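(* Let $q,r\ge 0$ with $q+r\geq 2$ and let $\Gamma$ be a nonelementary subgroup of $G=\mathrm{PSL}(2,\mathbb{C})^q\times\mathrm{PSL}(2,\mathbb{R})^r$. Then: (1) the projective limit set $P_\Gamma$ is convex, in the sense that whenever $(x_1:\dots:x_{q+r})$ and $(y_1:\dots:y_{q+r})$ are points of $P_\Gamma$ with all $x_i,y_i>0$, the points $(x_1+\lambda y_1:\dots:x_{q+r}+\lambda y_{q+r})$, $\lambda>0$, all lie in $P_\Gamma$; (2) the closure of $P_\Gamma$ in $\mathbb{RP}^{q+r-1}$ equals the limit cone of $\Gamma$; (3) in particular the limit cone of $\Gamma$ is convex.
   Context: $G=\mathrm{PSL}(2,\mathbb{C})^q\times\mathrm{PSL}(2,\mathbb{R})^r$ acts componentwise by isometries on $X=(\mathbb{H}^3)^q\times(\mathbb{H}^2)^r$ (product metric); $p_i$ denotes the $i$-th coordinate projection, $i=1,\dots,q+r$. Elements of $\mathrm{PSL}(2,\mathbb{C})$ are elliptic, parabolic or loxodromic in the usual sense; hyperbolic means loxodromic with real trace. For $g\in\mathrm{PSL}(2,\mathbb{C})$, $\ell(g)$ is its translation length if $g$ is loxodromic and $0$ otherwise. An element $g=(g_1,\dots,g_{q+r})\in G$ is elliptic (resp. parabolic, loxodromic, hyperbolic) if all $g_i$ are, and mixed otherwise. A subgroup of $\mathrm{PSL}(2,\mathbb{C})$ is elementary if it has a finite orbit in $\mathbb{H}^3\cup\partial\mathbb{H}^3$, nonelementary otherwise. A subgroup $\Gamma\le G$ is nonelementary if every $p_i(\Gamma)$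 is nonelementary and for every mixed $g\in\Gamma$ each component $g_i$ is loxodromic or elliptic of infinite order. $\partial X$ is the geometric boundary (asymptote classes of unit-speed geodesic rays, cone topology). The limit set is $\mathcal{L}_\Gamma=\overline{\Gamma x}\cap\partial X$ ($x\in X$ arbitrary). A ray $\gamma$ is regular if all $p_i\circ\gamma$ are nonconstant; the regular boundary is identified with $(\partial\mathbb{H}^3)^q\times(\partial\mathbb{H}^2)^r\times\mathbb{RP}^{q+r-1}_+$, $[\gamma]\mapsto\big((p_i\circ\gamma)(+\infty)\big)_i\times\big(\|(p_1\circ\gamma)'\|:\dots:\|(p_{q+r}\circ\gamma)'\|\big)$, where $\mathbb{RP}^{q+r-1}_+=\{(w_1:\dots:w_{q+r}):w_i>0\ \forall i\}$. $\mathcal{L}^{reg}_\Gamma$ is $\mathcal{L}_\Gamma$ intersected with the regular boundary, and $P_\Gamma$ (projective limit set) is its projection to $\mathbb{RP}^{q+r-1}_+$. The limit cone of $\Gamma$ is the smallest closed cone in $\mathbb{R}^{q+r}$ containing all vectors $(\ell(g_1),\dots,\ell(g_{q+r}))$, $g\in\Gamma$ (equivalently, the smallest closed cone in the diagonal Cartan subspace containing $\log\lambda(\Gamma)$, $\lambda(g)$ the diagonal form of the hyperbolic Jordan component of $g$), identified with its image in $\mathbb{RP}^{q+r-1}$. *)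

theory Defs
  imports "HOL-Analysis.Analysis"
begin

section \<open>SL(2,C) matrices (a,b,c,d) = [[a,b],[c,d]]; PSL(2,C) realised as SL(2,C) modulo sign\<close>

type_synonym mat2 = "complex \<times> complex \<times> complex \<times> complex"

definition mdet :: "mat2 \<Rightarrow> complex" where
  "mdet g = (case g of (a,b,c,d) \<Rightarrow> a*d - b*c)"

definition mtr :: "mat2 \<Rightarrow> complex" where
  "mtr g = (case g of (a,b,c,d) \<Rightarrow> a + d)"

definition mmul :: "mat2 \<Rightarrow> mat2 \<Rightarrow> mat2" where
  "mmul g h = (case g of (a,b,c,d) \<Rightarrow> case h of (a',b',c',d') \<Rightarrow>
      (a*a' + b*c', a*b' + b*d', c*a' + d*c', c*b' + d*d'))"

definition minv :: "mat2 \<Rightarrow> mat2" where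
  "minv g = (case g of (a,b,c,d) \<Rightarrow> (d, -b, -c, a))"

definition mneg :: "mat2 \<Rightarrow> mat2" where
  "mneg g = (case g of (a,b,c,d) \<Rightarrow> (-a, -b, -c, -d))"

definition mid :: mat2 where "mid = (1, 0, 0, 1)"

definition mpow :: "mat2 \<Rightarrow> nat \<Rightarrow> mat2" where
  "mpow g k = ((mmul g) ^^ k) mid"

definition real_mat :: "mat2 \<Rightarrow> bool" where
  "real_mat g = (case g of (a,b,c,d) \<Rightarrow> a \<in> \<real> \<and> b \<in> \<real> \<and> c \<in> \<real> \<and> d \<in> \<real>)"

definition is_pm_id :: "mat2 \<Rightarrow> bool" where
  "is_pm_id g \<longleftrightarrow> g = mid \<or> g = mneg mid"

definition elliptic :: "mat2 \<Rightarrow> bool" where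
  "elliptic g \<longleftrightarrow> is_pm_id g \<or> (mtr g \<in> \<real> \<and> \<bar>Re (mtr g)\<bar> < 2)"

definition parabolic :: "mat2 \<Rightarrow> bool" where
  "parabolic g \<longleftrightarrow> \<not> is_pm_id g \<and> (mtr g)^2 = 4"

definition loxodromic :: "mat2 \<Rightarrow> bool" where
  "loxodromic g \<longleftrightarrow> \<not> (mtr g \<in> \<real> \<and> \<bar>Re (mtr g)\<bar> \<le> 2)"

definition finite_order :: "mat2 \<Rightarrow> bool" where
  "finite_order g \<longleftrightarrow> (\<exists>k>0. is_pm_id (mpow g k))"

section \<open>Hyperbolic 3-space (upper half space), H^2 as the vertical half plane over the reals\<close>

definition H3 :: "(complex \<times> real) set" where
  "H3 = {p. snd p > 0}"

definition dH :: "complex \<times> real \<Rightarrow> complex \<times> real \<Rightarrow> real" where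
  "dH p p' = (case p of (z,t) \<Rightarrow> case p' of (z',t') \<Rightarrow>
      arcosh (1 + ((cmod (z - z'))^2 + (t - t')^2) / (2 * t * t')))"

text \<open>Poincare extension of the Moebius map of g to the upper half space.\<close>
definition act :: "mat2 \<Rightarrow> complex \<times> real \<Rightarrow> complex \<times> real" where
  "act g p = (case g of (a,b,c,d) \<Rightarrow> case p of (z,t) \<Rightarrow>
     (let D = (cmod (c*z + d))^2 + (cmod c)^2 * t^2
      in (((a*z + b) * cnj (c*z + d) + a * cnj c * complex_of_real (t^2)) / complex_of_real D, t / D)))"

text \<open>Action on the boundary sphere C \<union> {\<infinity>}, \<infinity> = None.\<close>
definition mob :: "mat2 \<Rightarrow> complex option \<Rightarrow> complex option" where
  "mob g w = (case g of (a,b,c,d) \<Rightarrow> (case w of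
       None \<Rightarrow> (if c = 0 then None else Some (a / c))
     | Some z \<Rightarrow> (if c*z + d = 0 then None else Some ((a*z + b) / (c*z + d)))))"

definition elementary :: "mat2 set \<Rightarrow> bool" where
  "elementary H \<longleftrightarrow> (\<exists>p\<in>H3. finite ((\<lambda>h. act h p) ` H)) \<or> (\<exists>\<xi>. finite ((\<lambda>h. mob h \<xi>) ` H))"

definition tlen :: "mat2 \<Rightarrow> real" where
  "tlen g = (if loxodromic g then Inf ((\<lambda>p. dH p (act g p)) ` H3) else 0)"

section \<open>The group G and the space X; factors indexed by 'n, complex factors are those in Q\<close>

definition Gset :: "'n set \<Rightarrow> ('n \<Rightarrow> mat2) set" where
  "Gset Q = {g. \<forall>i. mdet (g i) = 1 \<and> (i \<notin> Q \<longrightarrow> real_mat (g i))}"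

text \<open>A subgroup of G = PSL(2,C)^Q x PSL(2,R)^(rest), represented by its full preimage in the
  corresponding product of SL(2)'s.\<close>
definition psl_subgroup :: "'n set \<Rightarrow> ('n \<Rightarrow> mat2) set \<Rightarrow> bool" where
  "psl_subgroup Q \<Gamma> \<longleftrightarrow> \<Gamma> \<subseteq> Gset Q \<and> (\<lambda>i. mid) \<in> \<Gamma>
     \<and> (\<forall>g\<in>\<Gamma>. \<forall>h\<in>\<Gamma>. (\<lambda>i. mmul (g i) (h i)) \<in> \<Gamma>)
     \<and> (\<forall>g\<in>\<Gamma>. (\<lambda>i. minv (g i)) \<in> \<Gamma>)
     \<and> (\<forall>g\<in>\<Gamma>. \<forall>S. (\<lambda>i. if i \<in> S then mneg (g i) else g i) \<in> \<Gamma>)"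

definition mixed :: "('n \<Rightarrow> mat2) \<Rightarrow> bool" where
  "mixed g \<longleftrightarrow> \<not> (\<forall>i. elliptic (g i)) \<and> \<not> (\<forall>i. parabolic (g i)) \<and> \<not> (\<forall>i. loxodromic (g i))"

definition nonelementary :: "('n \<Rightarrow> mat2) set \<Rightarrow> bool" where
  "nonelementary \<Gamma> \<longleftrightarrow> (\<forall>i. \<not> elementary ((\<lambda>g. g i) ` \<Gamma>))
     \<and> (\<forall>g\<in>\<Gamma>. mixed g \<longrightarrow> (\<forall>i. loxodromic (g i) \<or> (elliptic (g i) \<and> \<not> finite_order (g i))))"

definition Xsp :: "'n set \<Rightarrow> ('n \<Rightarrow> complex \<times> real) set" where
  "Xsp Q = {x. \<forall>i. x i \<in> H3 \<and> (i \<notin> Q \<longrightarrow> Im (fst (x i)) = 0)}"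

definition dX :: "('n::finite \<Rightarrow> complex \<times> real) \<Rightarrow> ('n \<Rightarrow> complex \<times> real) \<Rightarrow> real" where
  "dX x y = sqrt (\<Sum>i\<in>UNIV. (dH (x i) (y i))^2)"

definition actX :: "('n \<Rightarrow> mat2) \<Rightarrow> ('n \<Rightarrow> complex \<times> real) \<Rightarrow> ('n \<Rightarrow> complex \<times> real)" where
  "actX g x = (\<lambda>i. act (g i) (x i))"

definition geod_ray :: "'n set \<Rightarrow> (real \<Rightarrow> ('n::finite \<Rightarrow> complex \<times> real)) \<Rightarrow> bool" where
  "geod_ray Q c \<longleftrightarrow> (\<forall>t\<ge>0. c t \<in> Xsp Q) \<and> (\<forall>s\<ge>0. \<forall>t\<ge>0. dX (c s) (c t) = \<bar>s - t\<bar>)"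

text \<open>[c] lies in the closure of the orbit of x in the cone topology: every basic neighbourhood
  U(c,R,\<epsilon>) = {y. d(c 0, y) > R, d(\<pi>_R y, c R) < \<epsilon>} meets the orbit, where \<pi>_R y is the point
  at distance R from c 0 on the (unique) geodesic segment [c 0, y].\<close>
definition in_limit_set :: "'n set \<Rightarrow> ('n::finite \<Rightarrow> mat2) set \<Rightarrow> ('n \<Rightarrow> complex \<times> real)
     \<Rightarrow> (real \<Rightarrow> ('n \<Rightarrow> complex \<times> real)) \<Rightarrow> bool" where
  "in_limit_set Q \<Gamma> x c \<longleftrightarrow> geod_ray Q c \<and>
     (\<forall>R>0. \<forall>\<epsilon>>0. \<exists>g\<in>\<Gamma>. dX (c 0) (actX g x) > R \<and>
        (\<forall>p\<in>Xsp Q. dX (c 0) p = R \<and> dX p (actX g x) = dX (c 0) (actX g x) - R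
            \<longrightarrow> dX p (c R) < \<epsilon>))"

definition regular_ray :: "(real \<Rightarrow> ('n \<Rightarrow> complex \<times> real)) \<Rightarrow> bool" where
  "regular_ray c \<longleftrightarrow> (\<forall>i. \<exists>t\<ge>0. c t i \<noteq> c 0 i)"

text \<open>Speed of the i-th component (metric derivative = norm of the derivative).\<close>
definition comp_speed :: "(real \<Rightarrow> ('n \<Rightarrow> complex \<times> real)) \<Rightarrow> 'n \<Rightarrow> real" where
  "comp_speed c i = Lim (at_right 0) (\<lambda>h. dH (c 0 i) (c h i) / h)"

definition speed_vec :: "(real \<Rightarrow> ('n::finite \<Rightarrow> complex \<times> real)) \<Rightarrow> real ^ 'n" where
  "speed_vec c = (\<chi> i. comp_speed c i)"

text \<open>Projective limit set, points of RP_+ represented by their unit representatives.\<close>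
definition proj_limit_set :: "'n set \<Rightarrow> ('n::finite \<Rightarrow> mat2) set \<Rightarrow> ('n \<Rightarrow> complex \<times> real)
     \<Rightarrow> (real ^ 'n) set" where
  "proj_limit_set Q \<Gamma> x = {sgn (speed_vec c) | c. in_limit_set Q \<Gamma> x c \<and> regular_ray c}"

definition limit_cone :: "('n::finite \<Rightarrow> mat2) set \<Rightarrow> (real ^ 'n) set" where
  "limit_cone \<Gamma> = \<Inter> {C. closed C \<and> cone C \<and> (\<forall>g\<in>\<Gamma>. (\<chi> i. tlen (g i)) \<in> C)}"

end

theory Submission
  imports Defs
begin

text \<open>
  Up to bounded errors, the displacement of a base point under \<open>g\<close> is \<open>2 ln |g|\<close> with the Frobenius
  norm, and the translation length is \<open>2 ln |\<lambda>|\<close> for the dominant eigenvalue \<open>\<lambda>\<close>. Since all orbits on the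
  boundary spheres are infinite, B. H. Neumann's lemma on coverings of a group by cosets yields, for
  given points \<open>\<xi>\<close>, \<open>\<eta>\<close> in each factor, an element of \<open>\<Gamma>\<close> which moves \<open>\<xi>\<close> off \<open>\<eta>\<close> in all factors at once;
  by compactness finitely many elements \<open>f\<close> suffice, with uniform constants. Hence for all \<open>g\<close>, \<open>h\<close> in
  \<open>\<Gamma>\<close> some \<open>f\<close> satisfies \<open>|g f h| \<ge> \<epsilon> |g| |h|\<close> in every factor, and by the Cayley-Hamilton identity
  \<open>A\<^sup>2 = (tr A) A - 1\<close> for \<open>A = f g\<close> the vector of translation lengths of some \<open>f g\<close> is within a bounded
  distance of the displacement vector of \<open>g\<close>. Applied to products of powers this shows that the limit
  cone is convex and that its positive unit vectors are exactly the asymptotic directions of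
  displacement vectors, which by compactness of the spheres of directions form the projective limit
  set. The limit cone contains a positive vector, because a factor in which all translation lengths
  vanish would be bounded and so fix a point of hyperbolic space.
\<close>

section \<open>The Hermitian model and geodesics of hyperbolic space\<close>

text \<open>The obstacle is that one \<open>f\<close> must serve all factors at once: in a single
  factor infinite boundary orbits suffice, but elements that are good for different factors need not
  agree. The bad elements of one factor are empty or a coset of a point stabiliser of infinite
  index, and finitely many such cosets never cover the group. The trace enters because
  \<open>g f g\<close> is the inverse of \<open>f\<close> times the square of \<open>f g\<close>: if
  this product has size of order |g|^2, Cayley-Hamilton forces the trace of \<open>f g\<close> to
  have order at least |g|, and a large trace means a large translation length. Bounded errors are
  harmless since a cone sees only directions; they vanish after division by an exponent n or by the
  length of a displacement. Regular boundary points give only vectors with positive entries, so a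
  cone vector with zero entries has to be reached by adding small multiples of a positive one. The
  limit set is defined by a condition on all points at distance R on the segment to an orbit point.
  Placing a ray in it requires such points to be unique; using a ray in it requires one to
  exist.\<close>

lemma mmul_assoc: "mmul (mmul g h) k = mmul g (mmul h k)"
  by (cases g; cases h; cases k) (simp add: mmul_def algebra_simps)

lemma mmul_mid [simp]: "mmul mid g = g" "mmul g mid = g"
  by (cases g, simp add: mmul_def mid_def)+

lemma mdet_mmul: "mdet (mmul g h) = mdet g * mdet h"
  by (cases g; cases h) (simp add: mmul_def mdet_def algebra_simps)

lemma mdet_mid [simp]: "mdet mid = 1"
  by (simp add: mid_def mdet_def)

lemma mdet_minv: "mdet (minv g) = mdet g"
  by (cases g) (simp add: minv_def mdet_def algebra_simps)

lemma mmul_minv: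
  assumes "mdet g = 1"
  shows "mmul g (minv g) = mid" "mmul (minv g) g = mid"
  using assms by (cases g, simp add: mmul_def minv_def mid_def mdet_def algebra_simps)+

lemma minv_mmul: "minv (mmul g h) = mmul (minv h) (minv g)"
  by (cases g; cases h) (simp add: mmul_def minv_def algebra_simps)

lemma mtr_mmul_commute: "mtr (mmul g h) = mtr (mmul h g)"
  by (cases g; cases h) (simp add: mmul_def mtr_def algebra_simps)

lemma mpow_0 [simp]: "mpow g 0 = mid"
  by (simp add: mpow_def)

lemma mpow_Suc: "mpow g (Suc n) = mmul g (mpow g n)"
  by (simp add: mpow_def)

lemma mdet_mpow: "mdet g = 1 \<Longrightarrow> mdet (mpow g n) = 1"
  by (induction n) (auto simp: mpow_Suc mdet_mmul)

lemma norm_mat2_sq: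
  "(norm (a,b,c,d :: complex))\<^sup>2 = (cmod a)\<^sup>2 + (cmod b)\<^sup>2 + (cmod c)\<^sup>2 + (cmod d)\<^sup>2"
  by (simp add: norm_prod_def)

text \<open>Cauchy-Schwarz through Lagrange's identity: the added square is the defect between the
  two sides.\<close>

lemma cmod_bilinear_sq_le:
  "(cmod (a*x + b*y))\<^sup>2 \<le> ((cmod a)\<^sup>2 + (cmod b)\<^sup>2) * ((cmod x)\<^sup>2 + (cmod y)\<^sup>2)"
proof -
  have "cmod (a*x + b*y) \<le> cmod a * cmod x + cmod b * cmod y"
    by (metis norm_mult norm_triangle_ineq)
  then have "(cmod (a*x + b*y))\<^sup>2 \<le> (cmod a * cmod x + cmod b * cmod y)\<^sup>2"
    by (simp add: power_mono)
  also have "\<dots> \<le> (cmod a * cmod x + cmod b * cmod y)\<^sup>2 + (cmod a * cmod y - cmod b * cmod x)\<^sup>2"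
    by simp
  also have "\<dots> = ((cmod a)\<^sup>2 + (cmod b)\<^sup>2) * ((cmod x)\<^sup>2 + (cmod y)\<^sup>2)"
    by (simp add: power2_eq_square algebra_simps)
  finally show ?thesis .
qed

lemma norm_mmul_le: "norm (mmul g h) \<le> norm g * norm h"
proof -
  obtain a b c d where g: "g = (a,b,c,d)" by (cases g)
  obtain a' b' c' d' where h: "h = (a',b',c',d')" by (cases h)
  have "(norm (mmul g h))\<^sup>2 \<le> (norm g * norm h)\<^sup>2"
    using cmod_bilinear_sq_le[of a a' b c'] cmod_bilinear_sq_le[of a b' b d']
      cmod_bilinear_sq_le[of c a' d c'] cmod_bilinear_sq_le[of c b' d d']
    unfolding power_mult_distrib
    by (simp add: g h mmul_def norm_mat2_sq algebra_simps)
  then show ?thesis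
    by (meson mult_nonneg_nonneg norm_ge_zero power2_le_imp_le)
qed

lemma norm_minv: "norm (minv g) = norm g"
  by (cases g) (simp add: minv_def norm_prod_def)

text \<open>The determinant pairs the two rows, so the product of their squared norms is at least 1,
  and then so is the sum. The bound keeps all logarithms of norms nonnegative.\<close>

lemma norm_mat2_ge_1:
  assumes "mdet g = 1"
  shows "norm g \<ge> 1"
proof -
  obtain a b c d where g: "g = (a,b,c,d)" by (cases g)
  have "1 = cmod (a*d + b*(-c))" using assms by (simp add: g mdet_def)
  then have 1: "1 \<le> ((cmod a)\<^sup>2 + (cmod b)\<^sup>2) * ((cmod c)\<^sup>2 + (cmod d)\<^sup>2)"
    using cmod_bilinear_sq_le[of a d b "-c"] by (simp add: add.commute)
  have "X * Y < 1" if "X + Y < 1" "0 \<le> X" "0 \<le> Y" for X Y :: real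
    using that by (smt (verit) mult_left_le)
  then have "(norm g)\<^sup>2 \<ge> 1"
    using 1 unfolding g norm_mat2_sq
    by (smt (verit, best) zero_le_power2)
  then show ?thesis
    by (smt (verit) norm_ge_zero power_less_one_iff pos2)
qed

lemma of_real_cmod_sq: "(complex_of_real (cmod z))\<^sup>2 = z * cnj z"
  by (metis complex_norm_square of_real_power)

text \<open>The conjugate transpose, for the congruence of a Hermitian matrix by
  \<open>g\<close>.\<close>

definition madj :: "mat2 \<Rightarrow> mat2" where
  "madj g = (case g of (a,b,c,d) \<Rightarrow> (cnj a, cnj c, cnj b, cnj d))"

text \<open>The model of hyperbolic space by positive definite Hermitian matrices of determinant 1;
  there the isometries become congruences.\<close>
definition herm :: "complex \<times> real \<Rightarrow> mat2" where
  "herm p = (case p of (z,t) \<Rightarrow> (of_real (((cmod z)\<^sup>2 + t\<^sup>2) / t), z / of_real t, cnj z / of_real t,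
      of_real (1 / t)))"

text \<open>The hyperbolic cosine of the distance. It is rational in the coordinates and linear in
  the Hermitian matrix of each point, so computations are made with it rather than with
  \<open>dH\<close>.\<close>

definition coshd :: "complex \<times> real \<Rightarrow> complex \<times> real \<Rightarrow> real" where
  "coshd p q = (case p of (z,t) \<Rightarrow> case q of (w,s) \<Rightarrow>
     ((cmod (z - w))\<^sup>2 + t\<^sup>2 + s\<^sup>2) / (2 * t * s))"

lemma madj_mmul: "madj (mmul g h) = mmul (madj h) (madj g)"
  by (cases g; cases h) (simp add: mmul_def madj_def algebra_simps)

lemma mdet_madj: "mdet (madj g) = cnj (mdet g)"
  by (cases g) (simp add: madj_def mdet_def algebra_simps)

lemma act_denominator_pos:
  assumes "mdet (a,b,c,d) = 1" "t > 0"
  shows "(cmod (c*z + d))\<^sup>2 + (cmod c)\<^sup>2 * t\<^sup>2 > 0"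
proof (cases "c = 0")
  case True
  then show ?thesis using assms by (auto simp: mdet_def)
next
  case False
  then show ?thesis using assms by (simp add: add_nonneg_pos)
qed

lemma act_in_H3:
  assumes "mdet g = 1" "p \<in> H3"
  shows "act g p \<in> H3"
proof -
  obtain a b c d where g: "g = (a,b,c,d)" by (cases g)
  obtain z t where p: "p = (z,t)" by (cases p)
  show ?thesis using assms act_denominator_pos[of a b c d t z]
    by (auto simp: g p act_def H3_def Let_def)
qed

lemma herm_act:
  assumes "mdet g = 1" "p \<in> H3"
  shows "herm (act g p) = mmul g (mmul (herm p) (madj g))"
proof -
  obtain a b c d where g: "g = (a,b,c,d)" by (cases g)
  obtain z t where p: "p = (z,t)" by (cases p)
  have t: "t > 0" using assms by (simp add: p H3_def)
  define D where "D = (cmod (c*z + d))\<^sup>2 + (cmod c)\<^sup>2 * t\<^sup>2"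
  define w where "w = (a*z + b) * cnj (c*z + d) + a * cnj c * complex_of_real (t\<^sup>2)"
  define A where "A = (cmod (a*z + b))\<^sup>2 + (cmod a)\<^sup>2 * t\<^sup>2"
  have D: "D > 0" unfolding D_def using assms act_denominator_pos t by (simp add: g)
  have act: "act g p = (w / of_real D, t / D)"
    by (simp add: g p act_def Let_def D_def w_def)
  have Dc: "complex_of_real D = (c*z + d) * cnj (c*z + d) + c * cnj c * of_real t^2"
    unfolding D_def by (simp add: of_real_cmod_sq)
  have Ac: "complex_of_real A = (a*z + b) * cnj (a*z + b) + a * cnj a * of_real t^2"
    unfolding A_def by (simp add: of_real_cmod_sq)
  have det: "a*d - b*c = 1" using assms by (simp add: g mdet_def)
  have det': "cnj a * cnj d - cnj b * cnj c = 1"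
    by (metis complex_cnj_diff complex_cnj_mult complex_cnj_one det)
  \<comment> \<open>This says that the congruent matrix, with diagonal \<open>A / t\<close>,
    \<open>D / t\<close> and off-diagonal entry \<open>w / t\<close>, again has determinant
    1.\<close>
  have "w * cnj w + of_real t^2 = of_real A * of_real D"
  proof -
    have "of_real A * of_real D - w * cnj w
        = of_real t^2 * ((a*d - b*c) * (cnj a * cnj d - cnj b * cnj c))"
      unfolding Ac Dc w_def by (simp add: algebra_simps power2_eq_square)
    then show ?thesis by (simp add: det det' algebra_simps)
  qed
  then have "complex_of_real ((cmod w)\<^sup>2 + t\<^sup>2) = of_real (A * D)"
    by (simp add: of_real_cmod_sq)
  then have key: "(cmod w)\<^sup>2 + t\<^sup>2 = A * D"
    using of_real_eq_iff by blast
  have "((cmod (w / of_real D))\<^sup>2 + (t/D)\<^sup>2) / (t/D) = ((cmod w)\<^sup>2 + t\<^sup>2) / (t * D)"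
    using t D by (simp add: norm_divide field_simps power2_eq_square)
  also have "\<dots> = A / t" unfolding key using D by simp
  finally have e1: "((cmod (w / of_real D))\<^sup>2 + (t/D)\<^sup>2) / (t/D) = A / t" .
  have "herm (act g p) = (of_real (A / t), w / of_real t, cnj w / of_real t, of_real (D / t))"
    unfolding act herm_def prod.case e1 using D t by (simp add: field_simps)
  also have "\<dots> = mmul g (mmul (herm p) (madj g))"
    using t unfolding g p herm_def madj_def mmul_def
    by (simp add: Ac Dc w_def of_real_cmod_sq) (simp add: field_simps power2_eq_square)
  finally show ?thesis .
qed

lemma inj_on_herm: "inj_on herm H3"
proof (rule inj_onI)
  fix p q assume pq: "p \<in> H3" "q \<in> H3" "herm p = herm q"
  obtain z t where p: "p = (z,t)" by (cases p)
  obtain w s where q: "q = (w,s)" by (cases q)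
  have pos: "t > 0" "s > 0" using pq by (auto simp: p q H3_def)
  have "complex_of_real (1/t) = of_real (1/s)" "z / of_real t = w / of_real s"
    using pq(3) by (auto simp: p q herm_def)
  moreover have "t = s" using calculation(1) pos by (metis inverse_eq_divide inverse_eq_iff_eq of_real_eq_iff)
  ultimately show "p = q" using pos by (simp add: p q)
qed

text \<open>Congruence is visibly multiplicative and \<open>herm\<close> is injective, so the
  composition law needs no computation with the Poincare extension.\<close>

lemma act_mmul:
  assumes "mdet g = 1" "mdet h = 1" "p \<in> H3"
  shows "act (mmul g h) p = act g (act h p)"
proof (rule inj_onD[OF inj_on_herm])
  show "herm (act (mmul g h) p) = herm (act g (act h p))"
    using assms by (simp add: herm_act mdet_mmul act_in_H3 madj_mmul mmul_assoc)
qed (use assms in \<open>auto simp: mdet_mmul act_in_H3\<close>)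

lemma act_mid [simp]: "act mid p = p"
  by (cases p) (simp add: act_def mid_def)

text \<open>The right side is the polarised determinant, that is the Lorentz form on Hermitian
  matrices. Invariance of distance under the action then reduces to cyclicity of the trace.\<close>

lemma coshd_herm:
  assumes "p \<in> H3" "q \<in> H3"
  shows "complex_of_real (coshd p q) = mtr (mmul (herm p) (minv (herm q))) / 2"
proof -
  obtain z t where p: "p = (z,t)" by (cases p)
  obtain w s where q: "q = (w,s)" by (cases q)
  have "t > 0" "s > 0" using assms by (auto simp: p q H3_def)
  then show ?thesis
    unfolding p q coshd_def herm_def mmul_def minv_def mtr_def
    by (simp add: of_real_cmod_sq) (simp add: field_simps power2_eq_square)
qed

lemma coshd_act:
  assumes "mdet g = 1" "p \<in> H3" "q \<in> H3"
  shows "coshd (act g p) (act g q) = coshd p q"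
proof -
  let ?P = "herm p" and ?Q = "minv (herm q)" and ?A = "madj g"
  have A: "mdet ?A = 1" using assms by (simp add: mdet_madj)
  have "mtr (mmul (herm (act g p)) (minv (herm (act g q))))
      = mtr (mmul (mmul g (mmul ?P ?A)) (mmul (mmul (minv ?A) ?Q) (minv g)))"
    using assms by (simp add: herm_act minv_mmul)
  also have "\<dots> = mtr (mmul g (mmul (mmul ?P (mmul (mmul ?A (minv ?A)) ?Q)) (minv g)))"
    by (simp add: mmul_assoc)
  also have "\<dots> = mtr (mmul ?P ?Q)"
    using A assms(1) by (metis mmul_assoc mmul_mid(1,2) mmul_minv(1,2) mtr_mmul_commute)
  finally have "complex_of_real (coshd (act g p) (act g q)) = of_real (coshd p q)"
    using assms by (simp add: coshd_herm act_in_H3)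
  then show ?thesis using of_real_eq_iff by blast
qed

lemma coshd_alt:
  assumes "t > 0" "s > 0"
  shows "coshd (z,t) (w,s) = 1 + ((cmod (z - w))\<^sup>2 + (t - s)\<^sup>2) / (2 * t * s)"
  using assms by (simp add: coshd_def field_simps power2_eq_square)

lemma dH_coshd:
  assumes "p \<in> H3" "q \<in> H3"
  shows "dH p q = arcosh (coshd p q)"
  using assms by (cases p; cases q) (auto simp: H3_def dH_def coshd_alt)

lemma coshd_ge_1:
  assumes "p \<in> H3" "q \<in> H3"
  shows "coshd p q \<ge> 1"
  using assms by (cases p; cases q) (auto simp: H3_def coshd_alt)

lemma dH_nonneg:
  assumes "p \<in> H3" "q \<in> H3"
  shows "dH p q \<ge> 0"
  using assms coshd_ge_1 dH_coshd by simp

lemma cosh_dH: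
  assumes "p \<in> H3" "q \<in> H3"
  shows "cosh (dH p q) = coshd p q"
  using assms by (simp add: dH_coshd cosh_arcosh_real coshd_ge_1)

lemma coshd_commute: "coshd p q = coshd q p"
  by (cases p; cases q) (simp add: coshd_def norm_minus_commute algebra_simps)

lemma dH_commute:
  assumes "p \<in> H3" "q \<in> H3"
  shows "dH p q = dH q p"
  using assms dH_coshd coshd_commute by simp

lemma dH_act:
  assumes "mdet g = 1" "p \<in> H3" "q \<in> H3"
  shows "dH (act g p) (act g q) = dH p q"
  using assms by (simp add: dH_coshd act_in_H3 coshd_act)

lemma dH_eq_0_iff:
  assumes "p \<in> H3" "q \<in> H3"
  shows "dH p q = 0 \<longleftrightarrow> p = q"
proof -
  have "dH p q = 0 \<longleftrightarrow> coshd p q = 1"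
    by (metis assms cosh_0 cosh_dH dH_coshd arcosh_1)
  also have "\<dots> \<longleftrightarrow> p = q"
    using assms by (cases p; cases q)
      (auto simp: H3_def coshd_alt add_nonneg_eq_0_iff)
  finally show ?thesis .
qed

text \<open>The unit speed geodesic with initial point \<open>x\<close> and direction \<open>V\<close>. For \<open>x = (0,1)\<close> and \<open>V = (b,a)\<close>
  its Hermitian matrix is \<open>cosh s\<close> times the identity plus \<open>sinh s\<close> times the matrix with rows
  \<open>(a, b)\<close> and \<open>(cnj b, - a)\<close>.\<close>
definition geo :: "complex \<times> real \<Rightarrow> complex \<times> real \<Rightarrow> real \<Rightarrow> complex \<times> real" where
  "geo x V s = (fst x + of_real (snd x * sinh s / (cosh s - snd V * sinh s)) * fst V,
      snd x / (cosh s - snd V * sinh s))"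

lemma geo_denominator_pos:
  assumes "norm (V :: complex \<times> real) = 1"
  shows "cosh s - snd V * sinh s > 0"
proof -
  have "\<bar>snd V\<bar> \<le> 1" using assms norm_snd_le[of "snd V" "fst V"] by simp
  then have "snd V * sinh s \<le> \<bar>sinh s\<bar>"
    by (metis abs_ge_self abs_ge_zero abs_mult mult_left_le_one_le order_trans)
  also have "\<dots> < cosh s" by (smt (verit) cosh_real_abs sinh_less_cosh_real sinh_real_abs cosh_minus sinh_minus)
  finally show ?thesis by simp
qed

lemma geo_in_H3:
  assumes "x \<in> H3" "norm V = 1"
  shows "geo x V s \<in> H3"
  using assms geo_denominator_pos[of V s] by (simp add: geo_def H3_def)

lemma geo_0 [simp]: "geo x V 0 = x"
  by (simp add: geo_def)

text \<open>The hyperbolic law of cosines, \<open>V \<bullet> W\<close> being the cosine of the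
  angle at \<open>x\<close>. The triangle inequality, uniqueness of segments and continuity of
  geodesics are all read off from it.\<close>

lemma coshd_geo:
  assumes x: "x \<in> H3" and V: "norm V = 1" and W: "norm W = 1"
  shows "coshd (geo x V s) (geo x W t) = cosh s * cosh t - sinh s * sinh t * (V \<bullet> W)"
proof -
  obtain z0 t0 where x0: "x = (z0,t0)" by (cases x)
  obtain b a where Vb: "V = (b,a)" by (cases V)
  obtain b' a' where Wb: "W = (b',a')" by (cases W)
  define \<delta> where "\<delta> = cosh s - a * sinh s"
  define \<delta>' where "\<delta>' = cosh t - a' * sinh t"
  have pos: "t0 > 0" "\<delta> > 0" "\<delta>' > 0"
    using x geo_denominator_pos[OF V, of s] geo_denominator_pos[OF W, of t]
    by (auto simp: x0 Vb Wb H3_def \<delta>_def \<delta>'_def)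
  define u where "u = sinh s / \<delta>"
  define v where "v = sinh t / \<delta>'"
  have geo: "geo x V s = (z0 + of_real (t0 * u) * b, t0 / \<delta>)"
    "geo x W t = (z0 + of_real (t0 * v) * b', t0 / \<delta>')"
    by (auto simp: geo_def x0 Vb Wb \<delta>_def \<delta>'_def u_def v_def)
  have "(cmod (of_real (t0 * u) * b - of_real (t0 * v) * b'))\<^sup>2
     = t0\<^sup>2 * (u\<^sup>2 * (cmod b)\<^sup>2 + v\<^sup>2 * (cmod b')\<^sup>2 - 2 * u * v * (b \<bullet> b'))"
    unfolding cmod_power2 by (simp add: inner_complex_def) (simp add: algebra_simps power2_eq_square)
  then have "coshd (geo x V s) (geo x W t)
     = (t0\<^sup>2 * (u\<^sup>2 * (cmod b)\<^sup>2 + v\<^sup>2 * (cmod b')\<^sup>2 - 2 * u * v * (b \<bullet> b'))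
        + (t0 / \<delta>)\<^sup>2 + (t0 / \<delta>')\<^sup>2) / (2 * (t0 / \<delta>) * (t0 / \<delta>'))"
    unfolding geo coshd_def by simp
  also have "\<dots> = \<delta> * \<delta>' * (u\<^sup>2 * (cmod b)\<^sup>2 + v\<^sup>2 * (cmod b')\<^sup>2 - 2 * u * v * (b \<bullet> b')
        + 1 / \<delta>\<^sup>2 + 1 / \<delta>'\<^sup>2) / 2"
    using pos by (simp add: field_simps power2_eq_square)
  also have "\<dots> = (((sinh s)\<^sup>2 * (cmod b)\<^sup>2 + 1) / \<delta> * \<delta>' + ((sinh t)\<^sup>2 * (cmod b')\<^sup>2 + 1) / \<delta>' * \<delta>) / 2
       - sinh s * sinh t * (b \<bullet> b')"
    using pos unfolding u_def v_def by (simp add: field_simps power2_eq_square)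
  \<comment> \<open>As \<open>b\<close> has squared modulus \<open>1 - a\<^sup>2\<close>, the
    numerator is \<open>cosh\<^sup>2 - a\<^sup>2 sinh\<^sup>2\<close>, a difference of squares with
    \<open>\<delta>\<close> as one factor.\<close>
  also have "((sinh s)\<^sup>2 * (cmod b)\<^sup>2 + 1) / \<delta> = cosh s + a * sinh s"
  proof -
    have "(cmod b)\<^sup>2 = 1 - a\<^sup>2" using V by (simp add: Vb norm_prod_def)
    then have "(sinh s)\<^sup>2 * (cmod b)\<^sup>2 + 1 = (cosh s + a * sinh s) * \<delta>"
      using hyperbolic_pythagoras[of s]
      by (simp only: \<delta>_def) (simp add: algebra_simps power2_eq_square)
    then show ?thesis using pos by simp
  qed
  also have "((sinh t)\<^sup>2 * (cmod b')\<^sup>2 + 1) / \<delta>' = cosh t + a' * sinh t"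
  proof -
    have "(cmod b')\<^sup>2 = 1 - a'\<^sup>2" using W by (simp add: Wb norm_prod_def)
    then have "(sinh t)\<^sup>2 * (cmod b')\<^sup>2 + 1 = (cosh t + a' * sinh t) * \<delta>'"
      using hyperbolic_pythagoras[of t]
      by (simp only: \<delta>'_def) (simp add: algebra_simps power2_eq_square)
    then show ?thesis using pos by simp
  qed
  finally show ?thesis
    by (simp add: \<delta>_def \<delta>'_def Vb Wb algebra_simps)
qed

lemma dH_geo:
  assumes "x \<in> H3" "norm V = 1"
  shows "dH (geo x V s) (geo x V t) = \<bar>s - t\<bar>"
proof -
  have "V \<bullet> V = 1" using assms(2) by (simp add: norm_eq_sqrt_inner)
  then have "coshd (geo x V s) (geo x V t) = cosh \<bar>s - t\<bar>"
    using assms by (simp add: coshd_geo cosh_diff)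
  then show ?thesis using assms by (simp add: dH_coshd geo_in_H3 arcosh_cosh_real del: cosh_real_abs)
qed

text \<open>The last clause keeps the direction inside the vertical half plane, so that real factors
  are not left.\<close>

lemma polar_coordinates:
  assumes x: "x \<in> H3" and y: "y \<in> H3"
  obtains V where "norm V = 1" "geo x V (dH x y) = y"
    "Im (fst x) = 0 \<Longrightarrow> Im (fst y) = 0 \<Longrightarrow> Im (fst V) = 0"
proof (cases "x = y")
  case True
  then have "dH x y = 0" using x y dH_eq_0_iff by blast
  then show ?thesis using that[of "(0,1)"] True by (simp add: norm_prod_def)
next
  case False
  define T where "T = dH x y"
  have T: "T > 0" using False x y dH_eq_0_iff[OF x y] dH_nonneg[OF x y] by (simp add: T_def)
  obtain z0 t0 where x0: "x = (z0,t0)" by (cases x)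
  obtain z t where y0: "y = (z,t)" by (cases y)
  have pos: "t0 > 0" "t > 0" using x y by (auto simp: x0 y0 H3_def)
  \<comment> \<open>Solved from \<open>geo x (b,a) T = y\<close>: the height determines
    \<open>a\<close>, then the horizontal displacement determines \<open>b\<close>. That
    \<open>(b,a)\<close> is a unit vector is equivalent to \<open>T\<close> being the
    distance.\<close>
  define a where "a = (cosh T - t0/t) / sinh T"
  define b where "b = (z - z0) / of_real (t * sinh T)"
  have sh: "sinh T > 0" using T by simp
  have d: "cosh T - a * sinh T = t0 / t" using sh by (simp add: a_def)
  have coshT: "cosh T = ((cmod (z - z0))\<^sup>2 + t0\<^sup>2 + t\<^sup>2) / (2 * t0 * t)"
    using cosh_dH[OF x y] by (simp add: T_def x0 y0 coshd_def norm_minus_commute)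
  have b2: "(cmod b)\<^sup>2 = (cmod (z - z0))\<^sup>2 / (t\<^sup>2 * (sinh T)\<^sup>2)"
    by (simp add: b_def norm_divide power_divide power_mult_distrib norm_mult)
  have "(cmod (z - z0))\<^sup>2 = 2 * t0 * t * cosh T - t0\<^sup>2 - t\<^sup>2"
    using pos coshT by (simp add: field_simps)
  then have "(cmod b)\<^sup>2 = (2 * (t0/t) * cosh T - (t0/t)\<^sup>2 - 1) / (sinh T)\<^sup>2"
    using pos sh unfolding b2 by (simp add: field_simps power2_eq_square)
  then have "(cmod b)\<^sup>2 + a\<^sup>2 = ((cosh T)\<^sup>2 - 1) / (sinh T)\<^sup>2"
    by (simp only: a_def power_divide add_divide_distrib[symmetric])
      (simp add: power2_eq_square algebra_simps)
  then have "norm (b,a) = 1" using sh by (simp add: norm_prod_def cosh_square_eq)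
  moreover have "geo x (b,a) T = y"
    using pos sh by (simp add: geo_def x0 y0 d) (simp add: b_def)
  moreover have "Im (fst (b,a)) = 0" if "Im (fst x) = 0" "Im (fst y) = 0"
    using that by (simp add: b_def x0 y0 Im_divide_of_real del: of_real_mult)
  ultimately show ?thesis using that unfolding T_def by blast
qed

lemma inner_unit_abs_le_1:
  fixes V W :: "'a::real_inner"
  assumes "norm V = 1" "norm W = 1"
  shows "\<bar>V \<bullet> W\<bar> \<le> 1"
  using Cauchy_Schwarz_ineq2[of V W] assms by simp

text \<open>Law of cosines at the intermediate point \<open>x\<close>, where the cosine of the angle
  is at least -1.\<close>

lemma dH_triangle:
  assumes x: "x \<in> H3" and y: "y \<in> H3" and z: "z \<in> H3"
  shows "dH y z \<le> dH y x + dH x z"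
proof -
  obtain V where V: "norm V = 1" "geo x V (dH x y) = y" using polar_coordinates[OF x y] by metis
  obtain W where W: "norm W = 1" "geo x W (dH x z) = z" using polar_coordinates[OF x z] by metis
  have nn: "dH x y \<ge> 0" "dH x z \<ge> 0" using assms dH_nonneg by auto
  have "cosh (dH y z) = cosh (dH x y) * cosh (dH x z) - sinh (dH x y) * sinh (dH x z) * (V \<bullet> W)"
    using coshd_geo[OF x V(1) W(1), of "dH x y" "dH x z"] y z by (simp add: V W cosh_dH)
  also have "\<dots> \<le> cosh (dH x y) * cosh (dH x z) + sinh (dH x y) * sinh (dH x z) * 1"
  proof -
    have "(sinh (dH x y) * sinh (dH x z)) * (- (V \<bullet> W)) \<le> (sinh (dH x y) * sinh (dH x z)) * 1"
      using inner_unit_abs_le_1[OF V(1) W(1)] nn by (intro mult_left_mono) auto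
    then show ?thesis by simp
  qed
  also have "\<dots> = cosh (dH x y + dH x z)" by (simp add: cosh_add)
  finally show ?thesis
    using nn assms dH_nonneg dH_commute by (metis add_nonneg_nonneg cosh_real_nonneg_le_iff)
qed

text \<open>Equality in the triangle inequality forces cosine 1 in the law of cosines, hence equal
  unit directions.\<close>

lemma geo_unique:
  assumes x: "x \<in> H3" and V: "norm V = 1" and p: "p \<in> H3"
    and s: "dH x p = s" "dH p (geo x V t) = t - s"
  shows "p = geo x V s"
proof -
  have s0: "s \<ge> 0" "s \<le> t" using s dH_nonneg[OF x p] dH_nonneg[OF p geo_in_H3[OF x V, of t]] by auto
  show ?thesis
  proof (cases "s = 0")
    case True
    then show ?thesis using s dH_eq_0_iff[OF x p] by simp
  next
    case False
    obtain W where W: "norm W = 1" "geo x W s = p" using polar_coordinates[OF x p] s by metis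
    have "cosh (t - s) = cosh s * cosh t - sinh s * sinh t * (W \<bullet> V)"
      using coshd_geo[OF x W(1) V, of s t] cosh_dH[OF p geo_in_H3[OF x V, of t]] s by (simp add: W)
    then have "sinh s * sinh t * (W \<bullet> V) = sinh s * sinh t" by (simp add: cosh_diff mult.commute)
    moreover have "sinh s * sinh t \<noteq> 0" using False s0 by auto
    ultimately have "W \<bullet> V = 1" by simp
    then have "(norm (W - V))\<^sup>2 = 0"
      using W V by (simp add: power2_norm_eq_inner inner_diff inner_commute norm_eq_1)
    then show ?thesis using W by simp
  qed
qed

section \<open>Norms, eigenvalues and translation lengths\<close>

abbreviation base :: "complex \<times> real" where "base \<equiv> (0, 1)"

lemma base_in_H3 [simp]: "base \<in> H3"
  by (simp add: H3_def)

text \<open>The base point is the identity matrix in the Hermitian model, so its image is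
  \<open>g\<close> times its adjoint, whose trace is the squared Frobenius norm.\<close>

lemma coshd_base_act:
  assumes "mdet g = 1"
  shows "coshd base (act g base) = (norm g)\<^sup>2 / 2"
proof -
  obtain a b c d where g: "g = (a,b,c,d)" by (cases g)
  have h: "herm base = mid" "minv mid = mid"
    by (auto simp: herm_def mid_def minv_def)
  have "complex_of_real (coshd (act g base) base) = mtr (mmul g (madj g)) / 2"
    using assms by (simp add: coshd_herm act_in_H3 herm_act h)
  also have "\<dots> = of_real ((norm g)\<^sup>2 / 2)"
    unfolding g norm_mat2_sq by (simp add: mmul_def madj_def mtr_def of_real_cmod_sq)
  finally show ?thesis using of_real_eq_iff coshd_commute by metis
qed

text \<open>With d the displacement, exp d + exp (- d) is the squared norm, which therefore lies
  between exp d and 2 exp d.\<close>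

lemma dH_base_act_bounds:
  assumes "mdet g = 1"
  shows "dH base (act g base) \<le> 2 * ln (norm g)"
    and "2 * ln (norm g) \<le> dH base (act g base) + ln 2"
proof -
  let ?d = "dH base (act g base)"
  have H: "act g base \<in> H3" using assms by (simp add: act_in_H3)
  have d: "?d \<ge> 0" using H by (simp add: dH_nonneg)
  have n: "norm g \<ge> 1" using assms by (rule norm_mat2_ge_1)
  have e: "exp ?d + exp (- ?d) = (norm g)\<^sup>2"
    using cosh_dH[OF base_in_H3 H] coshd_base_act[OF assms] by (simp add: cosh_field_def)
  have l: "ln ((norm g)\<^sup>2) = 2 * ln (norm g)" using n by (simp add: ln_realpow)
  have "exp ?d \<le> (norm g)\<^sup>2" using e by (smt (verit) exp_ge_zero)
  then show "?d \<le> 2 * ln (norm g)" using n l by (metis exp_gt_zero ln_exp ln_mono)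
  have "exp (- ?d) \<le> exp ?d" using d by (subst exp_le_cancel_iff) simp
  then have "(norm g)\<^sup>2 \<le> exp (?d + ln 2)" using e by (simp add: exp_add del: exp_le_cancel_iff)
  then show "2 * ln (norm g) \<le> ?d + ln 2"
    using n l by (smt (verit) exp_gt_zero ln_exp ln_mono zero_less_power)
qed

section \<open>Linear action, eigenvalues and growth of powers\<close>

definition mapp :: "mat2 \<Rightarrow> complex \<times> complex \<Rightarrow> complex \<times> complex" where
  "mapp g v = (case g of (a,b,c,d) \<Rightarrow> (a * fst v + b * snd v, c * fst v + d * snd v))"

lemma mapp_mmul: "mapp (mmul g h) v = mapp g (mapp h v)"
  by (cases g; cases h) (simp add: mapp_def mmul_def algebra_simps)

lemma mapp_mid [simp]: "mapp mid v = v"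
  by (simp add: mapp_def mid_def)

lemma norm_complex_pair_sq: "(norm (v :: complex \<times> complex))\<^sup>2 = (cmod (fst v))\<^sup>2 + (cmod (snd v))\<^sup>2"
  by (simp add: norm_prod_def)

lemma norm_mapp_le: "norm (mapp g v) \<le> norm g * norm v"
proof -
  obtain a b c d where g: "g = (a,b,c,d)" by (cases g)
  have "(norm (mapp g v))\<^sup>2 \<le> (norm g * norm v)\<^sup>2"
    using cmod_bilinear_sq_le[of a "fst v" b "snd v"] cmod_bilinear_sq_le[of c "fst v" d "snd v"]
    unfolding power_mult_distrib
    by (simp add: g mapp_def norm_mat2_sq norm_complex_pair_sq algebra_simps)
  then show ?thesis
    by (meson mult_nonneg_nonneg norm_ge_zero power2_le_imp_le)
qed

lemma eigenvalue_exists: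
  obtains l :: complex where "cmod l \<ge> 1" "l + 1 / l = \<tau>"
proof -
  define s where "s = csqrt (\<tau>\<^sup>2 - 4)"
  define p where "p = (\<tau> + s) / 2"
  define q where "q = (\<tau> - s) / 2"
  have "s\<^sup>2 = \<tau>\<^sup>2 - 4" by (simp add: s_def)
  then have pq: "p * q = 1" "p + q = \<tau>"
    by (simp_all add: p_def q_def field_simps power2_eq_square)
  then have "p \<noteq> 0" "q \<noteq> 0" by auto
  then have inv: "q = 1 / p" "p = 1 / q" using pq by (auto simp: field_simps)
  have "cmod p * cmod q = 1" using pq by (metis norm_mult norm_one)
  then have "cmod p \<ge> 1 \<or> cmod q \<ge> 1"
    by (metis less_le_not_le linorder_not_le mult_strict_mono' mult_1 norm_ge_zero)
  moreover have "p + 1 / p = \<tau>" "q + 1 / q = \<tau>"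
    using pq(2) by (simp_all add: inv[symmetric] add.commute)
  ultimately show ?thesis using that by blast
qed

lemma eigenvector_exists:
  assumes "mdet g = 1" "l \<noteq> 0" "l + 1 / l = mtr g"
  obtains v where "v \<noteq> 0" "mapp g v = (l * fst v, l * snd v)"
proof -
  obtain a b c d where g: "g = (a,b,c,d)" by (cases g)
  have "l * l + 1 = (a + d) * l" using assms by (simp add: g mtr_def field_simps)
  moreover have "a * d - b * c = 1" using assms by (simp add: g mdet_def)
  ultimately have det: "(a - l) * (d - l) = b * c" by (simp add: algebra_simps)
  \<comment> \<open>The candidates \<open>(b, l - a)\<close> and \<open>(l - d, c)\<close> are
    eigenvectors unless zero; if both vanish, then \<open>(1, 0)\<close> is one.\<close>
  show ?thesis
  proof (cases "b = 0 \<and> a = l")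
    case False
    show ?thesis
    proof (rule that[of "(b, l - a)"])
      show "(b, l - a) \<noteq> 0" using False by (auto simp: zero_prod_def)
      show "mapp g (b, l - a) = (l * fst (b, l - a), l * snd (b, l - a))"
        using det by (simp add: g mapp_def algebra_simps)
    qed
  next
    case True
    show ?thesis
    proof (cases "c = 0 \<and> d = l")
      case False
      show ?thesis
      proof (rule that[of "(l - d, c)"])
        show "(l - d, c) \<noteq> 0" using False by (auto simp: zero_prod_def)
        show "mapp g (l - d, c) = (l * fst (l - d, c), l * snd (l - d, c))"
          using det by (simp add: g mapp_def algebra_simps)
      qed
    next
      case c: True
      show ?thesis
        by (rule that[of "(1, 0)"]) (use True c in \<open>auto simp: g mapp_def zero_prod_def\<close>)
    qed
  qed
qed

lemma norm_mpow_ge: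
  assumes "mdet g = 1" "l \<noteq> 0" "l + 1 / l = mtr g"
  shows "cmod l ^ n \<le> norm (mpow g n)"
proof -
  obtain v where v: "v \<noteq> 0" "mapp g v = (l * fst v, l * snd v)"
    using eigenvector_exists[OF assms] .
  have lin: "mapp g (r * fst v, r * snd v) = (r * l * fst v, r * l * snd v)" for r
  proof -
    obtain a b c d where g: "g = (a,b,c,d)" by (cases g)
    have "mapp g (r * fst v, r * snd v) = (r * fst (mapp g v), r * snd (mapp g v))"
      by (simp add: g mapp_def algebra_simps)
    then show ?thesis by (simp add: v mult.assoc)
  qed
  have "mapp (mpow g n) v = (l ^ n * fst v, l ^ n * snd v)"
    by (induction n) (simp_all add: mpow_Suc mapp_mmul lin mult.commute[of l])
  moreover have "norm (l ^ n * fst v, l ^ n * snd v) = cmod l ^ n * norm v"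
    by (rule power2_eq_imp_eq)
      (simp_all add: norm_complex_pair_sq norm_mult norm_power power_mult_distrib algebra_simps)
  ultimately have "cmod l ^ n * norm v \<le> norm (mpow g n) * norm v"
    using norm_mapp_le[of "mpow g n" v] by simp
  then show ?thesis using v by simp
qed

lemma mpow_Suc2: "mpow g (Suc n) = mmul (mpow g n) g"
  by (induction n) (simp_all add: mpow_Suc mmul_assoc[symmetric])

definition msc :: "complex \<Rightarrow> mat2 \<Rightarrow> mat2" where
  "msc r g = (case g of (a,b,c,d) \<Rightarrow> (r*a, r*b, r*c, r*d))"

lemma norm_msc: "norm (msc r g) = cmod r * norm g"
proof (rule power2_eq_imp_eq)
  show "(norm (msc r g))\<^sup>2 = (cmod r * norm g)\<^sup>2"
    by (cases g) (simp add: msc_def norm_mat2_sq power_mult_distrib norm_mult algebra_simps)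
qed auto

text \<open>The factor \<open>n\<close> is needed for parabolic elements, which are not
  diagonalisable; it disappears in the limit of the logarithm divided by \<open>n\<close>.\<close>

lemma norm_mpow_le:
  assumes "mdet g = 1" "cmod l \<ge> 1" "l + 1 / l = mtr g"
  obtains K where "K > 0" "\<And>n. n > 0 \<Longrightarrow> norm (mpow g n) \<le> K * n * cmod l ^ n"
proof -
  obtain a b c d where g: "g = (a,b,c,d)" by (cases g)
  have l: "l \<noteq> 0" using assms by auto
  define B where "B = (a - 1/l, b, c, d - 1/l)"
  have tr: "a + d = l + 1/l" using assms by (simp add: g mtr_def)
  then have d: "d = l + 1/l - a" by (simp add: algebra_simps)
  have "a * d - b * c = 1" using assms by (simp add: g mdet_def)
  then have bc: "b * c = a * d - 1" by (simp add: algebra_simps)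
  \<comment> \<open>Cayley-Hamilton: \<open>g\<close> multiplies \<open>B = g - 1/l\<close> by \<open>l\<close>.\<close>
  have gB: "mmul g B = msc l B"
  proof -
    have e1: "a * (a - 1/l) + b * c = l * (a - 1/l)"
      unfolding bc d using l by (simp add: field_simps)
    have e2: "a * b + b * (d - 1/l) = l * b" "c * (a - 1/l) + d * c = l * c"
      unfolding d by (simp_all add: algebra_simps)
    have e3: "c * b + d * (d - 1/l) = l * (d - 1/l)"
      unfolding mult.commute[of c b] bc unfolding d using l by (simp add: field_simps)
    show ?thesis by (simp only: g B_def mmul_def msc_def prod.case e1 e2 e3)
  qed
  have gBn: "mmul (mpow g n) B = msc (l ^ n) B" for n
  proof (induction n)
    case 0
    then show ?case by (simp add: msc_def B_def)
  next
    case (Suc n)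
    have "mmul (mpow g (Suc n)) B = mmul g (msc (l ^ n) B)"
      by (simp add: mpow_Suc mmul_assoc Suc)
    also have "\<dots> = msc (l ^ n) (mmul g B)"
      by (simp add: g B_def mmul_def msc_def algebra_simps)
    also have "\<dots> = msc (l ^ Suc n) B"
      unfolding gB by (simp add: B_def msc_def algebra_simps)
    finally show ?case .
  qed
  have step: "norm (mpow g (Suc n)) \<le> cmod l ^ n * norm B + norm (mpow g n)" for n
  proof -
    \<comment> \<open>Splitting \<open>g\<close> as \<open>B + 1/l\<close> gives a recursion whose
      first term is known exactly and whose second term does not grow, since \<open>1/l\<close> has
      modulus at most 1.\<close>
    have "mmul h g = mmul h B + msc (1/l) h" for h
      by (cases h) (simp add: g B_def mmul_def msc_def algebra_simps)
    then have "mpow g (Suc n) = msc (l ^ n) B + msc (1/l) (mpow g n)"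
      unfolding mpow_Suc2 gBn by (metis gBn)
    then have "norm (mpow g (Suc n)) \<le> cmod (l ^ n) * norm B + cmod (1/l) * norm (mpow g n)"
      by (metis norm_msc norm_triangle_ineq)
    moreover have "cmod (1/l) * norm (mpow g n) \<le> 1 * norm (mpow g n)"
      using assms(2) l by (intro mult_right_mono) (auto simp: norm_divide)
    ultimately show ?thesis by (simp add: norm_power)
  qed
  have bound: "norm (mpow g n) \<le> (norm mid + n * norm B) * cmod l ^ n" for n
  proof (induction n)
    case (Suc n)
    have "cmod l ^ n \<le> cmod l ^ Suc n" using assms(2) by (intro power_increasing) auto
    then have "(norm mid + (n+1) * norm B) * cmod l ^ n \<le> (norm mid + (n+1) * norm B) * cmod l ^ Suc n"
      by (intro mult_left_mono) auto
    then show ?case using step[of n] Suc by (simp add: algebra_simps)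
  qed simp
  show ?thesis
  proof (rule that[of "norm mid + norm B"])
    show "norm mid + norm B > 0" by (simp add: mid_def add_pos_nonneg zero_prod_def)
    fix n :: nat assume "n > 0"
    then have "norm mid * 1 \<le> norm mid * n" by (intro mult_left_mono) auto
    then have "norm mid + n * norm B \<le> (norm mid + norm B) * n"
      by (simp add: algebra_simps)
    then show "norm (mpow g n) \<le> (norm mid + norm B) * n * cmod l ^ n"
      using bound[of n] by (meson mult_right_mono norm_ge_zero order_trans zero_le_power)
  qed
qed

lemma ln_norm_mpow_limit:
  assumes "mdet g = 1" "cmod l \<ge> 1" "l + 1 / l = mtr g"
  shows "(\<lambda>n. 2 * ln (norm (mpow g n)) / n) \<longlonglongrightarrow> 2 * ln (cmod l)"
proof -
  have l: "l \<noteq> 0" using assms by auto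
  obtain K where K: "K > 0" "\<And>n. n > 0 \<Longrightarrow> norm (mpow g n) \<le> K * n * cmod l ^ n"
    using norm_mpow_le[OF assms] by metis
  have up: "\<forall>\<^sub>F n in sequentially. 2 * ln (norm (mpow g n)) / n
      \<le> 2 * (ln K * (1 / n)) + 2 * (ln (real n) / n) + 2 * ln (cmod l)"
  proof (rule eventually_sequentiallyI[of 1])
    fix n :: nat assume n: "n \<ge> 1"
    have "ln (norm (mpow g n)) \<le> ln (K * n * cmod l ^ n)"
      using K(2)[of n] n norm_mat2_ge_1[OF mdet_mpow[OF assms(1)], of n]
      by (intro ln_mono) auto
    also have "\<dots> = ln K + ln (real n) + n * ln (cmod l)"
      using K n l by (simp add: ln_mult ln_realpow)
    finally show "2 * ln (norm (mpow g n)) / n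
      \<le> 2 * (ln K * (1 / n)) + 2 * (ln (real n) / n) + 2 * ln (cmod l)"
      using n by (simp add: field_simps)
  qed
  have lo: "\<forall>\<^sub>F n in sequentially. 2 * ln (cmod l) \<le> 2 * ln (norm (mpow g n)) / n"
  proof (rule eventually_sequentiallyI[of 1])
    fix n :: nat assume n: "n \<ge> 1"
    have "ln (cmod l ^ n) \<le> ln (norm (mpow g n))"
      using norm_mpow_ge[OF assms(1) l assms(3), of n] l by (intro ln_mono) auto
    then show "2 * ln (cmod l) \<le> 2 * ln (norm (mpow g n)) / n"
      using n l by (simp add: ln_realpow field_simps)
  qed
  have "(\<lambda>n. 2 * (ln K * (1 / real n)) + 2 * (ln (real n) / n) + 2 * ln (cmod l))
      \<longlonglongrightarrow> 2 * (ln K * 0) + 2 * 0 + 2 * ln (cmod l)"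
    by (intro tendsto_intros lim_ln_over_n lim_1_over_n)
  then show ?thesis
    by (intro tendsto_sandwich[OF lo up tendsto_const]) simp
qed

text \<open>On the unit circle \<open>1 / l\<close> is \<open>cnj l\<close>, so the trace is twice a
  real part. Off it, a real trace forces \<open>l\<close> to be real, and then
  \<open>|l + 1 / l|\<close> exceeds 2.\<close>

lemma loxodromic_iff_eigenvalue:
  assumes "cmod l \<ge> 1" "l + 1 / l = mtr g"
  shows "loxodromic g \<longleftrightarrow> cmod l > 1"
proof
  assume lox: "loxodromic g"
  show "cmod l > 1"
  proof (rule ccontr)
    assume "\<not> cmod l > 1"
    then have l1: "cmod l = 1" using assms by simp
    then have "1 / l = cnj l"
      by (metis complex_div_cnj mult_1 power_one of_real_1 div_by_1)
    then have "mtr g = of_real (2 * Re l)"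
      using assms by (simp add: complex_add_cnj)
    moreover have "\<bar>Re l\<bar> \<le> 1" using l1 abs_Re_le_cmod[of l] by simp
    ultimately show False using lox by (simp add: loxodromic_def)
  qed
next
  assume l1: "cmod l > 1"
  show "loxodromic g"
    unfolding loxodromic_def
  proof
    assume tr: "mtr g \<in> \<real> \<and> \<bar>Re (mtr g)\<bar> \<le> 2"
    have inv: "1 / l = cnj l / of_real ((cmod l)\<^sup>2)"
      by (metis complex_div_cnj mult_1 of_real_power)
    have "Im (l + 1 / l) = Im l * (1 - 1 / (cmod l)\<^sup>2)"
      unfolding inv by (simp add: Im_divide_of_real algebra_simps del: of_real_power)
    moreover have "Im (l + 1/l) = 0" using tr assms by (simp add: complex_is_Real_iff)
    moreover have "(cmod l)\<^sup>2 > 1" using l1 by (simp add: one_less_power)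
    ultimately have "Im l = 0" by auto
    then obtain x where x: "l = of_real x" by (metis complex_is_Real_iff Reals_cases)
    then have x1: "\<bar>x\<bar> > 1" using l1 by simp
    have "mtr g = of_real (x + 1 / x)" using assms x by simp
    then have "\<bar>x + 1 / x\<bar> \<le> 2" using tr by simp
    moreover have "\<bar>x + 1 / x\<bar> = \<bar>x\<bar> + 1 / \<bar>x\<bar>"
    proof (cases "x > 0")
      case False
      then have "x + 1 / x < 0" using x1 by (simp add: add_neg_neg)
      then show ?thesis using False by simp
    qed simp
    moreover have "\<bar>x\<bar> + 1 / \<bar>x\<bar> - 2 = (\<bar>x\<bar> - 1)\<^sup>2 / \<bar>x\<bar>"
      using x1 by (simp add: field_simps power2_eq_square)
    moreover have "(\<bar>x\<bar> - 1)\<^sup>2 / \<bar>x\<bar> > 0" using x1 by auto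
    ultimately show False by linarith
  qed
qed

lemma dH_mpow_le:
  assumes "mdet g = 1" "p \<in> H3"
  shows "dH p (act (mpow g n) p) \<le> n * dH p (act g p)"
proof (induction n)
  case 0
  then show ?case using assms dH_eq_0_iff[of p p] by simp
next
  case (Suc n)
  have H: "act g p \<in> H3" "act (mpow g n) p \<in> H3" "act (mpow g (Suc n)) p \<in> H3"
    using assms by (auto simp: act_in_H3 mdet_mpow)
  have "dH p (act (mpow g (Suc n)) p) \<le> dH p (act g p) + dH (act g p) (act (mpow g (Suc n)) p)"
    using H assms by (intro dH_triangle) auto
  also have "dH (act g p) (act (mpow g (Suc n)) p) = dH p (act (mpow g n) p)"
    using assms H by (simp add: mpow_Suc act_mmul mdet_mpow dH_act)
  finally show ?case using Suc by (simp add: algebra_simps)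
qed

lemma dH_base_change:
  assumes "mdet g = 1" "p \<in> H3" "q \<in> H3"
  shows "dH p (act g p) \<le> 2 * dH p q + dH q (act g q)"
proof -
  have H: "act g p \<in> H3" "act g q \<in> H3" using assms by (auto simp: act_in_H3)
  have "dH p (act g p) \<le> dH p q + dH q (act g p)"
    using assms H by (intro dH_triangle) auto
  also have "dH q (act g p) \<le> dH q (act g q) + dH (act g q) (act g p)"
    using assms H by (intro dH_triangle) auto
  also have "dH (act g q) (act g p) = dH p q"
    using assms by (simp add: dH_act dH_commute)
  finally show ?thesis by simp
qed

text \<open>A smaller displacement at \<open>p\<close> would make the powers of \<open>g\<close>
  move \<open>p\<close> at most linearly with too small a slope, against their growth rate at the
  base point; the change of base point costs a constant.\<close>

lemma displacement_ge:
  assumes "mdet g = 1" "cmod l \<ge> 1" "l + 1 / l = mtr g" "p \<in> H3"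
  shows "2 * ln (cmod l) \<le> dH p (act g p)"
proof (rule ccontr)
  assume "\<not> ?thesis"
  then have pos: "2 * ln (cmod l) - dH p (act g p) > 0" by simp
  have l: "l \<noteq> 0" using assms by auto
  obtain n :: nat where n: "n * (2 * ln (cmod l) - dH p (act g p)) > 2 * dH base p + ln 2"
    using reals_Archimedean3[OF pos] by auto
  have "n * ln (cmod l) = ln (cmod l ^ n)" using l by (simp add: ln_realpow)
  also have "\<dots> \<le> ln (norm (mpow g n))"
    using norm_mpow_ge[OF assms(1) l assms(3), of n] l by (intro ln_mono) auto
  finally have "2 * (n * ln (cmod l)) \<le> dH base (act (mpow g n) base) + ln 2"
    using dH_base_act_bounds(2)[OF mdet_mpow[OF assms(1)], of n] by linarith
  also have "\<dots> \<le> 2 * dH base p + n * dH p (act g p) + ln 2"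
    using dH_base_change[OF mdet_mpow[OF assms(1)] base_in_H3 assms(4), of n]
      dH_mpow_le[OF assms(1,4), of n] by linarith
  finally show False using n by (simp add: algebra_simps)
qed

text \<open>The diagonal matrix \<open>h\<close> moves the base point along its axis. The matrix
  \<open>k\<close> of eigenvectors conjugates \<open>h\<close> to \<open>g\<close>, and dividing its
  first column by \<open>\<delta>\<close> makes its determinant 1.\<close>

lemma axis_exists:
  assumes "mdet g = 1" "cmod l > 1" "l + 1 / l = mtr g"
  obtains p where "p \<in> H3" "dH p (act g p) = 2 * ln (cmod l)"
proof -
  have l: "l \<noteq> 0" using assms by auto
  \<comment> \<open>The eigenvalues \<open>l\<close> and \<open>1 / l\<close> differ, hence the two
    eigenvectors are independent and \<open>\<delta>\<close> is nonzero.\<close>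
  have ll: "l * l \<noteq> 1"
  proof
    assume "l * l = 1"
    then have "(cmod l)\<^sup>2 = 1" by (metis norm_mult norm_one power2_eq_square)
    then show False using assms(2) one_less_power[of "cmod l" 2] by simp
  qed
  obtain a b c d where g: "g = (a,b,c,d)" by (cases g)
  obtain v1 v2 where v: "(v1,v2) \<noteq> 0" "mapp g (v1,v2) = (l * v1, l * v2)"
    using eigenvector_exists[OF assms(1) l assms(3)] by (metis prod.collapse)
  obtain w1 w2 where w: "(w1,w2) \<noteq> 0" "mapp g (w1,w2) = (1/l * w1, 1/l * w2)"
  proof -
    have "1/l \<noteq> 0" "1/l + 1 / (1/l) = mtr g" using l assms(3) by (auto simp: add.commute)
    from eigenvector_exists[OF assms(1) this] show ?thesis using that by (metis prod.collapse)
  qed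
  have v': "a * v1 + b * v2 = l * v1" "c * v1 + d * v2 = l * v2"
    using v by (auto simp: g mapp_def)
  have w': "a * w1 + b * w2 = w1 / l" "c * w1 + d * w2 = w2 / l"
    using w by (auto simp: g mapp_def)
  define \<delta> where "\<delta> = v1 * w2 - v2 * w1"
  have \<delta>: "\<delta> \<noteq> 0"
  proof
    assume "\<delta> = 0"
    then have e: "v1 * w2 = v2 * w1" by (simp add: \<delta>_def)
    obtain k where k: "w1 = k * v1" "w2 = k * v2"
    proof (cases "v1 = 0")
      case True
      then have "v2 \<noteq> 0" using v by (auto simp: zero_prod_def)
      then show ?thesis using that[of "w2 / v2"] True e by simp
    next
      case False
      then show ?thesis using that[of "w1 / v1"] e by (simp add: field_simps)
    qed
    have "w1 / l = l * w1" "w2 / l = l * w2"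
    proof -
      have "w1 / l = k * (a * v1 + b * v2)" "w2 / l = k * (c * v1 + d * v2)"
        using w' by (simp_all add: k algebra_simps)
      then show "w1 / l = l * w1" "w2 / l = l * w2" by (simp_all add: v' k)
    qed
    then have "w1 * (l * l - 1) = 0" "w2 * (l * l - 1) = 0"
      using l by (auto simp: field_simps)
    then show False using ll w by (auto simp: zero_prod_def)
  qed
  define k where "k = (v1 / \<delta>, w1, v2 / \<delta>, w2)"
  define h where "h = (l, 0 :: complex, 0 :: complex, 1 / l)"
  have k1: "mdet k = 1" using \<delta> by (simp add: k_def mdet_def field_simps) (simp add: \<delta>_def)
  have h1: "mdet h = 1" using l by (simp add: h_def mdet_def)
  have gk: "mmul g k = mmul k h"
    using v' w' \<delta> l by (simp add: g k_def h_def mmul_def add_divide_distrib[symmetric] mult.commute)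
  have "dH (act k base) (act g (act k base)) = dH (act k base) (act k (act h base))"
    using assms(1) k1 h1 by (simp add: act_mmul[symmetric] gk)
  also have "\<dots> = dH base (act h base)" using k1 h1 by (simp add: dH_act act_in_H3)
  also have "\<dots> = arcosh ((norm h)\<^sup>2 / 2)" using h1 by (simp add: dH_coshd act_in_H3 coshd_base_act)
  also have "(norm h)\<^sup>2 / 2 = cosh (ln ((cmod l)\<^sup>2))"
    using l by (simp add: cosh_ln_real h_def norm_mat2_sq norm_divide power_divide inverse_eq_divide)
  also have "arcosh \<dots> = ln ((cmod l)\<^sup>2)"
    using assms(2) by (intro arcosh_cosh_real) (simp add: one_le_power)
  also have "\<dots> = 2 * ln (cmod l)" using l by (simp add: ln_realpow)
  finally show ?thesis using that[of "act k base"] k1 by (simp add: act_in_H3)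
qed

lemma tlen_eq_eigenvalue:
  assumes "mdet g = 1" "cmod l \<ge> 1" "l + 1 / l = mtr g"
  shows "tlen g = 2 * ln (cmod l)"
proof (cases "loxodromic g")
  case True
  then have "cmod l > 1" using loxodromic_iff_eigenvalue assms by blast
  then obtain p where p: "p \<in> H3" "dH p (act g p) = 2 * ln (cmod l)"
    using axis_exists assms by metis
  have "Inf ((\<lambda>p. dH p (act g p)) ` H3) = 2 * ln (cmod l)"
    by (rule cInf_eq_minimum) (use p displacement_ge[OF assms] in \<open>force+\<close>)
  then show ?thesis using True by (simp add: tlen_def)
next
  case False
  then have "cmod l = 1" using loxodromic_iff_eigenvalue[OF assms(2,3)] assms(2) by simp
  then show ?thesis using False by (simp add: tlen_def)
qed

lemma tlen_nonneg:
  assumes "mdet g = 1"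
  shows "tlen g \<ge> 0"
proof -
  obtain l where "cmod l \<ge> 1" "l + 1 / l = mtr g" using eigenvalue_exists .
  then show ?thesis using tlen_eq_eigenvalue[OF assms] by simp
qed

lemma tlen_le_norm:
  assumes "mdet g = 1"
  shows "tlen g \<le> 2 * ln (norm g)"
proof -
  obtain l where l: "cmod l \<ge> 1" "l + 1 / l = mtr g" using eigenvalue_exists .
  then have "l \<noteq> 0" by auto
  have "cmod l \<le> norm g"
    using norm_mpow_ge[OF assms \<open>l \<noteq> 0\<close> l(2), of 1] by (simp add: mpow_def)
  then have "ln (cmod l) \<le> ln (norm g)" using \<open>l \<noteq> 0\<close> by (intro ln_mono) auto
  then show ?thesis using tlen_eq_eigenvalue[OF assms l] by simp
qed

text \<open>Serves to turn a lower bound for the trace into one for the translation length.\<close>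

lemma mtr_le_exp_tlen:
  assumes "mdet g = 1"
  shows "cmod (mtr g) \<le> 2 * exp (tlen g / 2)"
proof -
  obtain l where l: "cmod l \<ge> 1" "l + 1 / l = mtr g" using eigenvalue_exists .
  then have "l \<noteq> 0" by auto
  have "cmod (mtr g) \<le> cmod l + cmod (1 / l)" using l by (metis norm_triangle_ineq)
  also have "cmod (1 / l) \<le> 1" using l \<open>l \<noteq> 0\<close> by (simp add: norm_divide)
  finally have "cmod (mtr g) \<le> 2 * cmod l" using l by simp
  moreover have "exp (tlen g / 2) = cmod l"
    using tlen_eq_eigenvalue[OF assms l] \<open>l \<noteq> 0\<close> by simp
  ultimately show ?thesis by simp
qed

lemma ln_norm_mpow_tendsto_tlen:
  assumes "mdet g = 1"
  shows "(\<lambda>n. 2 * ln (norm (mpow g n)) / n) \<longlonglongrightarrow> tlen g"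
proof -
  obtain l where l: "cmod l \<ge> 1" "l + 1 / l = mtr g" using eigenvalue_exists .
  then show ?thesis using ln_norm_mpow_limit tlen_eq_eigenvalue assms by simp
qed

section \<open>Generic elements of nonelementary groups\<close>

text \<open>B. H. Neumann's lemma: a group is not a finite union of cosets of subgroups of infinite index.
  The cosets are those of the stabilisers of the points \<open>\<beta> j\<close>.\<close>
lemma neumann_avoidance:
  fixes G :: "('i \<Rightarrow> 's \<Rightarrow> 's) set" and \<beta> :: "'i \<Rightarrow> 's"
  assumes comp: "\<And>g h. g \<in> G \<Longrightarrow> h \<in> G \<Longrightarrow> (\<lambda>i. g i \<circ> h i) \<in> G"
    and inv: "\<And>g. g \<in> G \<Longrightarrow> \<exists>h\<in>G. \<forall>i s. h i (g i s) = s \<and> g i (h i s) = s"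
    and ne: "G \<noteq> {}"
    and inf: "\<And>i. i \<in> J \<Longrightarrow> infinite ((\<lambda>g. g i (\<beta> i)) ` G)"
    and "finite J" and "\<And>j. finite (E j)"
  shows "\<exists>g\<in>G. \<forall>j\<in>J. g j (\<beta> j) \<notin> E j"
  using assms(5,6) inf
proof (induction J arbitrary: E rule: finite_induct)
  case empty
  then show ?case using ne by auto
next
  case (insert n J)
  show ?case
  proof (rule ccontr)
    assume cover: "\<not> (\<exists>g\<in>G. \<forall>j\<in>insert n J. g j (\<beta> j) \<notin> E j)"
    have "\<not> (\<lambda>g. g n (\<beta> n)) ` G \<subseteq> E n"
      using insert.prems finite_subset by blast
    then obtain x where x: "x \<in> G" "x n (\<beta> n) \<notin> E n" by auto
    define P where "P e y \<longleftrightarrow> y \<in> G \<and> y n (\<beta> n) = e" for e y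
    define y where "y e = (SOME y. P e y)" for e
    have y: "P e (y e)" if "P e z" for e z unfolding y_def using that by (rule someI[where P = "P e"])
    obtain x' where x': "x' \<in> G" "\<forall>i s. x' i (x i s) = s \<and> x i (x' i s) = s"
      using inv[OF x(1)] by auto
    \<comment> \<open>Suppose \<open>g\<close> is bad only at \<open>n\<close>, with value
      \<open>e\<close>. Then \<open>x\<close> times the inverse of \<open>y e\<close> times
      \<open>g\<close> takes the value \<open>x n (\<beta> n)\<close> at \<open>n\<close>, which is
      allowed, so it must be bad at some \<open>j\<close> in \<open>J\<close>; translating back puts
      \<open>g j (\<beta> j)\<close> into the image of \<open>E j\<close>. The enlarged sets are
      still finite, so induction yields a \<open>g\<close> for which this is impossible.\<close>
    define E' where "E' j = E j \<union> (\<Union>e\<in>E n. (\<lambda>s. y e j (x' j s)) ` E j)" for j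
    have "finite (E' j)" for j unfolding E'_def using insert.prems by auto
    then obtain g where g: "g \<in> G" "\<forall>j\<in>J. g j (\<beta> j) \<notin> E' j"
      using insert.IH[of E'] insert.prems by auto
    define e where "e = g n (\<beta> n)"
    have e: "e \<in> E n" using cover g unfolding e_def E'_def by auto
    have ye: "y e \<in> G" "y e n (\<beta> n) = e" using y[of e g] g by (auto simp: P_def e_def)
    obtain y' where y': "y' \<in> G" "\<forall>i s. y' i (y e i s) = s \<and> y e i (y' i s) = s"
      using inv[OF ye(1)] by auto
    define h where "h = (\<lambda>i. x i \<circ> (y' i \<circ> g i))"
    have "h \<in> G" unfolding h_def using comp[OF x(1) comp[OF y'(1) g(1)]] .
    moreover have "y' n e = \<beta> n" using ye(2) y'(2) by metis
    then have "h n (\<beta> n) = x n (\<beta> n)" by (simp add: h_def e_def)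
    ultimately obtain j where j: "j \<in> J" "h j (\<beta> j) \<in> E j" using cover x by auto
    have "g j (\<beta> j) = y e j (x' j (h j (\<beta> j)))"
      unfolding h_def o_apply by (simp only: x'(2) y'(2))
    then have "g j (\<beta> j) \<in> E' j" using e j by (auto simp: E'_def)
    then show False using g j by blast
  qed
qed

section \<open>Boundary points as lines in complex 2-space\<close>

definition cpoint :: "complex \<times> complex \<Rightarrow> complex option" where
  "cpoint v = (if snd v = 0 then None else Some (fst v / snd v))"

lemma cpoint_surj: obtains v where "v \<noteq> 0" "cpoint v = \<xi>"
  using that[of "(1,0)"] that[of "(the \<xi>,1)"] by (cases \<xi>) (auto simp: cpoint_def zero_prod_def)

lemma mapp_nonzero:
  assumes "mdet g = 1" "v \<noteq> 0"
  shows "mapp g v \<noteq> 0"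
proof
  assume "mapp g v = 0"
  then have "mapp (minv g) (mapp g v) = 0" by (cases g) (simp add: mapp_def minv_def zero_prod_def)
  then show False using assms by (simp add: mapp_mmul[symmetric] mmul_minv)
qed

lemma mob_cpoint:
  assumes "mdet g = 1" "v \<noteq> 0"
  shows "mob g (cpoint v) = cpoint (mapp g v)"
proof -
  obtain a b c d where g: "g = (a,b,c,d)" by (cases g)
  obtain p q where v: "v = (p,q)" by (cases v)
  show ?thesis
  proof (cases "q = 0")
    case True
    then have "p \<noteq> 0" using assms v by (auto simp: zero_prod_def)
    then show ?thesis using True by (simp add: g v mob_def cpoint_def mapp_def)
  next
    case False
    have "c * (p / q) + d = (c * p + d * q) / q" "a * (p / q) + b = (a * p + b * q) / q"
      using False by (simp_all add: field_simps)
    then show ?thesis using False by (simp add: g v mob_def cpoint_def mapp_def)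
  qed
qed

lemma mob_mmul:
  assumes "mdet g = 1" "mdet h = 1"
  shows "mob (mmul g h) \<xi> = mob g (mob h \<xi>)"
proof -
  obtain v where "v \<noteq> 0" "cpoint v = \<xi>" by (rule cpoint_surj)
  then show ?thesis using assms by (auto simp: mob_cpoint mdet_mmul mapp_mmul mapp_nonzero)
qed

lemma mob_mid [simp]: "mob mid \<xi> = \<xi>"
  by (cases \<xi>) (auto simp: mob_def mid_def)

text \<open>Bilinear without conjugation, so that pairing with a matrix row gives an entry of the
  product. It vanishes exactly on the line of \<open>(- snd \<alpha>, fst \<alpha>)\<close>.\<close>

definition cbil :: "complex \<times> complex \<Rightarrow> complex \<times> complex \<Rightarrow> complex" where
  "cbil v w = fst v * fst w + snd v * snd w"

lemma cbil_eq_0_imp_cpoint: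
  assumes "\<alpha> \<noteq> 0" "v \<noteq> 0" "cbil \<alpha> v = 0"
  shows "cpoint v = cpoint (- snd \<alpha>, fst \<alpha>)"
proof -
  obtain a b where \<alpha>: "\<alpha> = (a,b)" by (cases \<alpha>)
  obtain p q where v: "v = (p,q)" by (cases v)
  have e: "a * p = - b * q" using assms(3) by (simp add: \<alpha> v cbil_def eq_neg_iff_add_eq_0)
  show ?thesis
  proof (cases "a = 0 \<or> q = 0")
    case True
    then have "a = 0 \<and> q = 0" using e assms by (auto simp: \<alpha> v zero_prod_def)
    then show ?thesis by (simp add: \<alpha> v cpoint_def)
  next
    case False
    then show ?thesis using e by (simp add: \<alpha> v cpoint_def field_simps)
  qed
qed

lemma psl_subgroup_mdet: "psl_subgroup Q \<Gamma> \<Longrightarrow> g \<in> \<Gamma> \<Longrightarrow> mdet (g i) = 1"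
  unfolding psl_subgroup_def Gset_def by blast

lemma psl_subgroup_mid: "psl_subgroup Q \<Gamma> \<Longrightarrow> (\<lambda>i. mid) \<in> \<Gamma>"
  unfolding psl_subgroup_def by (elim conjE)

lemma psl_subgroup_mmul:
  "psl_subgroup Q \<Gamma> \<Longrightarrow> g \<in> \<Gamma> \<Longrightarrow> h \<in> \<Gamma> \<Longrightarrow> (\<lambda>i. mmul (g i) (h i)) \<in> \<Gamma>"
  unfolding psl_subgroup_def by (elim conjE) (drule (1) bspec, drule (1) bspec, assumption)

lemma psl_subgroup_minv: "psl_subgroup Q \<Gamma> \<Longrightarrow> g \<in> \<Gamma> \<Longrightarrow> (\<lambda>i. minv (g i)) \<in> \<Gamma>"
  unfolding psl_subgroup_def by (elim conjE) (drule (1) bspec[where P = "\<lambda>g. (\<lambda>i. minv (g i)) \<in> \<Gamma>"])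

text \<open>A zero pairing says that \<open>f i\<close> sends the boundary point of
  \<open>\<beta> i\<close> to the annihilator of \<open>\<alpha> i\<close>; the avoidance lemma
  applies with these single points as exceptional sets.\<close>

lemma generic_element:
  fixes \<Gamma> :: "('n::finite \<Rightarrow> mat2) set"
  assumes \<Gamma>: "psl_subgroup Q \<Gamma>" and ne: "nonelementary \<Gamma>"
    and \<alpha>: "\<And>i. \<alpha> i \<noteq> 0" and \<beta>: "\<And>i. \<beta> i \<noteq> 0"
  shows "\<exists>f\<in>\<Gamma>. \<forall>i. cbil (\<alpha> i) (mapp (f i) (\<beta> i)) \<noteq> 0"
proof -
  note det = psl_subgroup_mdet[OF \<Gamma>]
  define G where "G = (\<lambda>g i. mob (g i)) ` \<Gamma>"
  have "\<exists>g\<in>G. \<forall>j\<in>UNIV. g j (cpoint (\<beta> j)) \<notin> {cpoint (- snd (\<alpha> j), fst (\<alpha> j))}"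
  proof (rule neumann_avoidance)
    fix g h assume g: "g \<in> G" and h: "h \<in> G"
    obtain g' where g': "g = (\<lambda>i. mob (g' i))" "g' \<in> \<Gamma>" using g unfolding G_def by (rule imageE)
    obtain h' where h': "h = (\<lambda>i. mob (h' i))" "h' \<in> \<Gamma>" using h unfolding G_def by (rule imageE)
    have "(\<lambda>i. g i \<circ> h i) = (\<lambda>i. mob (mmul (g' i) (h' i)))"
      by (simp add: fun_eq_iff g' h' mob_mmul det)
    then show "(\<lambda>i. g i \<circ> h i) \<in> G"
      using imageI[OF psl_subgroup_mmul[OF \<Gamma> g'(2) h'(2)], of "\<lambda>g i. mob (g i)"] by (simp only: G_def)
  next
    fix g assume g: "g \<in> G"
    obtain g' where g': "g = (\<lambda>i. mob (g' i))" "g' \<in> \<Gamma>" using g unfolding G_def by (rule imageE)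
    have 1: "(\<lambda>i. mob (minv (g' i))) \<in> G"
      using imageI[OF psl_subgroup_minv[OF \<Gamma> g'(2)], of "\<lambda>g i. mob (g i)"] by (simp only: G_def)
    have 2: "mob (minv (g' i)) (g i s) = s \<and> g i (mob (minv (g' i)) s) = s" for i s
      using det[OF g'(2), of i] by (simp add: g'(1) mob_mmul[symmetric] mdet_minv mmul_minv)
    show "\<exists>h\<in>G. \<forall>i s. h i (g i s) = s \<and> g i (h i s) = s"
      by (rule bexI[OF _ 1]) (intro allI 2)
  next
    show "G \<noteq> {}" using psl_subgroup_mid[OF \<Gamma>] unfolding G_def image_is_empty by (rule ex_in_conv[THEN iffD1, OF exI])
  next
    fix i :: 'n
    have "(\<lambda>g. g i (cpoint (\<beta> i))) ` G = (\<lambda>h. mob h (cpoint (\<beta> i))) ` (\<lambda>g. g i) ` \<Gamma>"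
      by (simp only: G_def image_image)
    moreover have "\<not> elementary ((\<lambda>g. g i) ` \<Gamma>)" using ne unfolding nonelementary_def by blast
    ultimately show "infinite ((\<lambda>g. g i (cpoint (\<beta> i))) ` G)"
      unfolding elementary_def by (simp only: de_Morgan_disj not_ex not_False_eq_True)
  qed auto
  then obtain f where f: "f \<in> \<Gamma>" "\<And>i. mob (f i) (cpoint (\<beta> i)) \<noteq> cpoint (- snd (\<alpha> i), fst (\<alpha> i))"
    unfolding G_def by blast
  have "cbil (\<alpha> i) (mapp (f i) (\<beta> i)) \<noteq> 0" for i
  proof
    assume "cbil (\<alpha> i) (mapp (f i) (\<beta> i)) = 0"
    from cbil_eq_0_imp_cpoint[OF \<alpha> mapp_nonzero[OF det[OF f(1)] \<beta>] this] f(2)[of i]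
    show False by (metis mob_cpoint[OF det[OF f(1)] \<beta>])
  qed
  then show ?thesis using f(1) by (intro bexI[of _ f] allI)
qed

text \<open>Pairs of families of unit vectors form a compact set, and the pairs for which
  \<open>f\<close> gives values above \<open>1 / Suc n\<close> in every factor form an open set;
  finitely many \<open>(f, n)\<close> cover.\<close>

lemma generic_element_uniform:
  fixes \<Gamma> :: "('n::finite \<Rightarrow> mat2) set"
  assumes "psl_subgroup Q \<Gamma>" "nonelementary \<Gamma>"
  obtains F \<epsilon> where "finite F" "F \<subseteq> \<Gamma>" "\<epsilon> > 0"
    "\<And>\<alpha> \<beta>. (\<And>i. norm (\<alpha> i) = 1) \<Longrightarrow> (\<And>i. norm (\<beta> i) = 1)
       \<Longrightarrow> \<exists>f\<in>F. \<forall>i. cmod (cbil (\<alpha> i) (mapp (f i) (\<beta> i))) > \<epsilon>"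
proof -
  define S where "S = {x :: ((complex \<times> complex) ^ 'n) \<times> ((complex \<times> complex) ^ 'n).
      \<forall>i. norm (fst x $ i) = 1 \<and> norm (snd x $ i) = 1}"
  define U where "U = (\<lambda>(f :: 'n \<Rightarrow> mat2, n :: nat).
      {x :: ((complex \<times> complex) ^ 'n) \<times> ((complex \<times> complex) ^ 'n).
        \<forall>i. cmod (cbil (fst x $ i) (mapp (f i) (snd x $ i))) > 1 / Suc n})"
  have cont: "continuous_on UNIV (\<lambda>x. cmod (cbil (fst x $ i) (mapp (g i) (snd x $ i))))"
    for g :: "'n \<Rightarrow> mat2" and i
  proof -
    obtain a b c d where g: "g i = (a,b,c,d)" by (rule prod_cases4)
    show ?thesis unfolding g cbil_def mapp_def prod.case fst_conv snd_conv
      by (intro continuous_intros)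
  qed
  have op: "open (U z)" for z
  proof -
    obtain f n where z: "z = (f,n)" by (cases z)
    have "open {x. 1 / real (Suc n) < cmod (cbil (fst x $ i) (mapp (f i) (snd x $ i)))}" for i
      by (rule open_Collect_less[OF continuous_on_const cont])
    then show ?thesis unfolding U_def z prod.case Collect_all_eq
      by (intro open_INT ballI finite)
  qed
  have "closed {x :: ((complex \<times> complex) ^ 'n) \<times> ((complex \<times> complex) ^ 'n).
      norm (fst x $ i) = 1 \<and> norm (snd x $ i) = 1}" for i
    by (intro closed_Collect_conj closed_Collect_eq continuous_intros)
  then have closedS: "closed S" unfolding S_def Collect_all_eq
    by (intro closed_INT ballI)
  have "bounded S"
  proof (rule boundedI)
    fix x assume x: "x \<in> S"
    have "norm (fst x) \<le> (\<Sum>i\<in>UNIV. norm (fst x $ i))" "norm (snd x) \<le> (\<Sum>i\<in>UNIV. norm (snd x $ i))"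
      unfolding norm_vec_def by (intro L2_set_le_sum; simp)+
    then have "norm (fst x) \<le> CARD('n)" "norm (snd x) \<le> CARD('n)" using x by (simp_all add: S_def)
    then show "norm x \<le> CARD('n) + CARD('n)"
      using norm_Pair_le[of "fst x" "snd x"] by simp
  qed
  then have cS: "compact S" using closedS compact_eq_bounded_closed by blast
  have cover: "S \<subseteq> (\<Union>z\<in>\<Gamma> \<times> UNIV. U z)"
  proof
    fix x assume x: "x \<in> S"
    then have "norm (fst x $ i) = 1" "norm (snd x $ i) = 1" for i
      by (simp_all add: S_def)
    then have nz: "fst x $ i \<noteq> 0" "snd x $ i \<noteq> 0" for i
      by (metis norm_zero zero_neq_one)+
    have "\<exists>f\<in>\<Gamma>. \<forall>i. cbil (fst x $ i) (mapp (f i) (snd x $ i)) \<noteq> 0"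
      using generic_element[OF assms, of "\<lambda>i. fst x $ i" "\<lambda>i. snd x $ i", OF nz] .
    then obtain f where f: "f \<in> \<Gamma>" and f': "\<forall>i. cbil (fst x $ i) (mapp (f i) (snd x $ i)) \<noteq> 0"
      by (elim bexE)
    define m where "m = Min (range (\<lambda>i. cmod (cbil (fst x $ i) (mapp (f i) (snd x $ i)))))"
    have "m \<in> range (\<lambda>i. cmod (cbil (fst x $ i) (mapp (f i) (snd x $ i))))"
      unfolding m_def by (rule Min_in) simp_all
    then have "m > 0" using f' by (elim rangeE) simp
    then obtain n where n: "1 / Suc n < m" using nat_approx_posE by blast
    have "m \<le> cmod (cbil (fst x $ i) (mapp (f i) (snd x $ i)))" for i
      unfolding m_def by (intro Min_le) auto
    then have "x \<in> U (f,n)" unfolding U_def using n by (auto intro: less_le_trans)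
    then show "x \<in> (\<Union>z\<in>\<Gamma> \<times> UNIV. U z)" by (rule UN_I[rotated]) (simp add: f)
  qed
  obtain T where T: "T \<subseteq> \<Gamma> \<times> UNIV" "finite T" "S \<subseteq> (\<Union>z\<in>T. U z)"
    by (rule compactE_image[OF cS _ cover]) (rule op)
  \<comment> \<open>The largest index belongs to the smallest bound; 0 is inserted so that the
    maximum exists for every \<open>T\<close>.\<close>
  define N where "N = Max (insert 0 (snd ` T))"
  show ?thesis
  proof (rule that[of "fst ` T" "1 / Suc N"])
    show "finite (fst ` T)" "fst ` T \<subseteq> \<Gamma>" "1 / real (Suc N) > 0" using T by auto
    fix \<alpha> \<beta> :: "'n \<Rightarrow> complex \<times> complex"
    assume ab: "\<And>i. norm (\<alpha> i) = 1" "\<And>i. norm (\<beta> i) = 1"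
    then have "((\<chi> i. \<alpha> i), (\<chi> i. \<beta> i)) \<in> S" by (simp add: S_def)
    from subsetD[OF T(3) this] obtain z where z: "z \<in> T" "((\<chi> i. \<alpha> i), (\<chi> i. \<beta> i)) \<in> U z"
      by (rule UN_E)
    obtain f n where "z = (f,n)" by (cases z)
    then have fn: "(f,n) \<in> T" "((\<chi> i. \<alpha> i), (\<chi> i. \<beta> i)) \<in> U (f,n)" using z by simp_all
    have "n \<le> N" unfolding N_def using T(2) imageI[OF fn(1), of snd] by (intro Max_ge) simp_all
    then have "1 / real (Suc N) \<le> 1 / real (Suc n)" by (simp add: field_simps)
    then have "\<forall>i. cmod (cbil (\<alpha> i) (mapp (f i) (\<beta> i))) > 1 / real (Suc N)"
      using fn(2) by (auto simp: U_def intro: le_less_trans)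
    then show "\<exists>f\<in>fst ` T. \<forall>i. cmod (cbil (\<alpha> i) (mapp (f i) (\<beta> i))) > 1 / real (Suc N)"
      using imageI[OF fn(1), of fst] by (intro bexI[of _ f]) simp_all
  qed
qed

lemma cbil_mapp_scaleR: "cbil (x *\<^sub>R r) (mapp f (y *\<^sub>R c)) = of_real (x * y) * cbil r (mapp f c)"
  by (cases f; cases r; cases c) (simp add: cbil_def mapp_def scaleR_conv_of_real algebra_simps)

text \<open>The norm is at most the sum of the norms of the two rows, and pairing with a row is one
  coordinate of \<open>mapp\<close>.\<close>

lemma large_row:
  obtains r where "norm g / 2 \<le> norm r" "\<And>v. cmod (cbil r v) \<le> norm (mapp g v)"
proof -
  obtain a b c d where g: "g = (a,b,c,d)" by (cases g)
  have "(norm g)\<^sup>2 = (norm (a,b))\<^sup>2 + (norm (c,d))\<^sup>2"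
    by (simp add: g norm_mat2_sq norm_complex_pair_sq)
  also have "\<dots> \<le> (norm (a,b) + norm (c,d))\<^sup>2" by (simp add: power2_sum)
  finally have "norm g \<le> norm (a,b) + norm (c,d)"
    by (meson add_nonneg_nonneg norm_ge_zero power2_le_imp_le)
  then consider "norm g / 2 \<le> norm (a,b)" | "norm g / 2 \<le> norm (c,d)" by linarith
  then show ?thesis
  proof cases
    case 1
    have "cmod (cbil (a,b) v) \<le> norm (mapp g v)" for v
      using norm_fst_le[of "fst (mapp g v)" "snd (mapp g v)"] by (simp add: g cbil_def mapp_def)
    with 1 show ?thesis by (rule that)
  next
    case 2
    have "cmod (cbil (c,d) v) \<le> norm (mapp g v)" for v
      using norm_snd_le[of "snd (mapp g v)" "fst (mapp g v)"] by (simp add: g cbil_def mapp_def)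
    with 2 show ?thesis by (rule that)
  qed
qed

lemma large_column:
  obtains e where "norm e = 1" "norm g / 2 \<le> norm (mapp g e)"
proof -
  obtain a b c d where g: "g = (a,b,c,d)" by (cases g)
  have "(norm g)\<^sup>2 = (norm (a,c))\<^sup>2 + (norm (b,d))\<^sup>2"
    by (simp add: g norm_mat2_sq norm_complex_pair_sq)
  also have "\<dots> \<le> (norm (a,c) + norm (b,d))\<^sup>2" by (simp add: power2_sum)
  finally have "norm g \<le> norm (a,c) + norm (b,d)"
    by (meson add_nonneg_nonneg norm_ge_zero power2_le_imp_le)
  then consider "norm g / 2 \<le> norm (a,c)" | "norm g / 2 \<le> norm (b,d)" by linarith
  then show ?thesis
    by cases (use that[of "(1,0)"] that[of "(0,1)"] in \<open>auto simp: g mapp_def norm_prod_def\<close>)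
qed

text \<open>A large row of \<open>g\<close> and a large column of \<open>h\<close>, rescaled to unit
  length, are the \<open>\<alpha>\<close> and \<open>\<beta>\<close> of the uniform lemma. The two
  halves lost in choosing them account for the factor 1/4.\<close>

lemma norm_product_ge:
  fixes \<Gamma> :: "('n::finite \<Rightarrow> mat2) set"
  assumes "psl_subgroup Q \<Gamma>" "nonelementary \<Gamma>"
  obtains F \<epsilon> where "finite F" "F \<subseteq> \<Gamma>" "\<epsilon> > 0"
    "\<And>g h. g \<in> \<Gamma> \<Longrightarrow> h \<in> \<Gamma> \<Longrightarrow>
       \<exists>f\<in>F. \<forall>i. \<epsilon> * norm (g i) * norm (h i) \<le> norm (mmul (g i) (mmul (f i) (h i)))"
proof -
  obtain F \<epsilon> where F: "finite F" "F \<subseteq> \<Gamma>" "\<epsilon> > 0" and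
    key: "\<And>\<alpha> \<beta>. (\<And>i. norm (\<alpha> i) = 1) \<Longrightarrow> (\<And>i. norm (\<beta> i) = 1)
       \<Longrightarrow> \<exists>f\<in>F. \<forall>i. cmod (cbil (\<alpha> i) (mapp (f i) (\<beta> i))) > \<epsilon>"
    using generic_element_uniform[OF assms] by metis
  show ?thesis
  proof (rule that[OF F(1,2), of "\<epsilon> / 4"])
    show "\<epsilon> / 4 > 0" using F by simp
    fix g h assume gh: "g \<in> \<Gamma>" "h \<in> \<Gamma>"
    have "\<forall>i. \<exists>r. norm (g i) / 2 \<le> norm r \<and> (\<forall>v. cmod (cbil r v) \<le> norm (mapp (g i) v))"
      using large_row by metis
    then obtain r where r: "\<And>i. norm (g i) / 2 \<le> norm (r i)"
      "\<And>i v. cmod (cbil (r i) v) \<le> norm (mapp (g i) v)" by metis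
    have "\<forall>i. \<exists>e. norm e = 1 \<and> norm (h i) / 2 \<le> norm (mapp (h i) e)"
      using large_column by metis
    then obtain e where e: "\<And>i. norm (e i) = 1" "\<And>i. norm (h i) / 2 \<le> norm (mapp (h i) (e i))"
      by metis
    define c where "c i = mapp (h i) (e i)" for i
    have n1: "norm (g i) \<ge> 1" "norm (h i) \<ge> 1" for i
      using gh psl_subgroup_mdet[OF assms(1)] norm_mat2_ge_1 by blast+
    have pos: "norm (r i) > 0" "norm (c i) > 0" for i
      using r(1)[of i] e(2)[of i] n1[of i] unfolding c_def by linarith+
    have "\<exists>f\<in>F. \<forall>i. cmod (cbil ((1 / norm (r i)) *\<^sub>R r i) (mapp (f i) ((1 / norm (c i)) *\<^sub>R c i))) > \<epsilon>"
      by (rule key) (use pos in \<open>simp_all add: less_imp_neq[symmetric]\<close>)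
    then obtain f where f: "f \<in> F"
      "\<And>i. cmod (cbil ((1 / norm (r i)) *\<^sub>R r i) (mapp (f i) ((1 / norm (c i)) *\<^sub>R c i))) > \<epsilon>"
      by blast
    have "\<epsilon> / 4 * norm (g i) * norm (h i) \<le> norm (mmul (g i) (mmul (f i) (h i)))" for i
    proof -
      have "\<epsilon> < cmod (cbil (r i) (mapp (f i) (c i))) / (norm (r i) * norm (c i))"
        using f(2)[of i] unfolding cbil_mapp_scaleR by (simp add: norm_mult norm_divide)
      then have "\<epsilon> * (norm (r i) * norm (c i)) < cmod (cbil (r i) (mapp (f i) (c i)))"
        using pos[of i] by (simp add: less_divide_eq)
      also have "\<dots> \<le> norm (mapp (mmul (g i) (mmul (f i) (h i))) (e i))"
        using r(2)[of i "mapp (f i) (c i)"] by (simp add: c_def mapp_mmul)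
      also have "\<dots> \<le> norm (mmul (g i) (mmul (f i) (h i)))"
        using norm_mapp_le[of _ "e i"] e(1)[of i] by (metis mult.right_neutral)
      finally have 1: "\<epsilon> * (norm (r i) * norm (c i)) < norm (mmul (g i) (mmul (f i) (h i)))" .
      have "norm (g i) / 2 * (norm (h i) / 2) \<le> norm (r i) * norm (c i)"
        using r(1)[of i] e(2)[of i] unfolding c_def by (intro mult_mono) auto
      then have "\<epsilon> * (norm (g i) / 2 * (norm (h i) / 2)) \<le> \<epsilon> * (norm (r i) * norm (c i))"
        using F(3) by (intro mult_left_mono) auto
      then show ?thesis using 1 by simp
    qed
    then show "\<exists>f\<in>F. \<forall>i. \<epsilon> / 4 * norm (g i) * norm (h i) \<le> norm (mmul (g i) (mmul (f i) (h i)))"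
      using f(1) by blast
  qed
qed

text \<open>The constant 2 bounds the norm of the identity. In use: a matrix of given norm with a
  large square has a large trace.\<close>

lemma norm_square_le_trace:
  assumes "mdet A = 1"
  shows "norm (mmul A A) \<le> cmod (mtr A) * norm A + 2"
proof -
  obtain a b c d where A: "A = (a,b,c,d)" by (cases A)
  have bc: "b * c = a * d - 1" using assms by (simp add: A mdet_def algebra_simps)
  have "a * a + b * c = (a + d) * a - 1" "c * b + d * d = (a + d) * d - 1"
    unfolding mult.commute[of c b] bc by (simp_all add: algebra_simps)
  then have "mmul A A = msc (mtr A) A - mid"
    by (simp add: A mmul_def mtr_def msc_def mid_def algebra_simps)
  then have "norm (mmul A A) \<le> norm (msc (mtr A) A) + norm mid"
    by (metis norm_triangle_ineq4)
  moreover have "norm mid \<le> 2"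
    by (rule power2_le_imp_le) (simp_all add: mid_def norm_mat2_sq)
  ultimately show ?thesis by (simp add: norm_msc)
qed

lemma tlen_product_approx:
  fixes \<Gamma> :: "('n::finite \<Rightarrow> mat2) set"
  assumes \<Gamma>: "psl_subgroup Q \<Gamma>" and ne: "nonelementary \<Gamma>"
  obtains C where "C > 0" "\<And>g h. g \<in> \<Gamma> \<Longrightarrow> h \<in> \<Gamma> \<Longrightarrow>
       \<exists>k\<in>\<Gamma>. \<forall>i. \<bar>tlen (k i) - (2 * ln (norm (g i)) + 2 * ln (norm (h i)))\<bar> \<le> C"
proof -
  obtain F \<epsilon> where F: "finite F" "F \<subseteq> \<Gamma>" "\<epsilon> > 0" and
    key: "\<And>g h. g \<in> \<Gamma> \<Longrightarrow> h \<in> \<Gamma> \<Longrightarrow>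
       \<exists>f\<in>F. \<forall>i. \<epsilon> * norm (g i) * norm (h i) \<le> norm (mmul (g i) (mmul (f i) (h i)))"
    using norm_product_ge[OF assms] by metis
  note det = psl_subgroup_mdet[OF \<Gamma>]
  define M where "M = 1 + (\<Sum>f\<in>F. \<Sum>i\<in>UNIV. norm (f i))"
  have M: "norm (f i) \<le> M" if "f \<in> F" for f i
  proof -
    have "norm (f i) \<le> (\<Sum>i\<in>UNIV. norm (f i))" by (intro member_le_sum) auto
    also have "\<dots> \<le> (\<Sum>f\<in>F. \<Sum>i\<in>UNIV. norm (f i))"
      using that F(1) by (intro member_le_sum[of f F "\<lambda>f. \<Sum>i\<in>UNIV. norm (f i)"]) (auto intro: sum_nonneg)
    finally show ?thesis by (simp add: M_def)
  qed
  have M1: "M \<ge> 1" unfolding M_def by (simp add: sum_nonneg)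
  have n1: "norm (g i) \<ge> 1" if "g \<in> \<Gamma>" for g i using det[OF that] norm_mat2_ge_1 by blast
  \<comment> \<open>First half: one element whose norms are the products of the given norms, up to
    constants. It is then fed into the second half.\<close>
  have prod: "\<exists>k\<in>\<Gamma>. \<forall>i. \<epsilon> * norm (g i) * norm (h i) \<le> norm (k i)
      \<and> norm (k i) \<le> M * (norm (g i) * norm (h i))" if gh: "g \<in> \<Gamma>" "h \<in> \<Gamma>" for g h
  proof -
    obtain f where f: "f \<in> F" "\<And>i. \<epsilon> * norm (g i) * norm (h i) \<le> norm (mmul (g i) (mmul (f i) (h i)))"
      using key[OF gh] by blast
    have k: "(\<lambda>i. mmul (g i) (mmul (f i) (h i))) \<in> \<Gamma>"
      using psl_subgroup_mmul[OF \<Gamma> gh(1) psl_subgroup_mmul[OF \<Gamma> subsetD[OF F(2) f(1)] gh(2)]] .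
    have "norm (mmul (g i) (mmul (f i) (h i))) \<le> M * (norm (g i) * norm (h i))" for i
    proof -
      have "norm (mmul (g i) (mmul (f i) (h i))) \<le> norm (g i) * (norm (f i) * norm (h i))"
        by (meson mult_left_mono norm_ge_zero norm_mmul_le order_trans)
      also have "\<dots> \<le> norm (g i) * (M * norm (h i))"
        using M[OF f(1), of i] by (intro mult_left_mono mult_right_mono) auto
      finally show ?thesis by (simp add: algebra_simps)
    qed
    then show ?thesis using f k by (intro bexI[OF _ k]) blast
  qed
  \<comment> \<open>Second half: an element whose translation lengths match the norms of
    \<open>g\<close>. Here the previous lower bound is used with \<open>h = g\<close>.\<close>
  have prox: "\<exists>k\<in>\<Gamma>. \<forall>i. \<epsilon> / (4 * M\<^sup>2) * norm (g i) \<le> exp (tlen (k i) / 2)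
      \<and> exp (tlen (k i) / 2) \<le> M * norm (g i)" if g: "g \<in> \<Gamma>" for g
  proof -
    obtain f where f: "f \<in> F" "\<And>i. \<epsilon> * norm (g i) * norm (g i) \<le> norm (mmul (g i) (mmul (f i) (g i)))"
      using key[OF g g] by blast
    have f\<Gamma>: "f \<in> \<Gamma>" using f F by blast
    define A where "A i = mmul (f i) (g i)" for i
    have A: "A \<in> \<Gamma>" using psl_subgroup_mmul[OF \<Gamma> f\<Gamma> g] by (simp add: A_def[abs_def])
    have "\<epsilon> / (4 * M\<^sup>2) * norm (g i) \<le> exp (tlen (A i) / 2)
      \<and> exp (tlen (A i) / 2) \<le> M * norm (g i)" for i
    proof
      define E where "E = exp (tlen (A i) / 2)"
      have E1: "E \<ge> 1" using tlen_nonneg[OF det[OF A]] by (simp add: E_def)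
      have nA: "norm (A i) \<le> M * norm (g i)"
        unfolding A_def using norm_mmul_le[of "f i" "g i"] M[OF f(1), of i]
        by (meson mult_right_mono norm_ge_zero order_trans)
      \<comment> \<open>With \<open>A = f g\<close> the left side is \<open>g f g\<close>, which is
        large by the choice of \<open>f\<close>; hence the square of \<open>A\<close> is
        large.\<close>
      have "mmul (g i) (A i) = mmul (minv (f i)) (mmul (A i) (A i))"
        unfolding A_def by (simp add: mmul_assoc[symmetric] mmul_minv det[OF f\<Gamma>])
      then have "norm (mmul (g i) (A i)) \<le> norm (f i) * norm (mmul (A i) (A i))"
        using norm_mmul_le[of "minv (f i)" "mmul (A i) (A i)"] by (simp add: norm_minv)
      also have "\<dots> \<le> M * (cmod (mtr (A i)) * norm (A i) + 2)"
        using M[OF f(1), of i] M1 norm_square_le_trace[OF det[OF A], of i]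
        by (intro mult_mono) auto
      \<comment> \<open>The additive 2 is absorbed so that a factor \<open>norm (g i)\<close> can be
        cancelled. This is the source of \<open>4 * M\<^sup>2\<close>: one \<open>M\<close> from the
        inverse of \<open>f\<close>, one from \<open>A\<close>, and 2 + 2.\<close>
      also have "\<dots> \<le> M * ((2 * E) * (M * norm (g i)) + 2 * (E * (M * norm (g i))))"
      proof -
        have "cmod (mtr (A i)) * norm (A i) \<le> (2 * E) * (M * norm (g i))"
          using mtr_le_exp_tlen[OF det[OF A], of i] nA E1 by (intro mult_mono) (auto simp: E_def)
        moreover have "1 \<le> E * (M * norm (g i))"
          using E1 M1 n1[OF g, of i] by (smt (verit, best) mult_le_cancel_left1 mult_less_cancel_right1)
        ultimately show ?thesis using M1 by (intro mult_left_mono) auto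
      qed
      finally have "\<epsilon> * norm (g i) * norm (g i) \<le> 4 * M\<^sup>2 * E * norm (g i)"
        using f(2)[of i] by (simp add: A_def power2_eq_square algebra_simps)
      then have "\<epsilon> * norm (g i) \<le> 4 * M\<^sup>2 * E" using n1[OF g, of i]
        by (meson less_le_trans mult_right_le_imp_le zero_less_one)
      then show "\<epsilon> / (4 * M\<^sup>2) * norm (g i) \<le> exp (tlen (A i) / 2)"
        using M1 by (simp add: E_def field_simps)
      have "exp (tlen (A i) / 2) \<le> exp (ln (norm (A i)))"
        using tlen_le_norm[OF det[OF A], of i] by (subst exp_le_cancel_iff) simp
      also have "\<dots> = norm (A i)" using n1[OF A, of i] by (subst exp_ln) auto
      finally show "exp (tlen (A i) / 2) \<le> M * norm (g i)" using nA by simp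
    qed
    then show ?thesis using A by blast
  qed
  define C where "C = 1 + 2 * \<bar>ln (\<epsilon> / (4 * M\<^sup>2))\<bar> + 2 * \<bar>ln \<epsilon>\<bar> + 4 * ln M"
  show ?thesis
  proof (rule that[of C])
    have lnM: "ln M \<ge> 0" using M1 by simp
    then show "C > 0" unfolding C_def by linarith
    fix g h assume gh: "g \<in> \<Gamma>" "h \<in> \<Gamma>"
    obtain k where k: "k \<in> \<Gamma>" "\<And>i. \<epsilon> * norm (g i) * norm (h i) \<le> norm (k i)"
      "\<And>i. norm (k i) \<le> M * (norm (g i) * norm (h i))" using prod[OF gh] by blast
    obtain m where m: "m \<in> \<Gamma>" "\<And>i. \<epsilon> / (4 * M\<^sup>2) * norm (k i) \<le> exp (tlen (m i) / 2)"
      "\<And>i. exp (tlen (m i) / 2) \<le> M * norm (k i)" using prox[OF k(1)] by blast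
    have "\<bar>tlen (m i) - (2 * ln (norm (g i)) + 2 * ln (norm (h i)))\<bar> \<le> C" for i
    proof -
      have pos: "norm (g i) > 0" "norm (h i) > 0" "norm (k i) > 0" "\<epsilon> / (4 * M\<^sup>2) > 0" "M > 0"
        using n1[OF gh(1), of i] n1[OF gh(2), of i] n1[OF k(1), of i] F(3) M1 by auto
      have 1: "ln (norm (k i)) \<le> ln M + (ln (norm (g i)) + ln (norm (h i)))"
        using ln_mono[OF k(3)[of i]] pos by (simp add: ln_mult)
      have 2: "ln \<epsilon> + ln (norm (g i)) + ln (norm (h i)) \<le> ln (norm (k i))"
        using ln_mono[OF k(2)[of i]] pos F(3) by (simp add: ln_mult)
      have 3: "tlen (m i) / 2 \<le> ln M + ln (norm (k i))"
        using ln_mono[OF m(3)[of i]] pos by (simp add: ln_mult)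
      have 4: "ln (\<epsilon> / (4 * M\<^sup>2)) + ln (norm (k i)) \<le> tlen (m i) / 2"
        using ln_mono[OF m(2)[of i] mult_pos_pos[OF pos(4,3)]]
        by (simp only: ln_mult_pos[OF pos(4,3)] ln_exp)
      show ?thesis using 1 2 3 4 lnM unfolding C_def by linarith
    qed
    then show "\<exists>k\<in>\<Gamma>. \<forall>i. \<bar>tlen (k i) - (2 * ln (norm (g i)) + 2 * ln (norm (h i)))\<bar> \<le> C"
      using m(1) by blast
  qed
qed

section \<open>Bounded groups\<close>

text \<open>The averaged Hermitian matrix of two points has determinant greater than 1; rescaling it to
  determinant 1 gives a point strictly closer to everything.\<close>
lemma closer_point:
  assumes p: "p \<in> H3" and p': "p' \<in> H3" and "p \<noteq> p'"
  obtains k m where "k > 1" "m \<in> H3" "\<And>q. q \<in> H3 \<Longrightarrow> coshd m q = (coshd p q + coshd p' q) / (2 * k)"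
proof -
  obtain z t where zt: "p = (z,t)" by (cases p)
  obtain z' t' where zt': "p' = (z',t')" by (cases p')
  have t: "t > 0" "t' > 0" using p p' by (auto simp: zt zt' H3_def)
  define a where "a = (1/t + 1/t') / 2"
  define b where "b = (z / of_real t + z' / of_real t') / 2"
  define c where "c = (((cmod z)\<^sup>2 + t\<^sup>2) / t + ((cmod z')\<^sup>2 + t'\<^sup>2) / t') / 2"
  have a: "a > 0" using t by (simp add: a_def add_pos_pos)
  \<comment> \<open>The determinant of the average \<open>((c, b), (cnj b, a))\<close>; it exceeds 1
    because the points differ, and \<open>k\<close> is its square root.\<close>
  have det: "a * c - (cmod b)\<^sup>2 = (1 + coshd p p') / 2"
  proof -
    have b2: "(cmod b)\<^sup>2 = ((Re z / t + Re z' / t') / 2)\<^sup>2 + ((Im z / t + Im z' / t') / 2)\<^sup>2"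
      unfolding b_def cmod_power2 by (simp add: Re_divide_of_real Im_divide_of_real)
    show ?thesis
      unfolding b2 unfolding a_def c_def coshd_def zt zt' prod.case cmod_power2 minus_complex.sel using t
      by (simp add: field_simps power2_eq_square)
  qed
  have "coshd p p' \<noteq> 1" using assms cosh_dH[OF p p'] dH_eq_0_iff[OF p p'] dH_coshd[OF p p'] by auto
  then have gt: "coshd p p' > 1" using coshd_ge_1[OF p p'] by simp
  define k where "k = sqrt (a * c - (cmod b)\<^sup>2)"
  have k: "k > 1" unfolding k_def det using gt by simp
  have k2: "k\<^sup>2 = a * c - (cmod b)\<^sup>2" unfolding k_def det using gt by simp
  define m where "m = (b / of_real a, k / a)"
  have m: "m \<in> H3" using a k by (simp add: m_def H3_def)
  have "coshd m q = (coshd p q + coshd p' q) / (2 * k)" if q: "q \<in> H3" for q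
  proof -
    obtain w s where ws: "q = (w,s)" by (cases q)
    have s: "s > 0" using q by (simp add: ws H3_def)
    \<comment> \<open>Linearity in the Hermitian entries of the first point: averaging and dividing
      by \<open>k\<close> pass through \<open>coshd\<close>.\<close>
    have lin: "coshd (x,y) (w,s) = (((cmod w)\<^sup>2 + s\<^sup>2) * (1/y) - 2 * ((x / of_real y) \<bullet> w)
        + ((cmod x)\<^sup>2 + y\<^sup>2) / y) / (2 * s)" if "y > 0" for x y
      using that s unfolding coshd_def prod.case cmod_power2 inner_complex_def
      by (simp add: Re_divide_of_real Im_divide_of_real field_simps power2_eq_square)
    have ma: "1 / (k / a) = a / k" "b / of_real a / of_real (k / a) = b / of_real k"
      using a k by (simp_all add: field_simps)
    have mc: "((cmod (b / of_real a))\<^sup>2 + (k / a)\<^sup>2) / (k / a) = c / k"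
      using a k k2 by (simp add: norm_divide power_divide add_divide_distrib[symmetric])
        (simp add: field_simps power2_eq_square)
    have "b \<bullet> w = ((z / of_real t) \<bullet> w + (z' / of_real t') \<bullet> w) / 2"
      by (simp add: b_def inner_complex_def algebra_simps add_divide_distrib)
    moreover have "(b / of_real k) \<bullet> w = (b \<bullet> w) / k"
      by (simp add: inner_complex_def Re_divide_of_real Im_divide_of_real add_divide_distrib)
    moreover have "coshd m q = (((cmod w)\<^sup>2 + s\<^sup>2) * (a/k) - 2 * ((b / of_real k) \<bullet> w) + c / k) / (2 * s)"
      unfolding m_def ws by (subst lin) (use a k in \<open>simp_all only: ma mc zero_less_divide_iff, auto\<close>)
    moreover have "(W * (((u + v) / 2) / k) - 2 * (((X + Y) / 2) / k) + ((P + P') / 2) / k) / (2 * s)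
        = ((W * u - 2 * X + P) / (2 * s) + (W * v - 2 * Y + P') / (2 * s)) / (2 * k)" for W u v X Y P P'
      using s k by (simp add: field_simps)
    ultimately show ?thesis
      unfolding zt zt' ws lin[OF t(1)] lin[OF t(2)] by (simp only: a_def c_def)
  qed
  then show ?thesis using that k m by blast
qed

text \<open>The circumcentre argument: \<open>K r\<close> consists of the centres of balls of
  cosh-radius \<open>r\<close> that contain the orbit of the base point. The centre for the least
  radius is unique, and the group permutes such centres.\<close>

lemma bounded_group_fixed_point:
  assumes one: "mid \<in> H" and mul: "\<And>g h. g \<in> H \<Longrightarrow> h \<in> H \<Longrightarrow> mmul g h \<in> H"
    and inv: "\<And>g. g \<in> H \<Longrightarrow> minv g \<in> H" and det: "\<And>g. g \<in> H \<Longrightarrow> mdet g = 1"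
    and bdd: "\<And>g. g \<in> H \<Longrightarrow> norm g \<le> M"
  obtains p where "p \<in> H3" "\<And>g. g \<in> H \<Longrightarrow> act g p = p"
proof -
  define K where "K r = {p \<in> H3. \<forall>h\<in>H. coshd p (act h base) \<le> r}" for r
  have orb: "act h base \<in> H3" if "h \<in> H" for h using det[OF that] by (simp add: act_in_H3)
  have K_alt: "K r = {p. 0 \<le> snd p \<and> (\<forall>h\<in>H. (cmod (fst p - fst (act h base)))\<^sup>2 + (snd p)\<^sup>2
       + (snd (act h base))\<^sup>2 \<le> r * (2 * snd p * snd (act h base)))}" for r
  proof -
    have *: "coshd p q \<le> r \<longleftrightarrow> (cmod (fst p - fst q))\<^sup>2 + (snd p)\<^sup>2 + (snd q)\<^sup>2 \<le> r * (2 * snd p * snd q)"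
      if "p \<in> H3" "q \<in> H3" for p q
      using that by (auto simp: H3_def coshd_def case_prod_beta pos_divide_le_eq)
    \<comment> \<open>At height 0 the right side of the condition for \<open>mid\<close> vanishes
      while the left side is at least 1.\<close>
    have **: "p \<in> H3" if "0 \<le> snd p" "(cmod (fst p - fst (act mid base)))\<^sup>2 + (snd p)\<^sup>2
       + (snd (act mid base))\<^sup>2 \<le> r * (2 * snd p * snd (act mid base))" for p
    proof -
      have "snd p \<noteq> 0" using that(2) by (auto simp: add_nonneg_eq_0_iff)
          (smt (verit) zero_le_power2)
      then show ?thesis using that(1) by (simp add: H3_def)
    qed
    show ?thesis
    proof (intro set_eqI iffI)
      fix p assume p: "p \<in> K r"
      then have "p \<in> H3" by (simp add: K_def)
      then have "0 \<le> snd p" by (simp add: H3_def)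
      then show "p \<in> {p. 0 \<le> snd p \<and> (\<forall>h\<in>H. (cmod (fst p - fst (act h base)))\<^sup>2 + (snd p)\<^sup>2
       + (snd (act h base))\<^sup>2 \<le> r * (2 * snd p * snd (act h base)))}"
        using p *[OF \<open>p \<in> H3\<close> orb] unfolding K_def by blast
    next
      fix p assume p: "p \<in> {p. 0 \<le> snd p \<and> (\<forall>h\<in>H. (cmod (fst p - fst (act h base)))\<^sup>2 + (snd p)\<^sup>2
       + (snd (act h base))\<^sup>2 \<le> r * (2 * snd p * snd (act h base)))}"
      then have "p \<in> H3" using one by (intro **) blast+
      then show "p \<in> K r" using p *[OF \<open>p \<in> H3\<close> orb] unfolding K_def by blast
    qed
  qed
  have closedK: "closed (K r)" for r
    unfolding K_alt Collect_conj_eq Collect_ball_eq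
    by (intro closed_Int closed_INT ballI closed_Collect_le continuous_intros)
  have bddK: "bounded (K r)" for r
  proof (rule boundedI)
    fix p assume p: "p \<in> K r"
    have 0: "0 < snd p" using p by (auto simp: K_def H3_def)
    have "(cmod (fst p))\<^sup>2 + (snd p)\<^sup>2 + 1 \<le> r * (2 * snd p)"
      using p one unfolding K_alt by (auto dest!: bspec[of _ _ mid])
    then have 1: "(norm p)\<^sup>2 \<le> 2 * r * snd p" by (simp add: norm_prod_def)
    have "snd p \<le> norm p" using norm_snd_le[of "snd p" "fst p"] by simp
    have "r \<ge> 0" using 1 0 by (smt (verit, ccfv_SIG) mult_neg_pos zero_le_power2)
    then have "(norm p)\<^sup>2 \<le> (2 * r) * norm p"
      using 1 \<open>snd p \<le> norm p\<close> by (smt (verit) mult_left_mono)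
    then show "norm p \<le> 2 * r"
      using 0 \<open>snd p \<le> norm p\<close> unfolding power2_eq_square by (meson less_le_trans mult_right_le_imp_le)
  qed
  define R where "R = {r. K r \<noteq> {}}"
  have ge1: "r \<ge> 1" if r: "r \<in> R" for r
  proof -
    obtain p where "p \<in> K r" using r unfolding R_def by blast
    then have "p \<in> H3" "coshd p base \<le> r" using one unfolding K_def by (auto dest!: bspec[of _ _ mid])
    then show ?thesis using coshd_ge_1[of p base] by simp
  qed
  have "base \<in> K (M\<^sup>2 / 2)"
    unfolding K_def using det bdd by (auto simp: coshd_base_act intro!: power_mono)
  then have Rne: "R \<noteq> {}" by (auto simp: R_def)
  define r0 where "r0 = Inf R"
  have bb: "bdd_below R" using ge1 by (rule bdd_belowI)
  have r1: "r0 \<ge> 1" unfolding r0_def using Rne ge1 by (rule cInf_greatest)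
  have mono: "K r \<subseteq> K s" if "r \<le> s" for r s using that unfolding K_def by (auto intro: order_trans)
  have neK: "K (r0 + 1 / Suc n) \<noteq> {}" for n
  proof -
    have "r0 < r0 + 1 / Suc n" by simp
    then obtain r where "r \<in> R" "r < r0 + 1 / Suc n" unfolding r0_def using cInf_lessD[OF Rne] by blast
    then show ?thesis using mono[of r "r0 + 1 / Suc n"] by (auto simp: R_def)
  qed
  have "(\<Inter>n. K (r0 + 1 / Suc n)) \<noteq> {}"
  proof (rule compact_nest)
    show "compact (K (r0 + 1 / Suc n))" for n using closedK bddK compact_eq_bounded_closed by blast
    show "K (r0 + 1 / Suc n) \<subseteq> K (r0 + 1 / Suc m)" if "m \<le> n" for m n
      using that by (intro mono) (simp add: field_simps)
  qed (rule neK)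
  then obtain p where p: "\<And>n. p \<in> K (r0 + 1 / Suc n)" by blast
  have "coshd p (act h base) \<le> r0" if "h \<in> H" for h
  proof (rule field_le_epsilon)
    fix e :: real assume "e > 0"
    then obtain n where "1 / Suc n < e" using nat_approx_posE by blast
    then show "coshd p (act h base) \<le> r0 + e" using p[of n] that unfolding K_def by force
  qed
  then have pK: "p \<in> K r0" using p[of 0] by (auto simp: K_def)
  have unique: "p' = p" if p': "p' \<in> K r0" for p'
  proof (rule ccontr)
    assume "p' \<noteq> p"
    then obtain k m where km: "k > 1" "m \<in> H3"
      "\<And>q. q \<in> H3 \<Longrightarrow> coshd m q = (coshd p' q + coshd p q) / (2 * k)"
      using closer_point[of p' p] p' pK unfolding K_def by blast
    have "coshd m (act h base) \<le> r0 / k" if "h \<in> H" for h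
    proof -
      have "coshd p' (act h base) + coshd p (act h base) \<le> 2 * r0"
        using that p' pK by (force simp: K_def)
      then have "(coshd p' (act h base) + coshd p (act h base)) / (2 * k) \<le> 2 * r0 / (2 * k)"
        using km(1) by (intro divide_right_mono) auto
      then show ?thesis using km(3)[OF orb[OF that]] by simp
    qed
    \<comment> \<open>Two optimal centres would yield a centre with the smaller radius
      \<open>r0 / k\<close>, as \<open>k > 1\<close>.\<close>
    then have "r0 / k \<in> R" using km(2) unfolding R_def K_def by blast
    then have "r0 \<le> r0 / k" unfolding r0_def using bb by (intro cInf_lower)
    then show False using km r1 by (simp add: field_simps)
  qed
  have "act g p = p" if g: "g \<in> H" for g
  proof (rule unique)
    have pH: "p \<in> H3" using pK by (simp add: K_def)
    have "coshd (act g p) (act h base) \<le> r0" if h: "h \<in> H" for h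
    proof -
      have "act h base = act g (act (mmul (minv g) h) base)"
        using g h by (simp add: act_mmul[symmetric] det inv mul mmul_assoc[symmetric] mmul_minv)
      then have "coshd (act g p) (act h base) = coshd p (act (mmul (minv g) h) base)"
        using coshd_act[OF det[OF g] pH orb] g h inv mul by simp
      then show ?thesis using pK mul[OF inv[OF g] h] by (simp add: K_def)
    qed
    then show "act g p \<in> K r0" using pH det[OF g] by (simp add: K_def act_in_H3)
  qed
  then show ?thesis using that pK unfolding K_def by blast
qed

lemma exists_tlen_pos:
  fixes \<Gamma> :: "('n::finite \<Rightarrow> mat2) set"
  assumes \<Gamma>: "psl_subgroup Q \<Gamma>" and ne: "nonelementary \<Gamma>"
  shows "\<exists>g\<in>\<Gamma>. tlen (g i) > 0"
proof (rule ccontr)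
  assume "\<not> ?thesis"
  then have le: "tlen (g i) \<le> 0" if "g \<in> \<Gamma>" for g using that by force
  obtain C where C: "\<And>g h. g \<in> \<Gamma> \<Longrightarrow> h \<in> \<Gamma> \<Longrightarrow>
       \<exists>k\<in>\<Gamma>. \<forall>i. \<bar>tlen (k i) - (2 * ln (norm (g i)) + 2 * ln (norm (h i)))\<bar> \<le> C"
    using tlen_product_approx[OF assms] by metis
  have n1: "norm (g i) \<ge> 1" if "g \<in> \<Gamma>" for g
    using psl_subgroup_mdet[OF \<Gamma> that] norm_mat2_ge_1 by blast
  have bdd: "norm (g i) \<le> exp C" if g: "g \<in> \<Gamma>" for g
  proof -
    \<comment> \<open>If no translation length is positive, the estimate for the pair
      \<open>(g, g)\<close> bounds the logarithm of the norm by \<open>C\<close>.\<close>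
    obtain k where k: "k \<in> \<Gamma>" "\<bar>tlen (k i) - (2 * ln (norm (g i)) + 2 * ln (norm (g i)))\<bar> \<le> C"
      using C[OF g g] by blast
    have "ln (norm (g i)) \<ge> 0" using n1[OF g] by simp
    then have "ln (norm (g i)) \<le> C" using k(2) le[OF k(1)] by linarith
    then show ?thesis using n1[OF g] by (smt (verit) exp_le_cancel_iff exp_ln)
  qed
  define H where "H = (\<lambda>g. g i) ` \<Gamma>"
  obtain p where p: "p \<in> H3" "\<And>g. g \<in> H \<Longrightarrow> act g p = p"
  proof (rule bounded_group_fixed_point[of H "exp C"])
    show "mid \<in> H" unfolding H_def using imageI[OF psl_subgroup_mid[OF \<Gamma>], of "\<lambda>g. g i"] .
    show "mmul g h \<in> H" if "g \<in> H" "h \<in> H" for g h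
    proof -
      obtain g' h' where "g = g' i" "g' \<in> \<Gamma>" "h = h' i" "h' \<in> \<Gamma>" using \<open>g \<in> H\<close> \<open>h \<in> H\<close> unfolding H_def by (elim imageE)
      then show ?thesis unfolding H_def using imageI[OF psl_subgroup_mmul[OF \<Gamma>], of g' h' "\<lambda>g. g i"] by simp
    qed
    show "minv g \<in> H" if "g \<in> H" for g
    proof -
      obtain g' where "g = g' i" "g' \<in> \<Gamma>" using \<open>g \<in> H\<close> unfolding H_def by (elim imageE)
      then show ?thesis unfolding H_def using imageI[OF psl_subgroup_minv[OF \<Gamma>], of g' "\<lambda>g. g i"] by simp
    qed
    show "mdet g = 1" "norm g \<le> exp C" if "g \<in> H" for g
      using that psl_subgroup_mdet[OF \<Gamma>] bdd unfolding H_def by auto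
  qed blast
  have "(\<lambda>h. act h p) ` H \<subseteq> {p}" using p(2) by auto
  then have "finite ((\<lambda>h. act h p) ` H)" by (rule finite_subset) simp
  then have "elementary H" using p(1) unfolding elementary_def by (intro disjI1 bexI[of _ p])
  then show False using ne by (simp add: nonelementary_def H_def)
qed

section \<open>Rays and limit points in the product\<close>

lemma XspD: "x \<in> Xsp Q \<Longrightarrow> x i \<in> H3" "x \<in> Xsp Q \<Longrightarrow> i \<notin> Q \<Longrightarrow> Im (fst (x i)) = 0"
  by (simp_all add: Xsp_def)

definition dvec :: "('n::finite \<Rightarrow> complex \<times> real) \<Rightarrow> ('n \<Rightarrow> complex \<times> real) \<Rightarrow> real ^ 'n" where
  "dvec x y = (\<chi> i. dH (x i) (y i))"

lemma dvec_nth [simp]: "dvec x y $ i = dH (x i) (y i)"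
  by (simp add: dvec_def)

lemma dX_eq_norm_dvec: "dX x y = norm (dvec x y)"
  by (simp add: dX_def norm_vec_def L2_set_def)

lemma act_real:
  assumes "real_mat g" "Im (fst p) = 0"
  shows "Im (fst (act g p)) = 0"
proof -
  obtain a b c d where g: "g = (a,b,c,d)" by (cases g)
  obtain z t where p: "p = (z,t)" by (cases p)
  have R: "a \<in> \<real>" "b \<in> \<real>" "c \<in> \<real>" "d \<in> \<real>" "z \<in> \<real>"
    using assms by (auto simp: g p real_mat_def complex_is_Real_iff)
  then have cnj: "cnj (c * z + d) = c * z + d" "cnj c = c"
    by (metis Reals_cnj_iff Reals_add Reals_mult)+
  have "fst (act g p) \<in> \<real>"
    unfolding g p act_def prod.case Let_def fst_conv cnj
    by (intro Reals_divide Reals_add Reals_mult R Reals_of_real)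
  then show ?thesis by (simp add: complex_is_Real_iff)
qed

lemma actX_in_Xsp:
  assumes "psl_subgroup Q \<Gamma>" "g \<in> \<Gamma>" "x \<in> Xsp Q"
  shows "actX g x \<in> Xsp Q"
proof -
  have "g \<in> Gset Q" using assms unfolding psl_subgroup_def by blast
  then show ?thesis using assms(3) by (auto simp: Gset_def Xsp_def actX_def act_in_H3 act_real)
qed

text \<open>Equality in the Euclidean triangle inequality: \<open>a + b\<close> dominates the
  nonnegative vector \<open>d\<close> but is not longer, so it equals \<open>d\<close>, and then
  \<open>a\<close> and \<open>b\<close> are parallel. Applied to vectors of component distances, it
  splits product geodesics into factors.\<close>

lemma vector_segment:
  fixes a b d :: "real ^ 'n"
  assumes d0: "\<And>i. 0 \<le> d $ i" and d1: "\<And>i. d $ i \<le> a $ i + b $ i"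
    and n: "norm a = R" "norm b = T - R" "norm d = T" and T: "T > 0"
  shows "a = (R / T) *\<^sub>R d"
proof -
  have "d \<bullet> d \<le> (a + b) \<bullet> d"
    unfolding inner_vec_def using d0 d1 by (intro sum_mono) (simp add: mult_right_mono)
  moreover have up: "norm (a + b) \<le> T" using norm_triangle_ineq[of a b] n by simp
  then have "(norm (a + b))\<^sup>2 \<le> T\<^sup>2" by (simp add: power_mono)
  moreover have "(norm (a + b - d))\<^sup>2 = (norm (a + b))\<^sup>2 - 2 * ((a + b) \<bullet> d) + (norm d)\<^sup>2"
    unfolding power2_norm_eq_inner by (simp add: inner_diff inner_commute algebra_simps)
  ultimately have "(norm (a + b - d))\<^sup>2 \<le> 0"
    using n(3) by (simp add: power2_norm_eq_inner[symmetric])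
  then have d: "a + b = d" by simp
  then have "norm (a + b) = norm a + norm b" using n by simp
  then have "R *\<^sub>R b = (T - R) *\<^sub>R a" using n norm_triangle_eq by metis
  then have "T *\<^sub>R a = R *\<^sub>R d" using d by (simp add: algebra_simps flip: d)
  then show ?thesis using T by (metis divideR_right less_irrefl scaleR_scaleR inverse_eq_divide
    divide_inverse mult.commute)
qed

lemma dvec_segment:
  assumes x: "x \<in> Xsp Q" and p: "p \<in> Xsp Q" and y: "y \<in> Xsp Q"
    and T: "dX x y > 0" and R: "dX x p = R" "dX p y = dX x y - R"
  shows "dvec x p = (R / dX x y) *\<^sub>R dvec x y"
proof (rule vector_segment)
  show "0 \<le> dvec x y $ i" "dvec x y $ i \<le> dvec x p $ i + dvec p y $ i" for i
    using dH_triangle[of "p i" "x i" "y i"] x p y by (auto simp: XspD dH_nonneg)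
qed (use T R in \<open>simp_all add: dX_eq_norm_dvec\<close>)

lemma dvec_commute:
  assumes "x \<in> Xsp Q" "y \<in> Xsp Q"
  shows "dvec x y = dvec y x"
  using assms by (simp add: vec_eq_iff XspD dH_commute)

text \<open>Any two times lie on a common segment from \<open>c 0\<close>, so component distances
  grow proportionally and time 1 already shows all speeds.\<close>

lemma geod_ray_speed:
  assumes c: "geod_ray Q c"
  obtains w where "norm w = 1" "\<And>t. t \<ge> 0 \<Longrightarrow> dvec (c 0) (c t) = t *\<^sub>R w" "speed_vec c = w"
proof -
  define w where "w = dvec (c 0) (c 1)"
  have X: "c t \<in> Xsp Q" if "t \<ge> 0" for t using c that by (simp add: geod_ray_def)
  have D: "dX (c s) (c t) = \<bar>s - t\<bar>" if "s \<ge> 0" "t \<ge> 0" for s t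
    using c that by (simp add: geod_ray_def)
  have w: "dvec (c 0) (c t) = t *\<^sub>R w" if t: "t \<ge> 0" for t
  proof (cases "t \<le> 1")
    case True
    then show ?thesis
      using dvec_segment[of "c 0" Q "c t" "c 1" t] X t D by (simp add: w_def)
  next
    case False
    then have "w = (1 / t) *\<^sub>R dvec (c 0) (c t)"
      using dvec_segment[of "c 0" Q "c 1" "c t" 1] X t D by (simp add: w_def)
    then show ?thesis using False by simp
  qed
  have "comp_speed c i = w $ i" for i
    unfolding comp_speed_def
  proof (rule tendsto_Lim)
    have "\<forall>\<^sub>F h in at_right 0. w $ i = dH (c 0 i) (c h i) / h"
      using eventually_at_right_less[of 0]
    proof eventually_elim
      case (elim h)
      then have "dvec (c 0) (c h) $ i = h * w $ i" by (simp only: w less_imp_le vector_scaleR_component) simp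
      then show ?case using elim by simp
    qed
    then show "((\<lambda>h. dH (c 0 i) (c h i) / h) \<longlongrightarrow> w $ i) (at_right 0)"
      using tendsto_const Lim_transform_eventually by fast
  qed simp
  then have "speed_vec c = w" by (simp add: speed_vec_def vec_eq_iff)
  moreover have "norm w = 1" using D[of 0 1] by (simp add: w_def dX_eq_norm_dvec)
  ultimately show ?thesis using that w by blast
qed

lemma geo_real: "Im (fst x) = 0 \<Longrightarrow> Im (fst V) = 0 \<Longrightarrow> Im (fst (geo x V s)) = 0"
  by (simp add: geo_def)

lemma segment_point:
  assumes x: "x \<in> Xsp Q" and y: "y \<in> Xsp Q" and T: "dX x y > 0" and R: "0 \<le> R" "R \<le> dX x y"
  obtains p where "p \<in> Xsp Q" "dX x p = R" "dX p y = dX x y - R" "dvec x p = (R / dX x y) *\<^sub>R dvec x y"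
proof -
  have "\<forall>i. \<exists>V. norm V = 1 \<and> geo (x i) V (dH (x i) (y i)) = y i \<and>
      (Im (fst (x i)) = 0 \<longrightarrow> Im (fst (y i)) = 0 \<longrightarrow> Im (fst V) = 0)"
  proof
    fix i
    obtain V where "norm V = 1" "geo (x i) V (dH (x i) (y i)) = y i"
      "Im (fst (x i)) = 0 \<Longrightarrow> Im (fst (y i)) = 0 \<Longrightarrow> Im (fst V) = 0"
      using polar_coordinates[OF XspD(1)[OF x] XspD(1)[OF y]] by blast
    then show "\<exists>V. norm V = 1 \<and> geo (x i) V (dH (x i) (y i)) = y i \<and>
      (Im (fst (x i)) = 0 \<longrightarrow> Im (fst (y i)) = 0 \<longrightarrow> Im (fst V) = 0)" by blast
  qed
  then obtain V where V: "\<And>i. norm (V i) = 1" "\<And>i. geo (x i) (V i) (dH (x i) (y i)) = y i"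
    "\<And>i. Im (fst (x i)) = 0 \<Longrightarrow> Im (fst (y i)) = 0 \<Longrightarrow> Im (fst (V i)) = 0"
    by metis
  \<comment> \<open>Every factor covers the same fraction of its own distance.\<close>
  define \<theta> where "\<theta> = R / dX x y"
  have \<theta>: "0 \<le> \<theta>" "\<theta> \<le> 1" using R T by (simp_all add: \<theta>_def)
  define p where "p i = geo (x i) (V i) (\<theta> * dH (x i) (y i))" for i
  have "p \<in> Xsp Q"
    using V XspD[OF x] XspD[OF y] by (simp add: p_def Xsp_def geo_in_H3 geo_real)
  moreover have e1: "dvec x p = \<theta> *\<^sub>R dvec x y"
  proof (subst vec_eq_iff, intro allI)
    fix i
    show "dvec x p $ i = (\<theta> *\<^sub>R dvec x y) $ i"
      using dH_geo[OF XspD(1)[OF x, of i] V(1)[of i], of 0 "\<theta> * dH (x i) (y i)"] \<theta>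
        dH_nonneg[OF XspD(1)[OF x, of i] XspD(1)[OF y, of i]]
      by (simp add: p_def abs_mult)
  qed
  moreover have e2: "dvec p y = (1 - \<theta>) *\<^sub>R dvec x y"
  proof (subst vec_eq_iff, intro allI)
    fix i
    have "dH (p i) (y i) = \<bar>\<theta> * dH (x i) (y i) - dH (x i) (y i)\<bar>"
      using dH_geo[OF XspD(1)[OF x, of i] V(1)[of i], of "\<theta> * dH (x i) (y i)" "dH (x i) (y i)"]
      unfolding V(2) by (simp add: p_def)
    also have "\<dots> = \<bar>(1 - \<theta>) * dH (x i) (y i)\<bar>" by (simp add: algebra_simps abs_minus_commute)
    finally show "dvec p y $ i = ((1 - \<theta>) *\<^sub>R dvec x y) $ i"
      using \<theta> dH_nonneg[OF XspD(1)[OF x, of i] XspD(1)[OF y, of i]] by (simp add: abs_mult)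
  qed
  moreover have "dX x p = R" "dX p y = dX x y - R"
  proof -
    show "dX x p = R" unfolding dX_eq_norm_dvec e1 using R(1) T by (simp add: \<theta>_def dX_eq_norm_dvec)
    have "dX p y = (1 - \<theta>) * dX x y" unfolding dX_eq_norm_dvec e2 using \<theta> by simp
    also have "\<dots> = dX x y - R" using T by (simp add: \<theta>_def algebra_simps)
    finally show "dX p y = dX x y - R" .
  qed
  ultimately show ?thesis using that unfolding \<theta>_def by blast
qed

lemma dH_geo_tendsto_0:
  assumes x: "x \<in> H3" and Vn: "\<And>n. norm (Vn n) = 1" and V: "norm V = 1"
    and lim: "Vn \<longlonglongrightarrow> V" "sn \<longlonglongrightarrow> s"
  shows "(\<lambda>n. dH (geo x (Vn n) (sn n)) (geo x V s)) \<longlonglongrightarrow> 0"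
proof (rule order_tendstoI)
  fix e :: real assume "e < 0"
  then show "\<forall>\<^sub>F n in sequentially. e < dH (geo x (Vn n) (sn n)) (geo x V s)"
    using dH_nonneg[OF geo_in_H3[OF x Vn] geo_in_H3[OF x V]] less_le_trans by (intro always_eventually) blast
next
  fix e :: real assume e: "0 < e"
  have "(\<lambda>n. cosh (sn n) * cosh s - sinh (sn n) * sinh s * (Vn n \<bullet> V))
      \<longlonglongrightarrow> cosh s * cosh s - sinh s * sinh s * (V \<bullet> V)"
    by (intro tendsto_intros lim)
  moreover have "V \<bullet> V = 1" using V by (simp add: norm_eq_1)
  moreover have "cosh s * cosh s - sinh s * sinh s = 1"
    using hyperbolic_pythagoras[of s] by (simp add: power2_eq_square)
  ultimately have "(\<lambda>n. coshd (geo x (Vn n) (sn n)) (geo x V s)) \<longlonglongrightarrow> 1"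
    using x Vn V by (simp add: coshd_geo)
  moreover have "1 < cosh e" using e by (metis cosh_0 cosh_real_strict_mono order_refl)
  ultimately have "\<forall>\<^sub>F n in sequentially. coshd (geo x (Vn n) (sn n)) (geo x V s) < cosh e"
    by (rule order_tendstoD)
  then show "\<forall>\<^sub>F n in sequentially. dH (geo x (Vn n) (sn n)) (geo x V s) < e"
  proof eventually_elim
    case (elim n)
    have H: "geo x (Vn n) (sn n) \<in> H3" "geo x V s \<in> H3" using geo_in_H3 x Vn V by auto
    then show ?case using elim e dH_nonneg[OF H] cosh_dH[OF H] cosh_real_nonneg_less_iff by force
  qed
qed

text \<open>Orbit points far away with distance vectors in direction nearly \<open>u\<close> still
  need converging directions in each factor; compactness of the unit spheres provides these along a
  subsequence. The limit directions with speeds \<open>u\<close> define the ray, and positive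
  entries of \<open>u\<close> make it regular.\<close>

lemma in_proj_limit_setI:
  fixes \<Gamma> :: "('n::finite \<Rightarrow> mat2) set"
  assumes \<Gamma>: "psl_subgroup Q \<Gamma>" and x: "x \<in> Xsp Q" and u: "norm u = 1" "\<And>i. u $ i > 0"
    and appr: "\<And>N::nat. \<exists>g\<in>\<Gamma>. dX x (actX g x) > N \<and> norm (sgn (dvec x (actX g x)) - u) < 1 / Suc N"
  shows "u \<in> proj_limit_set Q \<Gamma> x"
proof -
  have xH: "x i \<in> H3" for i using XspD[OF x] by simp
  have "\<exists>g. \<forall>N::nat. g N \<in> \<Gamma> \<and> dX x (actX (g N) x) > N \<and> norm (sgn (dvec x (actX (g N) x)) - u) < 1 / Suc N"
    by (rule choice) (use appr in blast)
  then obtain g where g: "\<And>N::nat. g N \<in> \<Gamma>" "\<And>N::nat. dX x (actX (g N) x) > N"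
    "\<And>N::nat. norm (sgn (dvec x (actX (g N) x)) - u) < 1 / Suc N" by blast
  define y where "y N = actX (g N) x" for N
  define T where "T N = dX x (y N)" for N
  have y: "y N \<in> Xsp Q" for N unfolding y_def using actX_in_Xsp[OF \<Gamma> g(1) x] .
  have T: "T N > N" for N using g(2) by (simp add: T_def y_def)
  have "\<forall>N. \<exists>V :: (complex \<times> real) ^ 'n. \<forall>i. norm (V $ i) = 1 \<and> geo (x i) (V $ i) (dH (x i) (y N i)) = y N i \<and>
      (i \<notin> Q \<longrightarrow> Im (fst (V $ i)) = 0)"
  proof
    fix N
    have "\<forall>i. \<exists>V. norm V = 1 \<and> geo (x i) V (dH (x i) (y N i)) = y N i \<and> (i \<notin> Q \<longrightarrow> Im (fst V) = 0)"
    proof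
      fix i
      obtain V where "norm V = 1" "geo (x i) V (dH (x i) (y N i)) = y N i"
        "Im (fst (x i)) = 0 \<Longrightarrow> Im (fst (y N i)) = 0 \<Longrightarrow> Im (fst V) = 0"
        using polar_coordinates[OF xH XspD(1)[OF y]] by blast
      then show "\<exists>V. norm V = 1 \<and> geo (x i) V (dH (x i) (y N i)) = y N i \<and> (i \<notin> Q \<longrightarrow> Im (fst V) = 0)"
        using XspD(2)[OF x] XspD(2)[OF y] by blast
    qed
    then obtain V where "\<And>i. norm (V i) = 1 \<and> geo (x i) (V i) (dH (x i) (y N i)) = y N i \<and>
      (i \<notin> Q \<longrightarrow> Im (fst (V i)) = 0)" by metis
    then show "\<exists>V :: (complex \<times> real) ^ 'n. \<forall>i. norm (V $ i) = 1 \<and> geo (x i) (V $ i) (dH (x i) (y N i)) = y N i \<and>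
      (i \<notin> Q \<longrightarrow> Im (fst (V $ i)) = 0)" by (intro exI[of _ "\<chi> i. V i"]) simp
  qed
  then obtain V :: "nat \<Rightarrow> (complex \<times> real) ^ 'n" where V: "\<And>N i. norm (V N $ i) = 1"
    "\<And>N i. geo (x i) (V N $ i) (dH (x i) (y N i)) = y N i"
    "\<And>N i. i \<notin> Q \<Longrightarrow> Im (fst (V N $ i)) = 0" by metis
  define S where "S = {V :: (complex \<times> real) ^ 'n. \<forall>i. norm (V $ i) = 1}"
  have "closed {V :: (complex \<times> real) ^ 'n. norm (V $ i) = 1}" for i
    by (intro closed_Collect_eq continuous_intros)
  then have "closed S" unfolding S_def Collect_all_eq by (intro closed_INT ballI)
  moreover have "bounded S"
  proof (rule boundedI)
    fix V assume V: "V \<in> S"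
    have "norm V \<le> (\<Sum>i\<in>UNIV. norm (V $ i))" unfolding norm_vec_def by (intro L2_set_le_sum) simp
    then show "norm V \<le> CARD('n)" using V by (simp add: S_def)
  qed
  ultimately have "compact S" using compact_eq_bounded_closed by blast
  moreover have "\<forall>N. V N \<in> S" using V(1) by (simp add: S_def)
  ultimately obtain W \<sigma> where W: "W \<in> S" "strict_mono (\<sigma> :: nat \<Rightarrow> nat)" "(V \<circ> \<sigma>) \<longlonglongrightarrow> W"
    using compact_imp_seq_compact seq_compactE by metis
  have W1: "norm (W $ i) = 1" for i using W(1) by (simp add: S_def)
  have Wlim: "(\<lambda>n. V (\<sigma> n) $ i) \<longlonglongrightarrow> W $ i" for i
    using tendsto_vec_nth[OF W(3), of i] by (simp add: o_def)
  have WQ: "Im (fst (W $ i)) = 0" if "i \<notin> Q" for i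
  proof -
    have "(\<lambda>n. Im (fst (V (\<sigma> n) $ i))) \<longlonglongrightarrow> Im (fst (W $ i))"
      by (intro tendsto_intros Wlim)
    then show ?thesis using V(3)[OF that] LIMSEQ_unique[OF _ tendsto_const] by simp
  qed
  define c where "c t = (\<lambda>i. geo (x i) (W $ i) (t * u $ i))" for t
  have dc: "dvec (c s) (c t) = \<bar>s - t\<bar> *\<^sub>R u" for s t
    using u(2) by (simp add: vec_eq_iff c_def dH_geo[OF xH W1] abs_mult less_imp_le
        flip: left_diff_distrib)
  have c0: "c 0 = x" by (simp add: c_def)
  have cX: "c t \<in> Xsp Q" for t
    using xH W1 XspD(2)[OF x] WQ by (simp add: c_def Xsp_def geo_in_H3 geo_real)
  have ray: "geod_ray Q c"
    unfolding geod_ray_def dX_eq_norm_dvec dc using cX u(1) by simp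
  obtain w where w: "\<And>t. t \<ge> 0 \<Longrightarrow> dvec (c 0) (c t) = t *\<^sub>R w" "speed_vec c = w"
    using geod_ray_speed[OF ray] by blast
  have "w = u" using w(1)[of 1] dc[of 0 1] by simp
  then have sp: "sgn (speed_vec c) = u" using w(2) u(1) by (simp add: sgn_div_norm)
  have reg: "regular_ray c"
    unfolding regular_ray_def
  proof
    fix i
    have "dH (c 0 i) (c 1 i) = u $ i" using arg_cong[OF dc[of 0 1], of "\<lambda>v. v $ i"] by simp
    then have "c 1 i \<noteq> c 0 i"
      using u(2)[of i] dH_eq_0_iff[OF XspD(1)[OF cX] XspD(1)[OF cX], of 0 i 1 i] by auto
    then show "\<exists>t\<ge>0. c t i \<noteq> c 0 i" by (intro exI[of _ 1]) simp
  qed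
  have "in_limit_set Q \<Gamma> x c"
    unfolding in_limit_set_def
  proof (intro conjI ray allI impI)
    fix R \<epsilon> :: real assume R: "R > 0" and \<epsilon>: "\<epsilon> > 0"
    \<comment> \<open>The distance covered in factor \<open>i\<close> by the point at distance
      \<open>R\<close> on the segment from \<open>x\<close> to the orbit point.\<close>
    define s where "s n i = R * (sgn (dvec x (y (\<sigma> n))) $ i)" for n i
    have "(\<lambda>N. norm (sgn (dvec x (y N)) - u)) \<longlonglongrightarrow> 0"
    proof (rule tendsto_sandwich[OF _ _ tendsto_const])
      show "(\<lambda>N. 1 / real (Suc N)) \<longlonglongrightarrow> 0" using LIMSEQ_Suc[OF lim_1_over_n] .
      show "\<forall>\<^sub>F N in sequentially. norm (sgn (dvec x (y N)) - u) \<le> 1 / real (Suc N)"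
        using g(3) by (intro always_eventually) (auto simp: y_def intro: less_imp_le)
    qed simp
    then have "(\<lambda>N. sgn (dvec x (y N))) \<longlonglongrightarrow> u"
      using Lim_null tendsto_norm_zero_iff by blast
    then have "(\<lambda>n. sgn (dvec x (y (\<sigma> n)))) \<longlonglongrightarrow> u"
      using LIMSEQ_subseq_LIMSEQ[OF _ W(2)] by (force simp: o_def)
    then have slim: "(\<lambda>n. s n i) \<longlonglongrightarrow> R * u $ i" for i
      unfolding s_def by (intro tendsto_intros)
    define e where "e n i = dH (geo (x i) (V (\<sigma> n) $ i) (s n i)) (c R i)" for n i
    have "(\<lambda>n. e n i) \<longlonglongrightarrow> 0" for i
      unfolding e_def c_def by (rule dH_geo_tendsto_0[OF xH V(1) W1 Wlim slim])
    then have "(\<lambda>n. sqrt (\<Sum>i\<in>UNIV. (e n i)\<^sup>2)) \<longlonglongrightarrow> sqrt (\<Sum>i\<in>(UNIV :: 'n set). 0\<^sup>2)"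
      by (intro tendsto_intros)
    then have "\<forall>\<^sub>F n in sequentially. sqrt (\<Sum>i\<in>UNIV. (e n i)\<^sup>2) < \<epsilon>"
      using \<epsilon> by (intro order_tendstoD(2)) auto
    then obtain n0 where n0: "\<And>n. n \<ge> n0 \<Longrightarrow> sqrt (\<Sum>i\<in>UNIV. (e n i)\<^sup>2) < \<epsilon>"
      unfolding eventually_sequentially by blast
    obtain n1 :: nat where n1: "n1 > R" using reals_Archimedean2 by blast
    define n where "n = max n0 n1"
    have TR: "T (\<sigma> n) > R"
    proof -
      have "n \<le> \<sigma> n" using W(2) by (rule strict_mono_imp_increasing)
      then show ?thesis using T[of "\<sigma> n"] n1 by (simp add: n_def)
    qed
    show "\<exists>g\<in>\<Gamma>. dX (c 0) (actX g x) > R \<and> (\<forall>p\<in>Xsp Q. dX (c 0) p = R \<and>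
        dX p (actX g x) = dX (c 0) (actX g x) - R \<longrightarrow> dX p (c R) < \<epsilon>)"
    proof (intro bexI[of _ "g (\<sigma> n)"] conjI ballI impI)
      show "g (\<sigma> n) \<in> \<Gamma>" by (rule g(1))
      show "dX (c 0) (actX (g (\<sigma> n)) x) > R" using TR by (simp add: c0 T_def y_def)
      fix p assume p: "p \<in> Xsp Q" and pd: "dX (c 0) p = R \<and> dX p (actX (g (\<sigma> n)) x) = dX (c 0) (actX (g (\<sigma> n)) x) - R"
      let ?y = "y (\<sigma> n)"
      have pd': "dX x p = R" "dX p ?y = dX x ?y - R" using pd by (auto simp: c0 y_def)
      have pos: "dX x ?y > 0" using TR R by (simp add: T_def)
      have seg: "dvec x p = (R / dX x ?y) *\<^sub>R dvec x ?y"
        by (rule dvec_segment[OF x p y pos pd'])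
      \<comment> \<open>The same segment read backwards gives the remaining distance in each factor,
        so that \<open>p\<close> is determined factor by factor.\<close>
      have seg': "dvec ?y p = ((dX x ?y - R) / dX ?y x) *\<^sub>R dvec ?y x"
        by (rule dvec_segment[OF y p x])
          (use pos pd' dvec_commute[OF x y] dvec_commute[OF p y] dvec_commute[OF x p] in \<open>auto simp: dX_eq_norm_dvec\<close>)
      have pi: "p i = geo (x i) (V (\<sigma> n) $ i) (s n i)" for i
      proof (rule geo_unique[OF xH V(1) XspD(1)[OF p]])
        have 1: "dH (x i) (p i) = (R / dX x ?y) * dH (x i) (?y i)"
          using arg_cong[OF seg, of "\<lambda>v. v $ i"] by simp
        then show "dH (x i) (p i) = s n i"
          by (simp add: s_def sgn_div_norm dX_eq_norm_dvec divide_inverse)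
        have "dH (p i) (?y i) = ((dX x ?y - R) / dX x ?y) * dH (x i) (?y i)"
          using arg_cong[OF seg', of "\<lambda>v. v $ i"] dvec_commute[OF x y] XspD(1)[OF p] XspD(1)[OF y] XspD(1)[OF x]
          by (simp add: dX_eq_norm_dvec dH_commute)
        also have "\<dots> = dH (x i) (?y i) - (R / dX x ?y) * dH (x i) (?y i)"
          using pos by (simp add: field_simps)
        finally show "dH (p i) (geo (x i) (V (\<sigma> n) $ i) (dH (x i) (?y i))) = dH (x i) (?y i) - s n i"
          unfolding V(2) 1[symmetric] \<open>dH (x i) (p i) = s n i\<close> .
      qed
      have "dX p (c R) = sqrt (\<Sum>i\<in>UNIV. (e n i)\<^sup>2)"
        unfolding dX_def e_def by (simp only: pi)
      then show "dX p (c R) < \<epsilon>" using n0[of n] by (simp add: n_def)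
    qed
  qed
  then show ?thesis unfolding proj_limit_set_def using reg sp by blast
qed

section \<open>The limit cone\<close>

abbreviation tvec :: "('n::finite \<Rightarrow> mat2) \<Rightarrow> real ^ 'n" where
  "tvec g \<equiv> (\<chi> i. tlen (g i))"

text \<open>Multiples of single translation vectors already form a cone, so cone vectors are limits
  of such multiples and no sums are involved.\<close>

lemma limit_cone_eq_closure:
  "limit_cone \<Gamma> = closure {t *\<^sub>R tvec g | t g. t \<ge> 0 \<and> g \<in> \<Gamma>}" (is "_ = closure ?S")
proof
  have "cone ?S"
    unfolding cone_def
  proof (intro ballI allI impI)
    fix v and c :: real assume "v \<in> ?S" "0 \<le> c"
    then obtain t g where "v = t *\<^sub>R tvec g" "t \<ge> 0" "g \<in> \<Gamma>" by blast
    then show "c *\<^sub>R v \<in> ?S"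
      using \<open>0 \<le> c\<close> by (intro CollectI exI[of _ "c * t"] exI[of _ g]) simp
  qed
  then have "cone (closure ?S)" by (rule cone_closure)
  moreover have "tvec g \<in> closure ?S" if "g \<in> \<Gamma>" for g
    by (rule subsetD[OF closure_subset]) (use that in \<open>intro CollectI exI[of _ 1] exI[of _ g], simp\<close>)
  ultimately show "limit_cone \<Gamma> \<subseteq> closure ?S"
    unfolding limit_cone_def by (intro Inter_lower CollectI conjI ballI closed_closure)
  show "closure ?S \<subseteq> limit_cone \<Gamma>"
    unfolding limit_cone_def
  proof (rule Inter_greatest)
    fix C assume "C \<in> {C. closed C \<and> cone C \<and> (\<forall>g\<in>\<Gamma>. tvec g \<in> C)}"
    then have C: "closed C" "cone C" "\<And>g. g \<in> \<Gamma> \<Longrightarrow> tvec g \<in> C" by auto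
    then have "?S \<subseteq> C" by (auto simp: cone_def)
    then show "closure ?S \<subseteq> C" using C(1) by (rule closure_minimal)
  qed
qed

lemma closed_limit_cone: "closed (limit_cone \<Gamma>)"
  unfolding limit_cone_def by (intro closed_Inter) blast

lemma cone_limit_cone: "cone (limit_cone \<Gamma>)"
  unfolding limit_cone_def cone_def by blast

lemma tvec_in_limit_cone:
  assumes "g \<in> \<Gamma>" "t \<ge> 0"
  shows "t *\<^sub>R tvec g \<in> limit_cone \<Gamma>"
proof -
  have "tvec g \<in> limit_cone \<Gamma>"
    unfolding limit_cone_def by (rule InterI) (elim CollectE conjE, erule bspec[OF _ assms(1)])
  then show ?thesis using cone_limit_cone assms(2) unfolding cone_def by blast
qed

lemma limit_cone_nonneg:
  assumes "psl_subgroup Q \<Gamma>" "v \<in> limit_cone \<Gamma>"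
  shows "v $ i \<ge> 0"
proof -
  have "closed {v :: real ^ 'a. 0 \<le> v $ i}" by (intro closed_Collect_le continuous_intros)
  moreover have "cone {v :: real ^ 'a. 0 \<le> v $ i}" by (simp add: cone_def)
  moreover have "\<forall>g\<in>\<Gamma>. tvec g \<in> {v. 0 \<le> v $ i}"
    using tlen_nonneg psl_subgroup_mdet[OF assms(1)] by simp
  ultimately have "v \<in> {v. 0 \<le> v $ i}" using assms(2) unfolding limit_cone_def by blast
  then show ?thesis by simp
qed

lemma psl_subgroup_mpow:
  assumes "psl_subgroup Q \<Gamma>" "g \<in> \<Gamma>"
  shows "(\<lambda>i. mpow (g i) n) \<in> \<Gamma>"
proof (induction n)
  case 0
  then show ?case using psl_subgroup_mid[OF assms(1)] by simp
next
  case (Suc n)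
  then show ?case using psl_subgroup_mmul[OF assms Suc] by (simp add: mpow_Suc)
qed

lemma tendsto_floor_average:
  assumes "a \<ge> 0"
  shows "(\<lambda>n. real (nat \<lfloor>a * real n\<rfloor>) / n) \<longlonglongrightarrow> a"
proof (rule tendsto_sandwich)
  have "(\<lambda>n. a - 1 / real n) \<longlonglongrightarrow> a - 0" by (intro tendsto_intros lim_1_over_n)
  then show "(\<lambda>n. a - 1 / real n) \<longlonglongrightarrow> a" by simp
  show "\<forall>\<^sub>F n in sequentially. a - 1 / real n \<le> real (nat \<lfloor>a * real n\<rfloor>) / n"
  proof (rule eventually_sequentiallyI[of 1])
    fix n :: nat assume "n \<ge> 1"
    have "a * n - 1 \<le> real (nat \<lfloor>a * real n\<rfloor>)" using assms by linarith
    then have "(a * n - 1) / n \<le> real (nat \<lfloor>a * real n\<rfloor>) / n" by (simp add: divide_right_mono)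
    then show "a - 1 / real n \<le> real (nat \<lfloor>a * real n\<rfloor>) / n"
      using \<open>n \<ge> 1\<close> by (simp add: diff_divide_distrib)
  qed
  show "\<forall>\<^sub>F n in sequentially. real (nat \<lfloor>a * real n\<rfloor>) / n \<le> a"
  proof (rule eventually_sequentiallyI[of 1])
    fix n :: nat assume "n \<ge> 1"
    moreover have "real (nat \<lfloor>a * real n\<rfloor>) \<le> a * n" using assms by (simp add: of_nat_nat)
    ultimately show "real (nat \<lfloor>a * real n\<rfloor>) / n \<le> a" by (simp add: field_simps)
  qed
qed simp

text \<open>Allows real coefficients to be imitated by integer exponents. For \<open>a = 0\<close>
  the index stays at 0, so that case is separate.\<close>

lemma tendsto_floor_growth:
  fixes f :: "nat \<Rightarrow> real"
  assumes f: "(\<lambda>n. f n / n) \<longlonglongrightarrow> l" and a: "a \<ge> 0"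
  shows "(\<lambda>n. f (nat \<lfloor>a * real n\<rfloor>) / n) \<longlonglongrightarrow> a * l"
proof (cases "a = 0")
  case True
  have "(\<lambda>n. f 0 * (1 / real n)) \<longlonglongrightarrow> f 0 * 0" by (intro tendsto_intros lim_1_over_n)
  then show ?thesis using True by simp
next
  case False
  define m where "m n = nat \<lfloor>a * real n\<rfloor>" for n :: nat
  have av: "(\<lambda>n. real (m n) / n) \<longlonglongrightarrow> a" unfolding m_def using a by (rule tendsto_floor_average)
  have mge: "real (m n) \<ge> a * n - 1" for n using a unfolding m_def by linarith
  have "filterlim m sequentially sequentially"
    unfolding filterlim_at_top eventually_sequentially
  proof
    fix Z :: nat
    obtain n0 :: nat where n0: "n0 * a > Z + 1" using reals_Archimedean3[of a] a False by (auto simp: less_le)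
    have "Z \<le> m n" if "n \<ge> n0" for n
    proof -
      have "n0 * a \<le> n * a" using that a by (intro mult_right_mono) auto
      then show ?thesis using n0 mge[of n] by (simp add: mult.commute)
    qed
    then show "\<exists>N. \<forall>n\<ge>N. Z \<le> m n" by blast
  qed
  note mlim = this
  have "(\<lambda>n. f (m n) / m n) \<longlonglongrightarrow> l" using filterlim_compose[OF f mlim] .
  then have "(\<lambda>n. (real (m n) / n) * (f (m n) / m n)) \<longlonglongrightarrow> a * l" by (intro tendsto_mult av)
  moreover have "\<forall>\<^sub>F n in sequentially. (real (m n) / n) * (f (m n) / m n) = f (m n) / n"
    using eventually_compose_filterlim[OF eventually_gt_at_top[of 0] mlim]
    by eventually_elim simp
  ultimately show ?thesis unfolding m_def by (rule Lim_transform_eventually)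
qed

lemma limit_cone_combination:
  fixes \<Gamma> :: "('n::finite \<Rightarrow> mat2) set"
  assumes \<Gamma>: "psl_subgroup Q \<Gamma>" and ne: "nonelementary \<Gamma>"
    and g: "g \<in> \<Gamma>" and h: "h \<in> \<Gamma>" and a: "a \<ge> 0" and b: "b \<ge> 0"
  shows "a *\<^sub>R tvec g + b *\<^sub>R tvec h \<in> limit_cone \<Gamma>"
proof -
  obtain C where C: "\<And>g h. g \<in> \<Gamma> \<Longrightarrow> h \<in> \<Gamma> \<Longrightarrow>
       \<exists>k\<in>\<Gamma>. \<forall>i. \<bar>tlen (k i) - (2 * ln (norm (g i)) + 2 * ln (norm (h i)))\<bar> \<le> C"
    using tlen_product_approx[OF \<Gamma> ne] by metis
  \<comment> \<open>Powers of \<open>g\<close> and \<open>h\<close> with exponents about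
    \<open>a n\<close> and \<open>b n\<close> are joined into one element; its translation vector
    divided by \<open>n\<close> tends to the combination, with error at most \<open>C / n\<close>
    per entry.\<close>
  define m where "m n = nat \<lfloor>a * real n\<rfloor>" for n :: nat
  define m' where "m' n = nat \<lfloor>b * real n\<rfloor>" for n :: nat
  have "\<exists>k. \<forall>n. k n \<in> \<Gamma> \<and> (\<forall>i. \<bar>tlen (k n i) - (2 * ln (norm (mpow (g i) (m n)))
      + 2 * ln (norm (mpow (h i) (m' n))))\<bar> \<le> C)"
  proof (rule choice, rule allI)
    fix n
    from C[OF psl_subgroup_mpow[OF \<Gamma> g, of "m n"] psl_subgroup_mpow[OF \<Gamma> h, of "m' n"]]
    show "\<exists>k. k \<in> \<Gamma> \<and> (\<forall>i. \<bar>tlen (k i) - (2 * ln (norm (mpow (g i) (m n)))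
      + 2 * ln (norm (mpow (h i) (m' n))))\<bar> \<le> C)" by (simp only: Bex_def)
  qed
  then obtain k where k': "\<forall>n. k n \<in> \<Gamma> \<and> (\<forall>i. \<bar>tlen (k n i) - (2 * ln (norm (mpow (g i) (m n)))
      + 2 * ln (norm (mpow (h i) (m' n))))\<bar> \<le> C)" by (elim exE)
  then have k: "\<And>n. k n \<in> \<Gamma>" "\<And>n i. \<bar>tlen (k n i) - (2 * ln (norm (mpow (g i) (m n)))
      + 2 * ln (norm (mpow (h i) (m' n))))\<bar> \<le> C" by simp_all
  have "(\<lambda>n. tlen (k n i) / n) \<longlonglongrightarrow> a * tlen (g i) + b * tlen (h i)" for i
  proof -
    define e where "e n = tlen (k n i) - (2 * ln (norm (mpow (g i) (m n)))
      + 2 * ln (norm (mpow (h i) (m' n))))" for n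
    have "(\<lambda>n. C * (1 / real n)) \<longlonglongrightarrow> C * 0" by (intro tendsto_intros lim_1_over_n)
    then have "(\<lambda>n. C / real n) \<longlonglongrightarrow> 0" by simp
    then have "(\<lambda>n. e n / n) \<longlonglongrightarrow> 0"
    proof (rule Lim_null_comparison[rotated])
      show "\<forall>\<^sub>F n in sequentially. norm (e n / n) \<le> C / n"
        using k(2) by (intro always_eventually allI) (simp add: e_def divide_right_mono)
    qed
    moreover have "(\<lambda>n. 2 * ln (norm (mpow (g i) (m n))) / n) \<longlonglongrightarrow> a * tlen (g i)"
      unfolding m_def
      by (rule tendsto_floor_growth[OF ln_norm_mpow_tendsto_tlen[OF psl_subgroup_mdet[OF \<Gamma> g]] a])
    moreover have "(\<lambda>n. 2 * ln (norm (mpow (h i) (m' n))) / n) \<longlonglongrightarrow> b * tlen (h i)"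
      unfolding m'_def
      by (rule tendsto_floor_growth[OF ln_norm_mpow_tendsto_tlen[OF psl_subgroup_mdet[OF \<Gamma> h]] b])
    ultimately have "(\<lambda>n. e n / n + 2 * ln (norm (mpow (g i) (m n))) / n + 2 * ln (norm (mpow (h i) (m' n))) / n)
        \<longlonglongrightarrow> 0 + a * tlen (g i) + b * tlen (h i)" by (intro tendsto_add)
    then show ?thesis by (simp add: e_def flip: add_divide_distrib)
  qed
  then have "(\<lambda>n. (1 / real n) *\<^sub>R tvec (k n)) \<longlonglongrightarrow> a *\<^sub>R tvec g + b *\<^sub>R tvec h"
    by (intro vec_tendstoI) simp
  then show ?thesis
    by (rule closed_sequentially[OF closed_limit_cone, rotated]) (rule tvec_in_limit_cone[OF k(1)], simp)
qed

lemma limit_cone_add: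
  fixes \<Gamma> :: "('n::finite \<Rightarrow> mat2) set"
  assumes \<Gamma>: "psl_subgroup Q \<Gamma>" and ne: "nonelementary \<Gamma>"
    and u: "u \<in> limit_cone \<Gamma>" and v: "v \<in> limit_cone \<Gamma>"
  shows "u + v \<in> limit_cone \<Gamma>"
proof -
  obtain un where un: "\<And>n. \<exists>t g. un n = t *\<^sub>R tvec g \<and> t \<ge> 0 \<and> g \<in> \<Gamma>" "un \<longlonglongrightarrow> u"
    using u unfolding limit_cone_eq_closure closure_sequential by blast
  obtain vn where vn: "\<And>n. \<exists>t g. vn n = t *\<^sub>R tvec g \<and> t \<ge> 0 \<and> g \<in> \<Gamma>" "vn \<longlonglongrightarrow> v"
    using v unfolding limit_cone_eq_closure closure_sequential by blast
  have in_cone: "un n + vn n \<in> limit_cone \<Gamma>" for n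
  proof -
    obtain s g where sg: "un n = s *\<^sub>R tvec g" "s \<ge> 0" "g \<in> \<Gamma>" using un(1)[of n] by (elim exE conjE)
    obtain t h where th: "vn n = t *\<^sub>R tvec h" "t \<ge> 0" "h \<in> \<Gamma>" using vn(1)[of n] by (elim exE conjE)
    show ?thesis unfolding sg th by (rule limit_cone_combination[OF \<Gamma> ne sg(3) th(3) sg(2) th(2)])
  qed
  show ?thesis
    by (rule closed_sequentially[OF closed_limit_cone in_cone tendsto_add[OF un(2) vn(2)]])
qed

lemma limit_cone_positive_vector:
  fixes \<Gamma> :: "('n::finite \<Rightarrow> mat2) set"
  assumes \<Gamma>: "psl_subgroup Q \<Gamma>" and ne: "nonelementary \<Gamma>"
  obtains w where "w \<in> limit_cone \<Gamma>" "\<And>i. w $ i > 0"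
proof -
  \<comment> \<open>The elements may depend on the factor; adding their translation vectors makes
    every entry positive.\<close>
  have "\<forall>i. \<exists>g. g \<in> \<Gamma> \<and> tlen (g i) > 0" using exists_tlen_pos[OF assms] by blast
  then obtain g where g: "\<And>i. g i \<in> \<Gamma>" "\<And>i. tlen (g i i) > 0" by metis
  have in_cone: "tvec (g j) \<in> limit_cone \<Gamma>" for j
    using tvec_in_limit_cone[OF g(1), of 1 j] by simp
  have 0: "0 \<in> limit_cone \<Gamma>"
    using tvec_in_limit_cone[OF g(1), of 0] by simp
  have "(\<Sum>j\<in>A. tvec (g j)) \<in> limit_cone \<Gamma>" if "finite A" for A
    using that by (induction A) (simp_all add: 0 limit_cone_add[OF assms in_cone])
  then have "(\<Sum>j\<in>UNIV. tvec (g j)) \<in> limit_cone \<Gamma>" by simp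
  moreover have "(\<Sum>j\<in>UNIV. tvec (g j)) $ i > 0" for i
  proof -
    have "(\<Sum>j\<in>UNIV. tvec (g j)) $ i = (\<Sum>j\<in>UNIV. tlen (g j i))" by simp
    also have "\<dots> > 0"
      using g(2)[of i] tlen_nonneg[OF psl_subgroup_mdet[OF \<Gamma> g(1)]] by (intro sum_pos2[of _ i]) auto
    finally show ?thesis .
  qed
  ultimately show ?thesis using that by blast
qed

section \<open>Comparison of the projective limit set with the limit cone\<close>

lemma displacement_ln_norm:
  assumes g: "mdet g = 1" and p: "p \<in> H3"
  shows "\<bar>dH p (act g p) - 2 * ln (norm g)\<bar> \<le> 2 * dH p base + ln 2"
  using dH_base_change[OF g p base_in_H3] dH_base_change[OF g base_in_H3 p]
    dH_base_act_bounds[OF g] dH_commute[OF p base_in_H3] by (smt (verit) ln_ge_zero)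

text \<open>An orbit point near the ray at distance \<open>R\<close> has a displacement vector whose
  direction differs from the speed vector by order \<open>1 / R\<close>, and some translation vector
  stays within a bounded distance of that displacement.\<close>

lemma proj_limit_set_subset:
  fixes \<Gamma> :: "('n::finite \<Rightarrow> mat2) set"
  assumes \<Gamma>: "psl_subgroup Q \<Gamma>" and ne: "nonelementary \<Gamma>" and x: "x \<in> Xsp Q"
    and u: "u \<in> proj_limit_set Q \<Gamma> x"
  shows "u \<in> limit_cone \<Gamma> \<and> norm u = 1 \<and> (\<forall>i. u $ i > 0)"
proof -
  obtain c where c: "u = sgn (speed_vec c)" "in_limit_set Q \<Gamma> x c" "regular_ray c"
    using u unfolding proj_limit_set_def by blast
  have ray: "geod_ray Q c" using c(2) by (simp add: in_limit_set_def)
  have cX: "c t \<in> Xsp Q" if "t \<ge> 0" for t using ray that by (simp add: geod_ray_def)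
  have c0: "c 0 \<in> Xsp Q" by (rule cX) simp
  obtain w where w: "norm w = 1" "\<And>t. t \<ge> 0 \<Longrightarrow> dvec (c 0) (c t) = t *\<^sub>R w" "speed_vec c = w"
    using geod_ray_speed[OF ray] by blast
  have uw: "u = w" using c(1) w by (simp add: sgn_div_norm)
  have "w $ i > 0" for i
  proof -
    obtain t where t: "t \<ge> 0" "c t i \<noteq> c 0 i" using c(3) unfolding regular_ray_def by blast
    have "dH (c 0 i) (c t i) = t * w $ i" using arg_cong[OF w(2)[OF t(1)], of "\<lambda>v. v $ i"] by simp
    moreover have "dH (c 0 i) (c t i) > 0"
      using t dH_eq_0_iff[OF XspD(1)[OF c0] XspD(1)[OF cX], of t i i] dH_nonneg[OF XspD(1)[OF c0] XspD(1)[OF cX], of t i i]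
      by (auto simp: less_le)
    ultimately show ?thesis using t(1) by (simp add: zero_less_mult_iff)
  qed
  moreover have "w \<in> limit_cone \<Gamma>"
  proof -
    obtain C where C: "C > 0" "\<And>g h. g \<in> \<Gamma> \<Longrightarrow> h \<in> \<Gamma> \<Longrightarrow>
       \<exists>k\<in>\<Gamma>. \<forall>i. \<bar>tlen (k i) - (2 * ln (norm (g i)) + 2 * ln (norm (h i)))\<bar> \<le> C"
      using tlen_product_approx[OF \<Gamma> ne] by metis
    \<comment> \<open>Collects the errors: 1 from closeness to the ray, \<open>C\<close> and the
      norm of \<open>mid\<close> from the translation estimate with second element the identity, the
      rest from moving between \<open>c 0\<close>, \<open>x\<close> and the base point.\<close>
    define B where "B = 1 + C + 2 * \<bar>ln (norm mid)\<bar> + ln 2 + (\<Sum>i\<in>(UNIV::'n set). 2 * dH (x i) base + dH (c 0 i) (x i))"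
    have key: "\<exists>v\<in>limit_cone \<Gamma>. norm (v - w) \<le> CARD('n) * (B / R)" if R: "R > 0" for R
    proof -
      obtain g where g: "g \<in> \<Gamma>" "dX (c 0) (actX g x) > R" and
        near: "\<And>p. p \<in> Xsp Q \<Longrightarrow> dX (c 0) p = R \<Longrightarrow> dX p (actX g x) = dX (c 0) (actX g x) - R \<Longrightarrow> dX p (c R) < 1"
      proof -
        have "\<forall>\<epsilon>>0. \<exists>g\<in>\<Gamma>. dX (c 0) (actX g x) > R \<and> (\<forall>p\<in>Xsp Q. dX (c 0) p = R
            \<and> dX p (actX g x) = dX (c 0) (actX g x) - R \<longrightarrow> dX p (c R) < \<epsilon>)"
          using c(2) R unfolding in_limit_set_def by simp
        from this[THEN spec, THEN mp, OF zero_less_one] show ?thesis using that by blast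
      qed
      define y where "y = actX g x"
      have y: "y \<in> Xsp Q" unfolding y_def by (rule actX_in_Xsp[OF \<Gamma> g(1) x])
      define T where "T = dX (c 0) y"
      have T: "T > R" "T > 0" using g R by (simp_all add: T_def y_def)
      obtain p where p: "p \<in> Xsp Q" "dX (c 0) p = R" "dX p y = dX (c 0) y - R"
        "dvec (c 0) p = (R / T) *\<^sub>R dvec (c 0) y"
        using segment_point[OF c0 y, of R] T R unfolding T_def by (metis less_imp_le)
      have pc: "dX p (c R) < 1" using near[of p] p by (simp add: y_def)
      obtain k where k: "k \<in> \<Gamma>" "\<And>i. \<bar>tlen (k i) - (2 * ln (norm (g i)) + 2 * ln (norm mid))\<bar> \<le> C"
        using C(2)[OF g(1) psl_subgroup_mid[OF \<Gamma>]] by blast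
      have comp: "\<bar>((1 / T) *\<^sub>R tvec k - w) $ i\<bar> \<le> B / R" for i
      proof -
        define D where "D = dH (c 0 i) (y i)"
        have H: "c 0 i \<in> H3" "c R i \<in> H3" "p i \<in> H3" "y i \<in> H3" "x i \<in> H3"
          using XspD(1) c0 cX[of R] p(1) y x R by auto
        have "dH (p i) (c R i) \<le> dX p (c R)"
          using component_le_norm_cart[of "dvec p (c R)" i] by (simp add: dX_eq_norm_dvec)
        then have d1: "dH (p i) (c R i) < 1" using pc by simp
        have e1: "dH (c 0 i) (p i) = (R / T) * D" using arg_cong[OF p(4), of "\<lambda>v. v $ i"] by (simp add: D_def)
        have e2: "dH (c 0 i) (c R i) = R * w $ i" using arg_cong[OF w(2)[of R], of "\<lambda>v. v $ i"] R by simp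
        \<comment> \<open>Closeness at distance \<open>R\<close> compares \<open>R\<close> times the
          two directions; dividing by \<open>R\<close> is what makes the error small.\<close>
        have "\<bar>(R / T) * D - R * w $ i\<bar> \<le> 1"
          using dH_triangle[OF H(3) H(1) H(2)] dH_triangle[OF H(2) H(1) H(3)] dH_commute[OF H(2) H(3)] d1 e1 e2
          by linarith
        moreover have "(R / T) * D - R * w $ i = R * (D / T - w $ i)" by (simp add: algebra_simps)
        ultimately have "R * \<bar>D / T - w $ i\<bar> \<le> 1" using R by (simp only: abs_mult abs_of_pos)
        then have 1: "\<bar>D / T - w $ i\<bar> \<le> 1 / R" using R by (simp add: pos_le_divide_eq mult.commute)
        have "\<bar>D - dH (x i) (y i)\<bar> \<le> dH (c 0 i) (x i)"
          unfolding D_def using dH_triangle[OF H(5) H(1) H(4)] dH_triangle[OF H(1) H(5) H(4)]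
            dH_commute[OF H(1) H(5)] by linarith
        moreover have "\<bar>dH (x i) (y i) - 2 * ln (norm (g i))\<bar> \<le> 2 * dH (x i) base + ln 2"
          unfolding y_def actX_def using displacement_ln_norm[OF psl_subgroup_mdet[OF \<Gamma> g(1)] H(5)] .
        moreover have "2 * dH (x i) base + dH (c 0 i) (x i)
            \<le> (\<Sum>i\<in>(UNIV::'n set). 2 * dH (x i) base + dH (c 0 i) (x i))"
          by (rule member_le_sum[where f = "\<lambda>i. 2 * dH (x i) base + dH (c 0 i) (x i)"])
            (auto intro!: add_nonneg_nonneg dH_nonneg XspD(1)[OF c0] XspD(1)[OF x])
        ultimately have "\<bar>tlen (k i) - D\<bar> \<le> B - 1" using k(2)[of i] unfolding B_def by linarith
        then have "\<bar>(tlen (k i) - D) / T\<bar> \<le> (B - 1) / T" using T by (simp add: divide_right_mono)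
        also have "\<dots> \<le> (B - 1) / R"
          using T R \<open>\<bar>tlen (k i) - D\<bar> \<le> B - 1\<close> by (intro divide_left_mono) auto
        finally have "\<bar>tlen (k i) / T - w $ i\<bar> \<le> (B - 1) / R + 1 / R"
          using 1 by (simp add: diff_divide_distrib)
        then show ?thesis by (simp flip: add_divide_distrib)
      qed
      have "norm ((1 / T) *\<^sub>R tvec k - w) \<le> (\<Sum>i\<in>UNIV. \<bar>((1 / T) *\<^sub>R tvec k - w) $ i\<bar>)"
        by (rule norm_le_l1_cart)
      also have "\<dots> \<le> (\<Sum>i\<in>(UNIV::'n set). B / R)" using comp by (rule sum_mono)
      finally have "norm ((1 / T) *\<^sub>R tvec k - w) \<le> CARD('n) * (B / R)" by simp
      moreover have "(1 / T) *\<^sub>R tvec k \<in> limit_cone \<Gamma>"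
        by (rule tvec_in_limit_cone[OF k(1)]) (use T(2) in simp)
      ultimately show ?thesis by blast
    qed
    have "w \<in> closure (limit_cone \<Gamma>)"
      unfolding closure_approachable
    proof (intro allI impI)
      fix e :: real assume e: "e > 0"
      define R where "R = CARD('n) * (\<bar>B\<bar> + 1) / e"
      have card: "0 < real CARD('n)" by simp
      have R: "R > 0" unfolding R_def using e card by (intro divide_pos_pos mult_pos_pos) auto
      have "CARD('n) * (B / R) < e"
      proof -
        have "CARD('n) * B < CARD('n) * (\<bar>B\<bar> + 1)" using card by (intro mult_strict_left_mono) auto
        also have "\<dots> = e * R" using e by (simp add: R_def)
        finally show ?thesis using R by (simp add: pos_divide_less_eq)
      qed
      then show "\<exists>v\<in>limit_cone \<Gamma>. dist v w < e"
        using key[OF R] unfolding dist_norm by (meson le_less_trans)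
    qed
    then show ?thesis using closed_limit_cone closure_closed by blast
  qed
  ultimately show ?thesis using uw w(1) by blast
qed

text \<open>A single \<open>tvec g\<close> approximates the direction \<open>u\<close>, and the
  orbit of \<open>x\<close> under the powers of \<open>g\<close> escapes to infinity in the
  direction of \<open>tvec g\<close>.\<close>

lemma proj_limit_set_supset:
  fixes \<Gamma> :: "('n::finite \<Rightarrow> mat2) set"
  assumes \<Gamma>: "psl_subgroup Q \<Gamma>" and x: "x \<in> Xsp Q"
    and u: "u \<in> limit_cone \<Gamma>" "norm u = 1" "\<And>i. u $ i > 0"
  shows "u \<in> proj_limit_set Q \<Gamma> x"
proof (rule in_proj_limit_setI[OF \<Gamma> x u(2,3)])
  fix N :: nat
  obtain un where un: "\<And>n. \<exists>t g. un n = t *\<^sub>R tvec g \<and> t \<ge> 0 \<and> g \<in> \<Gamma>" "un \<longlonglongrightarrow> u"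
    using u(1) unfolding limit_cone_eq_closure closure_sequential by blast
  have "u \<noteq> 0" using u(2) by auto
  then have "(\<lambda>n. sgn (un n)) \<longlonglongrightarrow> sgn u" using un(2) by (rule tendsto_sgn[rotated])
  moreover have "sgn u = u" using u(2) by (simp add: sgn_div_norm)
  ultimately have "\<forall>\<^sub>F n in sequentially. dist (sgn (un n)) u < 1 / Suc N"
    by (metis tendstoD of_nat_0_less_iff zero_less_Suc zero_less_divide_1_iff)
  moreover have "\<forall>\<^sub>F n in sequentially. un n \<noteq> 0"
    using un(2) \<open>u \<noteq> 0\<close> by (rule tendsto_imp_eventually_ne)
  ultimately have "\<forall>\<^sub>F n in sequentially. dist (sgn (un n)) u < 1 / Suc N \<and> un n \<noteq> 0"
    by (rule eventually_conj)
  then obtain n where n: "dist (sgn (un n)) u < 1 / Suc N" "un n \<noteq> 0"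
    unfolding eventually_sequentially by blast
  obtain t g where tg: "un n = t *\<^sub>R tvec g" "t \<ge> 0" "g \<in> \<Gamma>" using un(1) by blast
  have t: "t > 0" "tvec g \<noteq> 0" using tg n(2) by (auto simp: less_le)
  then have sgn_g: "dist (sgn (tvec g)) u < 1 / Suc N" using n(1) tg(1) by (simp add: sgn_scaleR)
  define y where "y m = actX (\<lambda>i. mpow (g i) m) x" for m
  have "(\<lambda>m. dH (x i) (y m i) / m) \<longlonglongrightarrow> tlen (g i)" for i
  proof -
    define e where "e m = dH (x i) (y m i) - 2 * ln (norm (mpow (g i) m))" for m
    define B where "B = 2 * dH (x i) base + ln 2"
    have e: "\<bar>e m\<bar> \<le> B" for m
      unfolding e_def B_def y_def actX_def
      by (rule displacement_ln_norm[OF mdet_mpow[OF psl_subgroup_mdet[OF \<Gamma> tg(3)]] XspD(1)[OF x]])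
    have "(\<lambda>n. B * (1 / real n)) \<longlonglongrightarrow> B * 0" by (intro tendsto_intros lim_1_over_n)
    then have "(\<lambda>n. B / real n) \<longlonglongrightarrow> 0" by simp
    then have "(\<lambda>m. e m / m) \<longlonglongrightarrow> 0"
    proof (rule Lim_null_comparison[rotated])
      show "\<forall>\<^sub>F n in sequentially. norm (e n / n) \<le> B / n"
        using e by (intro always_eventually allI) (simp add: divide_right_mono)
    qed
    then have "(\<lambda>m. e m / m + 2 * ln (norm (mpow (g i) m)) / m) \<longlonglongrightarrow> 0 + tlen (g i)"
      by (intro tendsto_add ln_norm_mpow_tendsto_tlen[OF psl_subgroup_mdet[OF \<Gamma> tg(3)]])
    then show ?thesis by (simp add: e_def flip: add_divide_distrib)
  qed
  then have lim: "(\<lambda>m. (1 / real m) *\<^sub>R dvec x (y m)) \<longlonglongrightarrow> tvec g"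
    by (intro vec_tendstoI) simp
  then have "(\<lambda>m. sgn ((1 / real m) *\<^sub>R dvec x (y m))) \<longlonglongrightarrow> sgn (tvec g)"
    using t(2) by (rule tendsto_sgn)
  then have "(\<lambda>m. dist (sgn ((1 / real m) *\<^sub>R dvec x (y m))) u) \<longlonglongrightarrow> dist (sgn (tvec g)) u"
    by (rule tendsto_dist[OF _ tendsto_const])
  then have ev1: "\<forall>\<^sub>F m in sequentially. dist (sgn ((1 / real m) *\<^sub>R dvec x (y m))) u < 1 / Suc N"
    using sgn_g by (rule order_tendstoD)
  have "(\<lambda>m. norm ((1 / real m) *\<^sub>R dvec x (y m))) \<longlonglongrightarrow> norm (tvec g)"
    by (intro tendsto_intros lim)
  then have ev2: "\<forall>\<^sub>F m in sequentially. norm ((1 / real m) *\<^sub>R dvec x (y m)) > norm (tvec g) / 2"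
    using t(2) by (intro order_tendstoD(1)) auto
  obtain m0 :: nat where m0: "m0 * (norm (tvec g) / 2) > N"
    using reals_Archimedean3[of "norm (tvec g) / 2"] t(2) by auto
  obtain m where m: "m \<ge> m0" "m > 0" "dist (sgn ((1 / real m) *\<^sub>R dvec x (y m))) u < 1 / Suc N"
    "norm ((1 / real m) *\<^sub>R dvec x (y m)) > norm (tvec g) / 2"
    using eventually_happens'[OF sequentially_bot eventually_conj[OF eventually_conj[OF ev1 ev2]
        eventually_conj[OF eventually_ge_at_top[of m0] eventually_gt_at_top[of 0]]]] by blast
  show "\<exists>g\<in>\<Gamma>. dX x (actX g x) > N \<and> norm (sgn (dvec x (actX g x)) - u) < 1 / Suc N"
  proof (intro bexI conjI)
    show "(\<lambda>i. mpow (g i) m) \<in> \<Gamma>" by (rule psl_subgroup_mpow[OF \<Gamma> tg(3)])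
    have "real N < m0 * (norm (tvec g) / 2)" by (rule m0)
    also have "\<dots> \<le> m * (norm (tvec g) / 2)" using m(1) by (intro mult_right_mono) auto
    also have "\<dots> < m * norm ((1 / real m) *\<^sub>R dvec x (y m))"
      using m(2,4) by (intro mult_strict_left_mono) auto
    also have "\<dots> = dX x (y m)" using m(2) by (simp add: dX_eq_norm_dvec)
    finally show "real N < dX x (actX (\<lambda>i. mpow (g i) m) x)" by (simp add: y_def)
    show "norm (sgn (dvec x (actX (\<lambda>i. mpow (g i) m) x)) - u) < 1 / Suc N"
      using m(2,3) by (simp add: y_def dist_norm sgn_scaleR)
  qed
qed

theorem theoremA:
  fixes Q :: "'n::finite set" and \<Gamma> :: "('n \<Rightarrow> mat2) set"
    and x :: "'n \<Rightarrow> complex \<times> real"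
  assumes "CARD('n) \<ge> 2"
    and "psl_subgroup Q \<Gamma>"
    and "nonelementary \<Gamma>"
    and "x \<in> Xsp Q"
  shows "(\<forall>u\<in>proj_limit_set Q \<Gamma> x. \<forall>v\<in>proj_limit_set Q \<Gamma> x.
            (\<forall>i. u $ i > 0 \<and> v $ i > 0) \<longrightarrow>
            (\<forall>s>0. sgn (u + s *\<^sub>R v) \<in> proj_limit_set Q \<Gamma> x))
       \<and> closure (proj_limit_set Q \<Gamma> x) = {sgn v | v. v \<in> limit_cone \<Gamma> \<and> v \<noteq> 0}
       \<and> convex (limit_cone \<Gamma>)"
proof -
  let ?P = "proj_limit_set Q \<Gamma> x" and ?L = "limit_cone \<Gamma>"
  \<comment> \<open>From here on only a closed cone matters that is stable under addition, has
    nonnegative entries and contains a positive vector.\<close>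
  have P: "u \<in> ?P \<longleftrightarrow> u \<in> ?L \<and> norm u = 1 \<and> (\<forall>i. u $ i > 0)" for u
    using proj_limit_set_subset[OF assms(2,3,4)] proj_limit_set_supset[OF assms(2,4)] by blast
  have scale: "r *\<^sub>R v \<in> ?L" if "v \<in> ?L" "r \<ge> 0" for r v
    using cone_limit_cone that unfolding cone_def by blast
  note add = limit_cone_add[OF assms(2,3)]
  have sgnL: "sgn v \<in> ?L" if "v \<in> ?L" for v
    using scale[OF that] by (simp add: sgn_div_norm)
  have sgnP: "sgn v \<in> ?P" if v: "v \<in> ?L" "\<And>i. v $ i > 0" for v
  proof -
    have "v \<noteq> 0" using v(2) by (metis less_irrefl zero_index)
    then show ?thesis unfolding P using sgnL[OF v(1)] v(2) by (simp add: norm_sgn sgn_div_norm)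
  qed
  have "sgn (u + s *\<^sub>R v) \<in> ?P" if "u \<in> ?P" "v \<in> ?P" "s > 0" for u v s
    using that by (intro sgnP add scale) (auto simp: P add_pos_pos)
  moreover have "closure ?P = {sgn v | v. v \<in> ?L \<and> v \<noteq> 0}"
  proof
    have eq: "{sgn v | v. v \<in> ?L \<and> v \<noteq> 0} = ?L \<inter> {v. norm v = 1}"
    proof (intro set_eqI iffI)
      fix v assume "v \<in> {sgn v | v. v \<in> ?L \<and> v \<noteq> 0}"
      then show "v \<in> ?L \<inter> {v. norm v = 1}" using sgnL by (auto simp: norm_sgn)
    next
      fix v assume v: "v \<in> ?L \<inter> {v. norm v = 1}"
      then have "v = sgn v" "v \<noteq> 0" by (auto simp: sgn_div_norm)
      then show "v \<in> {sgn v | v. v \<in> ?L \<and> v \<noteq> 0}" using v by blast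
    qed
    have "closed {v :: real ^ 'n. norm v = 1}" by (intro closed_Collect_eq continuous_intros)
    then have "closed (?L \<inter> {v. norm v = 1})" by (intro closed_Int closed_limit_cone)
    then show "closure ?P \<subseteq> {sgn v | v. v \<in> ?L \<and> v \<noteq> 0}"
      unfolding eq by (intro closure_minimal) (auto simp: P)
    show "{sgn v | v. v \<in> ?L \<and> v \<noteq> 0} \<subseteq> closure ?P"
    proof
      fix s assume "s \<in> {sgn v | v. v \<in> ?L \<and> v \<noteq> 0}"
      then obtain v where v: "s = sgn v" "v \<in> ?L" "v \<noteq> 0" by blast
      obtain w where w: "w \<in> ?L" "\<And>i. w $ i > 0" using limit_cone_positive_vector[OF assms(2,3)] by blast
      \<comment> \<open>Entries of \<open>v\<close> may vanish; adding a small multiple of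
        \<open>w\<close> makes them positive.\<close>
      have in_P: "sgn (v + (1 / Suc n) *\<^sub>R w) \<in> ?P" for n
      proof (rule sgnP)
        show "v + (1 / Suc n) *\<^sub>R w \<in> ?L" by (intro add scale v w) simp
        show "(v + (1 / Suc n) *\<^sub>R w) $ i > 0" for i
          using limit_cone_nonneg[OF assms(2) v(2), of i] w(2)[of i] by (simp add: add_nonneg_pos)
      qed
      have "(\<lambda>n. v + (1 / Suc n) *\<^sub>R w) \<longlonglongrightarrow> v + 0 *\<^sub>R w"
        by (intro tendsto_intros LIMSEQ_Suc[OF lim_1_over_n])
      then have lim: "(\<lambda>n. sgn (v + (1 / Suc n) *\<^sub>R w)) \<longlonglongrightarrow> sgn v"
        using v(3) by (intro tendsto_sgn) simp_all
      show "s \<in> closure ?P"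
        unfolding closure_sequential v(1)
        by (rule exI[of _ "\<lambda>n. sgn (v + (1 / Suc n) *\<^sub>R w)"]) (intro conjI allI in_P lim)
    qed
  qed
  moreover have "convex ?L" unfolding convex_def using add scale by blast
  ultimately show ?thesis by blast
qed

end
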